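(* Every propeller graph is determined by its $L$-spectrum; that is, if $G$ is a propeller graph and $H$ is any graph whose Laplacian matrix $L(H)$ has the same eigenvalues, counted with multiplicity, as $L(G)$, then $H$ is isomorphic to $G$.
   Context: All graphs are finite, undirected and simple. For a graph $G$ with adjacency matrix $A(G)$ and diagonal matrix of vertex degrees $D(G)$, the Laplacian matrix is $L(G)=D(G)-A(G)$. The $L$-spectrum of $G$ is the multiset of eigenvalues of $L(G)$. A graph $G$ is determined by its $L$-spectrum if no graph non-isomorphic to $G$ has the same $L$-spectrum. An $\infty$-graph is a graph consisting of two cycles with exactly one vertex in common. A propeller graph is a graph obtained from an $\infty$-graph by attaching a path to the vertex of degree $4$: it consists of cycles $C_p$ and $C_q$ ($p,q\ge 3$) sharing exactly one vertex $u$, together with a disjoint path $P_k$ on $k\ge 1$ vertices and one additional edge joining $u$ to an end vertex of $P_k$; it has $n=p+q+k-1$ vertices. *)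

theory Defs
  imports
    "Jordan_Normal_Form.Char_Poly"
    "Graph_Theory.Pair_Digraph"
    "Graph_Theory.Digraph_Isomorphism"
begin

text \<open>
  A finite simple undirected graph is a \<^locale>\<open>pair_graph\<close>: a finite vertex set with a
  symmetric, irreflexive set of arcs, where the two arcs \<open>(u, v)\<close> and \<open>(v, u)\<close> together
  represent the edge joining \<open>u\<close> and \<open>v\<close>.  Two graphs are isomorphic if the library's
  \<^const>\<open>digraph_iso\<close> relates them; for these graphs that is the usual notion, see
  \<open>digraph_iso_with_proj_iff\<close>.
\<close>

lemma digraph_iso_with_proj_iff:
  assumes "pair_graph G" "pair_graph H"
  shows "digraph_iso (with_proj G) (with_proj H) \<longleftrightarrow>
    (\<exists>f. bij_betw f (pverts G) (pverts H) \<and>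
      (\<forall>u\<in>pverts G. \<forall>v\<in>pverts G. (u, v) \<in> parcs G \<longleftrightarrow> (f u, f v) \<in> parcs H))"
    (is "?L \<longleftrightarrow> ?R")
proof
  interpret G: pair_graph G by fact
  interpret H: pair_graph H by fact
  have wfG: "wf_digraph (with_proj G)" by unfold_locales
  {
    assume ?L
    then obtain h where h: "pre_digraph.digraph_isomorphism (with_proj G) h"
      and H: "with_proj H = app_iso h (with_proj G)"
      unfolding digraph_iso_def by blast
    define f where "f = iso_verts h"
    have vH: "pverts H = f ` pverts G"
      using arg_cong[OF H, of verts] by (simp add: f_def)
    have aH: "parcs H = iso_arcs h ` parcs G"
      using arg_cong[OF H, of arcs] by simp
    have tl: "iso_tail h = fst" and hd: "iso_head h = snd"
      using arg_cong[OF H, of tail] arg_cong[OF H, of head] by simp_all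
    have inj: "inj_on f (pverts G)"
      using h by (simp add: pre_digraph.digraph_isomorphism_def f_def)
    have ia: "iso_arcs h e = (f (fst e), f (snd e))" if "e \<in> parcs G" for e
      using h that by (auto simp: pre_digraph.digraph_isomorphism_def f_def tl hd prod_eq_iff)
    have "(u, v) \<in> parcs G \<longleftrightarrow> (f u, f v) \<in> parcs H" if uv: "u \<in> pverts G" "v \<in> pverts G" for u v
    proof
      assume "(u, v) \<in> parcs G"
      then show "(f u, f v) \<in> parcs H" using ia[of "(u, v)"] by (force simp: aH)
    next
      assume "(f u, f v) \<in> parcs H"
      then obtain e where e: "e \<in> parcs G" "iso_arcs h e = (f u, f v)" by (auto simp: aH)
      then have "f (fst e) = f u" "f (snd e) = f v" using ia by auto
      moreover have "fst e \<in> pverts G" "snd e \<in> pverts G"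
        using e G.in_arcsD1[of "fst e" "snd e"] G.in_arcsD2[of "fst e" "snd e"] by simp_all
      ultimately have "e = (u, v)" using inj uv by (auto simp: prod_eq_iff dest: inj_onD)
      then show "(u, v) \<in> parcs G" using e by simp
    qed
    then show ?R using inj vH by (auto simp: bij_betw_def)
  }
  {
    assume ?R
    then obtain f where f: "bij_betw f (pverts G) (pverts H)"
      and fe: "\<And>u v. u \<in> pverts G \<Longrightarrow> v \<in> pverts G \<Longrightarrow> (u, v) \<in> parcs G \<longleftrightarrow> (f u, f v) \<in> parcs H"
      by blast
    have inj: "inj_on f (pverts G)" and im: "f ` pverts G = pverts H"
      using f by (auto simp: bij_betw_def)
    define h where "h = \<lparr>iso_verts = f, iso_arcs = map_prod f f, iso_head = snd, iso_tail = fst\<rparr>"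
    have sub: "parcs G \<subseteq> pverts G \<times> pverts G"
      using G.in_arcsD1 G.in_arcsD2 by auto
    have "inj_on (map_prod f f) (parcs G)"
      using inj_on_subset[OF map_prod_inj_on[OF inj inj] sub] .
    then have iso: "pre_digraph.digraph_isomorphism (with_proj G) h"
      using wfG inj by (auto simp: pre_digraph.digraph_isomorphism_def h_def)
    have "parcs H = map_prod f f ` parcs G"
    proof (intro equalityI subsetI)
      fix e assume e: "e \<in> parcs H"
      obtain x y where xy: "e = (x, y)" by (cases e)
      have "x \<in> f ` pverts G" "y \<in> f ` pverts G"
        using e xy H.in_arcsD1 H.in_arcsD2 im by auto
      then obtain u v where "u \<in> pverts G" "v \<in> pverts G" "x = f u" "y = f v" by auto
      then show "e \<in> map_prod f f ` parcs G"
        using e xy fe[of u v] by force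
    next
      fix e assume "e \<in> map_prod f f ` parcs G"
      then show "e \<in> parcs H" using fe sub by auto
    qed
    then have "with_proj H = app_iso h (with_proj G)"
      by (simp add: with_proj_def app_iso_def h_def im)
    then show ?L using iso unfolding digraph_iso_def by blast
  }
qed

section \<open>The Laplacian spectrum\<close>

text \<open>
  Matrices are indexed by natural numbers, so they are formed with respect to a list \<open>vs\<close>
  that enumerates the vertices without repetition.
\<close>

definition adjacency_mat :: "'a list \<Rightarrow> 'a pair_pre_digraph \<Rightarrow> real mat" where
  "adjacency_mat vs G = mat (length vs) (length vs)
     (\<lambda>(i, j). if (vs ! i, vs ! j) \<in> parcs G then 1 else 0)"

definition degree_mat :: "'a list \<Rightarrow> 'a pair_pre_digraph \<Rightarrow> real mat" where
  "degree_mat vs G = mat (length vs) (length vs)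
     (\<lambda>(i, j). if i = j then real (out_degree (with_proj G) (vs ! i)) else 0)"

definition laplacian_mat :: "'a list \<Rightarrow> 'a pair_pre_digraph \<Rightarrow> real mat" where
  "laplacian_mat vs G = degree_mat vs G - adjacency_mat vs G"

definition mat_spectrum :: "real mat \<Rightarrow> complex multiset" where
  \<comment> \<open>eigenvalues with algebraic multiplicity; they are taken in the complex numbers, where the
    characteristic polynomial of any matrix splits\<close>
  "mat_spectrum A = proots (char_poly (map_mat complex_of_real A))"

definition L_spectrum :: "'a pair_pre_digraph \<Rightarrow> complex multiset" where
  \<comment> \<open>the choice of the enumeration is immaterial, see \<open>L_spectrum_eq\<close>\<close>
  "L_spectrum G =
     mat_spectrum (laplacian_mat (SOME vs. distinct vs \<and> set vs = pverts G) G)"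

lemma char_poly_reindex:
  fixes A :: "'r :: idom mat"
  assumes A: "A \<in> carrier_mat n n" and p: "p permutes {0..<n}"
  shows "char_poly (mat n n (\<lambda>(i, j). A $$ (p i, p j))) = char_poly A"
proof -
  let ?C = "char_poly_matrix A"
  let ?R = "mat n n (\<lambda>(i, j). ?C $$ (p i, j))"
  have C: "?C \<in> carrier_mat n n" using A by simp
  have pn: "p i < n \<longleftrightarrow> i < n" for i using permutes_in_image[OF p, of i] by simp
  have pe: "p i = p j \<longleftrightarrow> i = j" for i j using permutes_inj[OF p] by (auto dest: injD)
  have "char_poly_matrix (mat n n (\<lambda>(i, j). A $$ (p i, p j)))
      = transpose_mat (mat n n (\<lambda>(i, j). transpose_mat ?R $$ (p i, j)))"
    using A by (intro eq_matI) (auto simp: char_poly_matrix_def pn pe)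
  then have "char_poly (mat n n (\<lambda>(i, j). A $$ (p i, p j)))
      = det (transpose_mat (mat n n (\<lambda>(i, j). transpose_mat ?R $$ (p i, j))))"
    by (simp add: char_poly_def)
  also have "\<dots> = det (mat n n (\<lambda>(i, j). transpose_mat ?R $$ (p i, j)))"
    by (rule det_transpose[OF mat_carrier])
  also have "\<dots> = signof p * det (transpose_mat ?R)"
    by (rule det_permute_rows[OF _ p]) simp
  also have "det (transpose_mat ?R) = det ?R"
    by (rule det_transpose[OF mat_carrier])
  also have "det ?R = signof p * det ?C"
    by (rule det_permute_rows[OF C p])
  also have "signof p * (signof p * det ?C) = det ?C"
    by (simp add: sign_def)
  finally show ?thesis by (simp add: char_poly_def)
qed

lemma L_spectrum_eq:
  assumes vs: "distinct vs" "set vs = pverts G"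
  shows "L_spectrum G = mat_spectrum (laplacian_mat vs G)"
proof -
  let ?n = "length vs"
  define ws where "ws = (SOME vs. distinct vs \<and> set vs = pverts G)"
  have ws: "distinct ws \<and> set ws = pverts G"
    unfolding ws_def by (rule someI[of _ vs]) (use vs in simp)
  have "mset ws = mset vs" using ws vs set_eq_iff_mset_eq_distinct[of ws vs] by simp
  then obtain p where p: "p permutes {..<?n}" and pw: "permute_list p vs = ws"
    by (rule mset_eq_permutation)
  have p': "p permutes {0..<?n}" using p by (simp add: atLeast0LessThan)
  have len: "length ws = ?n" using pw by auto
  have nth: "ws ! i = vs ! p i" if "i < ?n" for i
    using permute_list_nth[OF p that] pw by simp
  have pn: "p i < ?n \<longleftrightarrow> i < ?n" for i using permutes_in_image[OF p, of i] by simp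
  have pe: "p i = p j \<longleftrightarrow> i = j" for i j using permutes_inj[OF p] by (auto dest: injD)
  let ?A = "map_mat complex_of_real (laplacian_mat vs G)"
  have A: "?A \<in> carrier_mat ?n ?n"
    unfolding laplacian_mat_def degree_mat_def adjacency_mat_def
    by (intro map_carrier_mat[THEN iffD2] minus_carrier_mat mat_carrier)
  have "map_mat complex_of_real (laplacian_mat ws G) = mat ?n ?n (\<lambda>(i, j). ?A $$ (p i, p j))"
    unfolding laplacian_mat_def degree_mat_def adjacency_mat_def len
    by (rule eq_matI) (simp_all add: nth pn pe)
  then show ?thesis
    using char_poly_reindex[OF A p'] by (simp add: L_spectrum_def mat_spectrum_def ws_def)
qed

section \<open>Propeller graphs\<close>

fun path_arcs :: "'a list \<Rightarrow> ('a \<times> 'a) set" where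
  "path_arcs (x # y # xs) = {(x, y), (y, x)} \<union> path_arcs (y # xs)"
| "path_arcs _ = {}"

definition cycle_arcs :: "'a list \<Rightarrow> ('a \<times> 'a) set" where
  "cycle_arcs xs = path_arcs xs \<union> {(last xs, hd xs), (hd xs, last xs)}"

text \<open>
  \<open>cs\<close> and \<open>ds\<close> list the vertices of the two cycles and \<open>ps\<close> those of the path, each in
  the order in which they are traversed; \<open>u\<close> is the common vertex of the two cycles.
\<close>

definition propeller_graph :: "'a pair_pre_digraph \<Rightarrow> bool" where
  "propeller_graph G \<longleftrightarrow>
     (\<exists>cs ds ps u.
        distinct cs \<and> length cs \<ge> 3 \<and>
        distinct ds \<and> length ds \<ge> 3 \<and>
        distinct ps \<and> length ps \<ge> 1 \<and>
        set cs \<inter> set ds = {u} \<and>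
        set ps \<inter> (set cs \<union> set ds) = {} \<and>
        pverts G = set cs \<union> set ds \<union> set ps \<and>
        parcs G = cycle_arcs cs \<union> cycle_arcs ds \<union> path_arcs ps \<union> {(u, hd ps), (hd ps, u)})"

lemma path_arcs_subset: "path_arcs xs \<subseteq> set xs \<times> set xs"
  by (induction xs rule: path_arcs.induct) auto

lemma sym_path_arcs: "sym (path_arcs xs)"
  by (induction xs rule: path_arcs.induct) (auto simp: sym_def)

lemma path_arcs_irrefl: "distinct xs \<Longrightarrow> (x, x) \<notin> path_arcs xs"
  by (induction xs rule: path_arcs.induct) auto

lemma cycle_arcs_subset: "xs \<noteq> [] \<Longrightarrow> cycle_arcs xs \<subseteq> set xs \<times> set xs"
  using path_arcs_subset[of xs] by (auto simp: cycle_arcs_def)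

lemma sym_cycle_arcs: "sym (cycle_arcs xs)"
  using sym_path_arcs[of xs] by (auto simp: cycle_arcs_def sym_def)

lemma cycle_arcs_irrefl: "distinct xs \<Longrightarrow> length xs \<ge> 3 \<Longrightarrow> (x, x) \<notin> cycle_arcs xs"
  using path_arcs_irrefl[of xs x] by (cases xs) (auto simp: cycle_arcs_def split: if_splits)

lemma propeller_graph_imp_pair_graph:
  assumes "propeller_graph G"
  shows "pair_graph G"
proof -
  obtain cs ds ps u where *: "distinct cs" "length cs \<ge> 3" "distinct ds" "length ds \<ge> 3"
    "distinct ps" "length ps \<ge> 1" "set cs \<inter> set ds = {u}"
    "set ps \<inter> (set cs \<union> set ds) = {}"
    and V: "pverts G = set cs \<union> set ds \<union> set ps"
    and E: "parcs G = cycle_arcs cs \<union> cycle_arcs ds \<union> path_arcs ps \<union> {(u, hd ps), (hd ps, u)}"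
    using assms unfolding propeller_graph_def by blast
  have ne: "cs \<noteq> []" "ds \<noteq> []" "ps \<noteq> []" using * by auto
  have h: "hd ps \<in> set ps" using ne by simp
  have u: "u \<in> set cs" using * by auto
  have sub: "parcs G \<subseteq> pverts G \<times> pverts G"
    using cycle_arcs_subset[OF ne(1)] cycle_arcs_subset[OF ne(2)] path_arcs_subset[of ps] h u
    unfolding E V by blast
  have fin: "finite (parcs G)"
    by (rule finite_subset[OF sub]) (simp add: V)
  have sy: "sym (parcs G)"
    unfolding E by (intro sym_Un sym_cycle_arcs sym_path_arcs) (auto simp: sym_def)
  have un: "hd ps \<noteq> u" using h u *(8) by blast
  have "(x, x) \<notin> parcs G" for x
    using cycle_arcs_irrefl[OF *(1,2), of x] cycle_arcs_irrefl[OF *(3,4), of x]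
      path_arcs_irrefl[OF *(5), of x] un unfolding E by simp
  then have irr: "fst e \<noteq> snd e" if "e \<in> parcs G" for e
    using that by (cases e) auto
  show ?thesis
  proof unfold_locales
    show "fst e \<in> pverts G" "snd e \<in> pverts G" if "e \<in> parcs G" for e
      using sub that by auto
    show "finite (pverts G)" by (simp add: V)
    show "finite (parcs G)" by (rule fin)
    show "symmetric (with_proj G)" using sy by (simp add: symmetric_def)
    show "fst e \<noteq> snd e" if "e \<in> parcs G" for e using irr that .
  qed
qed

end

theory Submission
  imports Defs "HOL-Real_Asymp.Real_Asymp"
begin

text \<open>
  \<^bold>\<open>Why the theorem holds.\<close>  Let \<open>G\<close> be a propeller graph with cycles of lengths \<open>p\<close>, \<open>q\<close> and
  a path of \<open>k\<close> vertices, and let \<open>H\<close> be cospectral with \<open>G\<close>.  The proof finds the degrees of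
  \<open>H\<close>, concludes that \<open>H\<close> is a propeller graph as well, and recovers \<open>p\<close>, \<open>q\<close>, \<open>k\<close> from the
  characteristic polynomial.

  \<^bold>\<open>Degrees.\<close>  Cospectral symmetric matrices are orthogonally similar
  (\<open>symmetric_cospectral_imp_orthogonally_similar\<close>), so there is a linear isometry between the
  functions on the vertices of \<open>H\<close> and of \<open>G\<close> that preserves the Laplacian form, and the traces
  of the first three powers of the two Laplacians agree (\<open>cospectral_isometry\<close>).
  The kernel of the form is one-dimensional for \<open>G\<close>, hence for \<open>H\<close>, so \<open>H\<close> is connected.
  With \<open>e = d - 2\<close> for a degree \<open>d\<close>, the traces say that \<open>\<Sum>e = 2\<close>, \<open>\<Sum>e\<^sup>2 = 10\<close> and
  \<open>\<Sum>e\<^sup>3 \<ge> 14\<close>, because \<open>G\<close> has at most two triangles.  These sums leave two cases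
  (\<open>degree_defects\<close>): \<open>H\<close> has the degrees of \<open>G\<close>, or it has two vertices of degree 4 and no
  triangles.  In the second case the form of \<open>H\<close> is at least \<open>4|x|\<^sup>2\<close> on a plane, supported
  around the two vertices of degree 4 (\<open>two_hubs_energy\<close>).  But for \<open>G\<close> it is less than
  \<open>4|x|\<^sup>2\<close> for every nonzero function \<open>x\<close> that vanishes at the vertex of degree 5
  (\<open>energy_hyperplane\<close>).  These functions form a hyperplane, and a plane contains a nonzero
  element of any hyperplane: the second case is impossible.

  \<^bold>\<open>Structure.\<close>  A connected graph with one vertex of degree 5, one of degree 1 and all others
  of degree 2 is a propeller graph (\<open>propeller_structure\<close>): without the vertex of degree 5 it
  falls apart into paths, one of which contains the leaf.

  \<^bold>\<open>Parameters.\<close>  Write an argument \<open>x < 0\<close> of the characteristic polynomial as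
  \<open>x = 2 - 2 cosh 2t\<close>.  Gaussian elimination along the paths gives \<open>det (L - x)\<close> explicitly
  (\<open>propeller_fun_eq_det\<close>): up to a factor independent of \<open>p\<close>, \<open>q\<close>, \<open>k\<close> it is
  \<open>sinh 2pt sinh 2qt cosh Kt (2 tanh pt + 2 tanh qt + tanh Kt - 3 tanh t)\<close>, where
  \<open>K = 2k + 1\<close>.  Multiplied by \<open>cosh t\<close>, this is a linear combination of functions \<open>sinh ft\<close>
  with integers \<open>f\<close>.  Its behaviour as \<open>t\<close> tends to 0 gives \<open>pq\<close>, the number of spanning trees,
  and \<open>2(p + q) + K\<close> is known from the number of vertices.  If the smaller cycle lengths of two
  propeller graphs with the same characteristic polynomial were different, then the one with the
  shorter cycle would also have the shorter path, and the largest \<open>f\<close> at which the two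
  combinations can differ would occur for it alone (\<open>propeller_fun_inj\<close>).
\<close>

section \<open>Orthogonal similarity of cospectral symmetric matrices\<close>

definition orthogonal_matrix :: "nat \<Rightarrow> real mat \<Rightarrow> bool" where
  "orthogonal_matrix n Q \<longleftrightarrow> Q \<in> carrier_mat n n \<and> Q\<^sup>T * Q = 1\<^sub>m n"

lemma orthogonal_matrixD:
  assumes "orthogonal_matrix n Q"
  shows "Q \<in> carrier_mat n n" "Q\<^sup>T * Q = 1\<^sub>m n" "Q * Q\<^sup>T = 1\<^sub>m n"
  using assms mat_mult_left_right_inverse[of "Q\<^sup>T" n Q] by (auto simp: orthogonal_matrix_def)

lemma orthogonal_matrix_transpose:
  assumes "orthogonal_matrix n Q" shows "orthogonal_matrix n Q\<^sup>T"
  using orthogonal_matrixD[OF assms] by (auto simp: orthogonal_matrix_def)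

lemma orthogonal_matrix_mult:
  assumes "orthogonal_matrix n P" "orthogonal_matrix n Q"
  shows "orthogonal_matrix n (P * Q)"
proof -
  note P = orthogonal_matrixD[OF assms(1)] and Q = orthogonal_matrixD[OF assms(2)]
  have "(P * Q)\<^sup>T * (P * Q) = Q\<^sup>T * P\<^sup>T * (P * Q)"
    using P(1) Q(1) by (simp add: transpose_mult)
  also have "\<dots> = Q\<^sup>T * (P\<^sup>T * (P * Q))"
    by (rule assoc_mult_mat) (use P(1) Q(1) in auto)
  also have "P\<^sup>T * (P * Q) = P\<^sup>T * P * Q"
    by (rule assoc_mult_mat[symmetric]) (use P(1) Q(1) in auto)
  finally show ?thesis using P Q by (simp add: orthogonal_matrix_def)
qed

text \<open>
  For an eigenvector \<open>v\<close> of \<open>z\<close>, symmetry lets \<open>A\<close> be moved from one side of the Hermitian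
  product of \<open>A v\<close> and \<open>v\<close> to the other, so that \<open>z |v|\<^sup>2\<close> equals its own conjugate.
\<close>

lemma symmetric_complex_eigenvalue_real:
  fixes A :: "real mat"
  assumes A: "A \<in> carrier_mat n n" and sym: "A\<^sup>T = A"
    and ev: "eigenvalue (map_mat complex_of_real A) z"
  shows "z \<in> \<real>"
proof -
  let ?A = "map_mat complex_of_real A"
  have cA: "?A \<in> carrier_mat n n" using A by simp
  obtain v where v: "v \<in> carrier_vec n" "v \<noteq> 0\<^sub>v n" and Av: "?A *\<^sub>v v = z \<cdot>\<^sub>v v"
    using ev cA by (auto simp: eigenvalue_def eigenvector_def)
  have symA: "?A\<^sup>T = ?A"
    using arg_cong[OF sym, of "map_mat complex_of_real"] by (simp add: map_mat_transpose)
  have cv: "conjugate v \<in> carrier_vec n" using v by simp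
  have cnj: "conjugate (?A *\<^sub>v v) = ?A *\<^sub>v conjugate v"
  proof (rule eq_vecI)
    fix i assume "i < dim_vec (?A *\<^sub>v conjugate v)"
    then have i: "i < n" using A by simp
    show "conjugate (?A *\<^sub>v v) $ i = (?A *\<^sub>v conjugate v) $ i"
      using i A v by (simp add: scalar_prod_def)
  qed (use A in simp)
  have "z * (v \<bullet>c v) = (?A *\<^sub>v v) \<bullet>c v"
    using v by (simp add: Av)
  also have "\<dots> = v \<bullet> (?A *\<^sub>v conjugate v)"
    using transpose_vec_mult_scalar[OF cA cv v(1)] by (simp add: symA)
  also have "\<dots> = v \<bullet>c (z \<cdot>\<^sub>v v)" by (simp add: cnj[symmetric] Av)
  also have "\<dots> = cnj z * (v \<bullet>c v)"
    using v by (simp add: conjugate_smult_vec)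
  finally have "z = cnj z"
    using conjugate_square_eq_0_vec[OF v(1)] v(2) by simp
  then show ?thesis by (simp add: complex_is_Real_iff complex_eq_iff)
qed

lemma symmetric_real_eigenvalue_exists:
  fixes A :: "real mat"
  assumes A: "A \<in> carrier_mat n n" and sym: "A\<^sup>T = A" and n: "n > 0"
  shows "\<exists>e. eigenvalue A e"
proof -
  let ?A = "map_mat complex_of_real A"
  have cA: "?A \<in> carrier_mat n n" using A by simp
  have "degree (char_poly ?A) = n" using degree_monic_char_poly[OF cA] by simp
  then have "\<not> constant (poly (char_poly ?A))" using n by (simp add: constant_degree)
  then obtain z where z: "poly (char_poly ?A) z = 0"
    using fundamental_theorem_of_algebra by blast
  then have "eigenvalue ?A z" using eigenvalue_root_char_poly[OF cA] by simp
  then obtain e where e: "z = complex_of_real e"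
    using symmetric_complex_eigenvalue_real[OF A sym] by (auto elim: Reals_cases)
  have "char_poly ?A = map_poly complex_of_real (char_poly A)"
    by (rule of_real_hom.char_poly_hom[OF A])
  then have "poly (char_poly A) e = 0"
    using z by (simp add: e)
  then show ?thesis using eigenvalue_root_char_poly[OF A] by auto
qed

text \<open>
  The Householder reflection that exchanges \<open>v\<close> and the first unit vector \<open>e\<close>: its matrix is
  \<open>1 - c w w\<^sup>T\<close> with \<open>w = v - e\<close>, and \<open>w \<bullet> w = 2 - 2 v $ 0\<close> makes \<open>c = 1 / (1 - v $ 0)\<close>
  the constant for which it is orthogonal.
\<close>

lemma householder:
  fixes v :: "real vec"
  assumes v: "v \<in> carrier_vec n" and n: "n > 0" and unit: "v \<bullet> v = 1"
  shows "\<exists>W. orthogonal_matrix n W \<and> col W 0 = v"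
proof (cases "v = unit_vec n 0")
  case True
  show ?thesis
    by (rule exI[of _ "1\<^sub>m n"]) (use n True in \<open>auto simp: orthogonal_matrix_def\<close>)
next
  case False
  have s: "(\<Sum>i<n. (v $ i)^2) = 1"
    using unit v by (simp add: scalar_prod_def power2_eq_square atLeast0LessThan)
  define w where "w i = v $ i - (if i = 0 then 1 else 0)" for i
  \<comment> \<open>for a unit vector, \<open>w \<bullet> w = 2 - 2 v $ 0\<close>, so that \<open>c (w \<bullet> w) = 2\<close>\<close>
  define c where "c = 1 / (1 - v $ 0)"
  have "(\<Sum>i<n. (w i)^2) = (\<Sum>i<n. (v $ i)^2 + (if i = 0 then 1 - 2 * v $ 0 else 0))"
    by (rule sum.cong) (auto simp: w_def power2_eq_square algebra_simps)
  also have "\<dots> = 2 - 2 * v $ 0" using n s by (simp add: sum.distrib)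
  finally have w2: "(\<Sum>i<n. (w i)^2) = 2 - 2 * v $ 0" .
  have v0: "v $ 0 \<noteq> 1"
  proof
    assume "v $ 0 = 1"
    then have "(\<Sum>i<n. (w i)^2) = 0" using w2 by simp
    then have "w i = 0" if "i < n" for i using that by (simp add: sum_nonneg_eq_0_iff)
    then have "v = unit_vec n 0" using v by (intro eq_vecI) (auto simp: w_def)
    then show False using False by simp
  qed
  define W where "W = mat n n (\<lambda>(i,j). (if i = j then 1 else 0) - c * w i * w j)"
  have W: "W \<in> carrier_mat n n" by (simp add: W_def)
  have WT: "W\<^sup>T = W" by (rule eq_matI) (auto simp: W_def)
  have "W * W = 1\<^sub>m n"
  proof (rule eq_matI)
    fix i j assume "i < dim_row (1\<^sub>m n)" "j < dim_col (1\<^sub>m n)"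
    then have ij: "i < n" "j < n" by auto
    have "(W * W) $$ (i,j) = (\<Sum>k<n. ((if i = k then 1 else 0) - c * w i * w k) * ((if k = j then 1 else 0) - c * w k * w j))"
      using ij by (simp add: W_def scalar_prod_def atLeast0LessThan)
    also have "\<dots> = (\<Sum>k<n. (if k = i then (if i = j then 1 else 0) - c * w i * w j else 0)
        - (if k = j then c * w i * w j else 0) + c^2 * w i * w j * (w k)^2)"
      by (rule sum.cong) (auto simp: algebra_simps power2_eq_square)
    also have "\<dots> = (if i = j then 1 else 0) - 2 * c * w i * w j + c^2 * w i * w j * (2 - 2 * v $ 0)"
      using ij by (simp add: sum.distrib sum_subtractf sum_distrib_left[symmetric] w2)
    also have "c^2 * w i * w j * (2 - 2 * v $ 0) = c * w i * w j * (c * (2 - 2 * v $ 0))"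
      by (simp only: power2_eq_square mult_ac)
    also have "c * (2 - 2 * v $ 0) = 2" using v0 by (simp add: c_def field_simps)
    finally show "(W * W) $$ (i,j) = 1\<^sub>m n $$ (i,j)" using ij by simp
  qed (auto simp: W_def)
  moreover have "col W 0 = v"
  proof (rule eq_vecI)
    fix i assume "i < dim_vec v"
    then have i: "i < n" using v by simp
    have "c * w 0 = -1" using v0 by (simp add: c_def w_def field_simps)
    then have "c * w i * w 0 = - w i" by (metis mult.assoc mult.commute mult_minus1_right)
    then show "col W 0 $ i = v $ i" using i n by (simp add: W_def w_def)
  qed (use W v in auto)
  ultimately show ?thesis using W WT by (auto simp: orthogonal_matrix_def)
qed

text \<open>
  Change to an orthonormal basis that begins with a unit eigenvector.  This makes the first column
  a multiple of the unit vector, and symmetry then clears the first row.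
\<close>

lemma symmetric_deflation:
  fixes A :: "real mat"
  assumes A: "A \<in> carrier_mat (Suc n) (Suc n)" and sym: "A\<^sup>T = A" and ev: "eigenvalue A e"
  shows "\<exists>W A'. orthogonal_matrix (Suc n) W \<and> A' \<in> carrier_mat n n \<and> A'\<^sup>T = A' \<and>
    W\<^sup>T * A * W = four_block_mat (mat 1 1 (\<lambda>_. e)) (0\<^sub>m 1 n) (0\<^sub>m n 1) A'"
proof -
  obtain x where x: "x \<in> carrier_vec (Suc n)" "x \<noteq> 0\<^sub>v (Suc n)" and Ax: "A *\<^sub>v x = e \<cdot>\<^sub>v x"
    using ev A by (auto simp: eigenvalue_def eigenvector_def)
  have xx: "x \<bullet> x > 0" using conjugate_square_greater_0_vec[OF x(1)] x by simp
  define v where "v = (1 / sqrt (x \<bullet> x)) \<cdot>\<^sub>v x"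
  have v: "v \<in> carrier_vec (Suc n)" using x by (simp add: v_def)
  have vv: "v \<bullet> v = 1" using x xx by (simp add: v_def power2_eq_square[symmetric] power_divide)
  have Av: "A *\<^sub>v v = e \<cdot>\<^sub>v v"
    using x A by (simp add: v_def mult_mat_vec Ax smult_smult_assoc mult.commute)
  obtain W where oW: "orthogonal_matrix (Suc n) W" and Wv: "col W 0 = v"
    using householder[OF v _ vv] by auto
  note W = orthogonal_matrixD[OF oW]
  define B where "B = W\<^sup>T * A * W"
  have B: "B \<in> carrier_mat (Suc n) (Suc n)" using W(1) A by (auto simp: B_def)
  have "B\<^sup>T = W\<^sup>T * (W\<^sup>T * A)\<^sup>T"
    unfolding B_def by (rule transpose_mult) (use W(1) A in auto)
  also have "(W\<^sup>T * A)\<^sup>T = A\<^sup>T * W"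
    using transpose_mult[of "W\<^sup>T" "Suc n" "Suc n" A "Suc n"] W(1) A by simp
  also have "W\<^sup>T * (A\<^sup>T * W) = B"
    unfolding sym B_def by (rule assoc_mult_mat[symmetric]) (use W(1) A in auto)
  finally have BT: "B\<^sup>T = B" .
  have "col B 0 = (W\<^sup>T * A) *\<^sub>v v"
    unfolding B_def by (subst col_mult2[of _ "Suc n" "Suc n" _ "Suc n"]) (use W(1) A Wv in auto)
  also have "\<dots> = W\<^sup>T *\<^sub>v (A *\<^sub>v v)" using W(1) A v by (intro assoc_mult_mat_vec) auto
  also have "\<dots> = e \<cdot>\<^sub>v (W\<^sup>T *\<^sub>v v)" using W(1) v by (simp add: Av mult_mat_vec)
  also have "W\<^sup>T *\<^sub>v v = col (W\<^sup>T * W) 0"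
    by (subst col_mult2[of _ "Suc n" "Suc n" _ "Suc n"]) (use W(1) Wv in auto)
  also have "\<dots> = unit_vec (Suc n) 0" by (simp add: W)
  finally have colB: "col B 0 = e \<cdot>\<^sub>v unit_vec (Suc n) 0" .
  have B0: "B $$ (i, 0) = (if i = 0 then e else 0)" if "i < Suc n" for i
    using arg_cong[OF colB, of "\<lambda>v. v $ i"] that B by simp
  have Bs: "B $$ (i, j) = B $$ (j, i)" if "i < Suc n" "j < Suc n" for i j
    using arg_cong[OF BT, of "\<lambda>M. M $$ (i, j)"] that B by simp
  define A' where "A' = mat n n (\<lambda>(i,j). B $$ (Suc i, Suc j))"
  have "A'\<^sup>T = A'" using Bs by (intro eq_matI) (auto simp: A'_def)
  moreover have "B = four_block_mat (mat 1 1 (\<lambda>_. e)) (0\<^sub>m 1 n) (0\<^sub>m n 1) A'"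
  proof (rule eq_matI)
    fix i j assume "i < dim_row (four_block_mat (mat 1 1 (\<lambda>_. e)) (0\<^sub>m 1 n) (0\<^sub>m n 1) A')"
      "j < dim_col (four_block_mat (mat 1 1 (\<lambda>_. e)) (0\<^sub>m 1 n) (0\<^sub>m n 1) A')"
    then have "i < Suc n" "j < Suc n" by (auto simp: A'_def)
    then show "B $$ (i,j) = four_block_mat (mat 1 1 (\<lambda>_. e)) (0\<^sub>m 1 n) (0\<^sub>m n 1) A' $$ (i,j)"
      using B0[of i] B0[of j] Bs[of i j] by (cases i; cases j) (auto simp: A'_def)
  qed (use B in \<open>auto simp: A'_def\<close>)
  moreover have "A' \<in> carrier_mat n n" by (simp add: A'_def)
  ultimately show ?thesis using oW unfolding B_def by blast
qed

text \<open>
  The two matrices have a real eigenvalue in common.  Splitting it off from both and cancelling the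
  common factor of the characteristic polynomials leaves smaller matrices that are again
  symmetric and cospectral.  Carrying out the induction on a pair of matrices means that the
  eigenvalues need not be listed in any order.
\<close>

theorem symmetric_cospectral_imp_orthogonally_similar:
  fixes A B :: "real mat"
  assumes "A \<in> carrier_mat n n" "A\<^sup>T = A" "B \<in> carrier_mat n n" "B\<^sup>T = B" "char_poly A = char_poly B"
  shows "\<exists>R. orthogonal_matrix n R \<and> A = R\<^sup>T * B * R"
  using assms
proof (induction n arbitrary: A B)
  case 0
  then show ?case by (intro exI[of _ "1\<^sub>m 0"]) (auto simp: orthogonal_matrix_def)
next
  case (Suc n)
  obtain e where e: "eigenvalue A e"
    using symmetric_real_eigenvalue_exists[OF Suc.prems(1,2)] by auto
  then have e': "eigenvalue B e"
    using Suc.prems by (simp add: eigenvalue_root_char_poly)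
  let ?D = "\<lambda>A'. four_block_mat (mat 1 1 (\<lambda>_. e)) (0\<^sub>m 1 n) (0\<^sub>m n 1) A'"
  obtain V A' where V: "orthogonal_matrix (Suc n) V" and A': "A' \<in> carrier_mat n n" "A'\<^sup>T = A'"
    and VA: "V\<^sup>T * A * V = ?D A'"
    using symmetric_deflation[OF Suc.prems(1,2) e] by blast
  obtain W B' where W: "orthogonal_matrix (Suc n) W" and B': "B' \<in> carrier_mat n n" "B'\<^sup>T = B'"
    and WB: "W\<^sup>T * B * W = ?D B'"
    using symmetric_deflation[OF Suc.prems(3,4) e'] by blast
  note V' = orthogonal_matrixD[OF V] and W' = orthogonal_matrixD[OF W]
  have conj_inverse: "U * (U\<^sup>T * C * U) * U\<^sup>T = C"
    if U: "orthogonal_matrix (Suc n) U" and C: "C \<in> carrier_mat (Suc n) (Suc n)" for U C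
  proof -
    note U' = orthogonal_matrixD[OF U]
    have "U * (U\<^sup>T * C * U) * U\<^sup>T = (U * U\<^sup>T) * C * (U * U\<^sup>T)"
      using U'(1) C by (simp add: assoc_mult_mat[of _ "Suc n" "Suc n" _ "Suc n" _ "Suc n"])
    then show ?thesis using U' C by simp
  qed
  have cp: "char_poly C = char_poly (mat 1 1 (\<lambda>_. e)) * char_poly C'"
    if U: "orthogonal_matrix (Suc n) U" and C: "C \<in> carrier_mat (Suc n) (Suc n)" and C': "C' \<in> carrier_mat n n"
     and UC: "U\<^sup>T * C * U = ?D C'" for U C C'
  proof -
    note U' = orthogonal_matrixD[OF U]
    have "similar_mat_wit C (?D C') U U\<^sup>T"
      using U' C conj_inverse[OF U C] C' unfolding similar_mat_wit_def Let_def UC by auto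
    then have "char_poly C = char_poly (?D C')" by (intro char_poly_similar) (auto simp: similar_mat_def)
    also have "\<dots> = char_poly (mat 1 1 (\<lambda>_. e)) * char_poly C'"
      by (rule char_poly_four_block_zeros_col) (use C' in auto)
    finally show ?thesis .
  qed
  have "char_poly (mat 1 1 (\<lambda>_. e)) \<noteq> 0"
    using degree_monic_char_poly[of "mat 1 1 (\<lambda>_. e)" 1] by force
  then have "char_poly A' = char_poly B'"
    using cp[OF V Suc.prems(1) A'(1) VA] cp[OF W Suc.prems(3) B'(1) WB] Suc.prems(5) by simp
  then obtain R' where R': "orthogonal_matrix n R'" and AB: "A' = R'\<^sup>T * B' * R'"
    using Suc.IH[OF A' B'] by blast
  note R'' = orthogonal_matrixD[OF R']
  \<comment> \<open>the matrix from the induction hypothesis, extended by the identity on the eigenvector\<close>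
  define S where "S = four_block_mat (1\<^sub>m 1) (0\<^sub>m 1 n) (0\<^sub>m n 1) R'"
  have S: "S \<in> carrier_mat (Suc n) (Suc n)" using R''(1) by (auto simp: S_def)
  have ST: "S\<^sup>T = four_block_mat (1\<^sub>m 1) (0\<^sub>m 1 n) (0\<^sub>m n 1) R'\<^sup>T"
    using R''(1) unfolding S_def by (subst transpose_four_block_mat[of _ 1 1 _ n _ n]) auto
  have "S\<^sup>T * S = four_block_mat (1\<^sub>m 1) (0\<^sub>m 1 n) (0\<^sub>m n 1) (1\<^sub>m n)"
    using R'' unfolding ST unfolding S_def by (subst mult_four_block_mat[of _ 1 1 _ n _ n _ _ 1 _ n]) auto
  also have "\<dots> = 1\<^sub>m (Suc n)" by (rule eq_matI) auto
  finally have oS: "orthogonal_matrix (Suc n) S" using S by (simp add: orthogonal_matrix_def)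
  have D: "?D B' \<in> carrier_mat (Suc n) (Suc n)" using B' by auto
  have "S\<^sup>T * ?D B' = four_block_mat (mat 1 1 (\<lambda>_. e)) (0\<^sub>m 1 n) (0\<^sub>m n 1) (R'\<^sup>T * B')"
    using R''(1) B' unfolding ST by (subst mult_four_block_mat[of _ 1 1 _ n _ n _ _ 1 _ n]) auto
  then have "S\<^sup>T * ?D B' * S = ?D (R'\<^sup>T * B' * R')"
    using R''(1) B' unfolding S_def by (simp, subst mult_four_block_mat[of _ 1 1 _ n _ n _ _ 1 _ n]) auto
  then have SD: "?D A' = S\<^sup>T * (W\<^sup>T * B * W) * S" by (simp add: AB WB)
  define R where "R = W * (S * V\<^sup>T)"
  have oR: "orthogonal_matrix (Suc n) R"
    unfolding R_def by (intro orthogonal_matrix_mult W oS orthogonal_matrix_transpose V)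
  have "R\<^sup>T = (S * V\<^sup>T)\<^sup>T * W\<^sup>T"
    unfolding R_def by (rule transpose_mult) (use V'(1) W'(1) S in auto)
  also have "(S * V\<^sup>T)\<^sup>T = V * S\<^sup>T"
    using transpose_mult[of S "Suc n" "Suc n" "V\<^sup>T" "Suc n"] V'(1) S by simp
  finally have RT: "R\<^sup>T = V * S\<^sup>T * W\<^sup>T" .
  have "A = V * (S\<^sup>T * (W\<^sup>T * B * W) * S) * V\<^sup>T"
    using conj_inverse[OF V Suc.prems(1)] unfolding VA SD by (rule sym)
  also have "\<dots> = R\<^sup>T * B * R"
    using V'(1) W'(1) S Suc.prems(3) unfolding RT unfolding R_def
    by (simp add: assoc_mult_mat[of _ "Suc n" "Suc n" _ "Suc n" _ "Suc n"])
  finally show ?case using oR by blast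
qed

section \<open>The Laplacian of a graph on an initial segment of the naturals\<close>

text \<open>
  A finite simple graph with the vertices \<open>0, \<dots>, n - 1\<close>, the form that a graph takes once its
  vertices are enumerated.
\<close>

locale nat_graph =
  fixes n :: nat and A :: "nat \<Rightarrow> nat \<Rightarrow> bool"
  assumes adj_sym: "A i j \<Longrightarrow> A j i" and adj_less: "A i j \<Longrightarrow> i < n" and adj_irrefl: "\<not> A i i"

definition deg :: "(nat \<Rightarrow> nat \<Rightarrow> bool) \<Rightarrow> nat \<Rightarrow> nat" where
  "deg A i = card {j. A i j}"

definition laplacian :: "nat \<Rightarrow> (nat \<Rightarrow> nat \<Rightarrow> bool) \<Rightarrow> real mat" where
  "laplacian n A = mat n n (\<lambda>(i, j). if i = j then real (deg A i) else if A i j then - 1 else 0)"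

context nat_graph
begin

lemma adj_less2: "A i j \<Longrightarrow> j < n"
  using adj_sym adj_less by blast

lemma adj_commute: "A i j \<longleftrightarrow> A j i"
  using adj_sym by blast

lemma adj_neq: "A i j \<Longrightarrow> i \<noteq> j"
  using adj_irrefl by blast

lemma nbrs_subset: "{j. A i j} \<subseteq> {..<n}"
  using adj_less2 by auto

lemma finite_nbrs [simp]: "finite {j. A i j}"
  by (rule finite_subset[OF nbrs_subset]) simp

lemma sum_nbrs: "(\<Sum>j<n. if A i j then f j else 0) = (\<Sum>j | A i j. f j)"
proof -
  have "{..<n} \<inter> {j. A i j} = {j. A i j}" using nbrs_subset by auto
  then show ?thesis by (simp add: sum.If_cases)
qed

lemma laplacian_carrier: "laplacian n A \<in> carrier_mat n n"
  by (simp add: laplacian_def)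

lemma laplacian_transpose: "(laplacian n A)\<^sup>T = laplacian n A"
  by (rule eq_matI) (auto simp: laplacian_def adj_commute)

lemma laplacian_row_sum:
  assumes "i < n"
  shows "(\<Sum>j<n. laplacian n A $$ (i, j) * h j) = real (deg A i) * h i - (\<Sum>j | A i j. h j)"
proof -
  have "(\<Sum>j<n. laplacian n A $$ (i, j) * h j) = (\<Sum>j<n. (if j = i then real (deg A i) * h i else 0) - (if A i j then h j else 0))"
    by (rule sum.cong) (use assms in \<open>auto simp: laplacian_def adj_irrefl\<close>)
  then show ?thesis using assms by (simp add: sum_subtractf sum_nbrs)
qed

end

definition mat_trace :: "'a :: semiring_0 mat \<Rightarrow> 'a" where
  "mat_trace M = (\<Sum>i<dim_row M. M $$ (i, i))"

lemma mat_trace_mult_commute: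
  fixes X Y :: "'a :: comm_semiring_0 mat"
  assumes "X \<in> carrier_mat n n" "Y \<in> carrier_mat n n"
  shows "mat_trace (X * Y) = mat_trace (Y * X)"
proof -
  have e: "mat_trace (X * Y) = (\<Sum>i<n. \<Sum>j<n. X $$ (i, j) * Y $$ (j, i))"
    if "X \<in> carrier_mat n n" "Y \<in> carrier_mat n n" for X Y :: "'a mat"
    using that by (simp add: mat_trace_def scalar_prod_def atLeast0LessThan)
  show ?thesis unfolding e[OF assms] e[OF assms(2,1)]
    by (subst sum.swap) (simp add: mult.commute)
qed

lemma mat_trace_conj:
  assumes R: "orthogonal_matrix n R" and M: "M \<in> carrier_mat n n"
  shows "mat_trace (R\<^sup>T * M * R) = mat_trace M"
proof -
  note R' = orthogonal_matrixD[OF R]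
  have "mat_trace (R\<^sup>T * M * R) = mat_trace (R * (R\<^sup>T * M))"
    by (rule mat_trace_mult_commute) (use R'(1) M in auto)
  also have "R * (R\<^sup>T * M) = R * R\<^sup>T * M"
    by (rule assoc_mult_mat[symmetric]) (use R'(1) M in auto)
  also have "\<dots> = M" using R' M by simp
  finally show ?thesis .
qed

lemma conj_mult:
  assumes R: "orthogonal_matrix n R" and M: "M \<in> carrier_mat n n" and N: "N \<in> carrier_mat n n"
  shows "(R\<^sup>T * M * R) * (R\<^sup>T * N * R) = R\<^sup>T * (M * N) * R"
proof -
  note R' = orthogonal_matrixD[OF R]
  note assoc = assoc_mult_mat[of _ n n _ n _ n]
  have "(R\<^sup>T * M * R) * (R\<^sup>T * N * R) = R\<^sup>T * M * (R * R\<^sup>T) * (N * R)"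
    using R'(1) M N by (simp add: assoc)
  also have "\<dots> = R\<^sup>T * (M * N) * R"
    using R' M N by (simp add: assoc)
  finally show ?thesis .
qed

text \<open>
  The triples are ordered, so each triangle of the graph is counted six times.
\<close>

definition triangles :: "(nat \<Rightarrow> nat \<Rightarrow> bool) \<Rightarrow> (nat \<times> nat \<times> nat) set" where
  "triangles A = {(i, j, l). A i j \<and> A j l \<and> A i l}"

text \<open>
  This is twice the Laplacian form, as every edge is counted in both directions.
\<close>

definition energy :: "(nat \<Rightarrow> nat \<Rightarrow> bool) \<Rightarrow> (nat \<Rightarrow> real) \<Rightarrow> real" where
  "energy A x = (\<Sum>(i, j)\<in>{(i, j). A i j}. (x i - x j)\<^sup>2)"

context nat_graph
begin

abbreviation L :: "real mat" where "L \<equiv> laplacian n A"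

lemma arcs_Sigma: "{(i, j). A i j} = Sigma {..<n} (\<lambda>i. {j. A i j})"
  using adj_less by auto

lemma finite_arcs [simp]: "finite {(i, j). A i j}"
  unfolding arcs_Sigma by (rule finite_SigmaI) auto

lemma sum_arcs: "(\<Sum>(i, j)\<in>{(i, j). A i j}. f i j) = (\<Sum>i<n. \<Sum>j | A i j. f i j)"
  unfolding arcs_Sigma by (simp add: sum.Sigma)

lemma sum_arcs_swap: "(\<Sum>(i, j)\<in>{(i, j). A i j}. f i j) = (\<Sum>(i, j)\<in>{(i, j). A i j}. f j i)"
  by (rule sum.reindex_bij_witness[of _ prod.swap prod.swap]) (auto simp: adj_commute)

lemma sum_arcs_fst: "(\<Sum>(i, j)\<in>{(i, j). A i j}. f i) = (\<Sum>i<n. of_nat (deg A i) * (f i :: 'b :: semiring_1))"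
  by (subst sum_arcs) (simp add: deg_def)

lemma sum_arcs_snd: "(\<Sum>(i, j)\<in>{(i, j). A i j}. f j) = (\<Sum>i<n. of_nat (deg A i) * (f i :: 'b :: semiring_1))"
  by (subst sum_arcs_swap) (rule sum_arcs_fst)

lemma laplacian_index: "i < n \<Longrightarrow> j < n \<Longrightarrow> L $$ (i, j) = (if i = j then real (deg A i) else if A i j then - 1 else 0)"
  by (simp add: laplacian_def)

lemma laplacian_mult_index:
  assumes "M \<in> carrier_mat n n" "i < n" "j < n"
  shows "(L * M) $$ (i, j) = real (deg A i) * M $$ (i, j) - (\<Sum>l | A i l. M $$ (l, j))"
proof -
  have "(L * M) $$ (i, j) = (\<Sum>l<n. L $$ (i, l) * M $$ (l, j))"
    using assms laplacian_carrier by (simp add: scalar_prod_def atLeast0LessThan)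
  also have "\<dots> = real (deg A i) * M $$ (i, j) - (\<Sum>l | A i l. M $$ (l, j))"
    by (rule laplacian_row_sum[OF assms(2)])
  finally show ?thesis .
qed

lemma trace_laplacian: "mat_trace L = (\<Sum>i<n. real (deg A i))"
  by (simp add: mat_trace_def laplacian_def)

lemma laplacian_square_diag: "i < n \<Longrightarrow> (L * L) $$ (i, i) = real (deg A i)^2 + real (deg A i)"
proof -
  assume i: "i < n"
  have "(\<Sum>l | A i l. L $$ (l, i)) = (\<Sum>l | A i l. - 1)"
    using i adj_less2 adj_neq adj_sym by (intro sum.cong) (auto simp: laplacian_index)
  then show ?thesis using i by (simp add: laplacian_mult_index laplacian_carrier laplacian_index power2_eq_square deg_def)
qed

lemma trace_laplacian_square: "mat_trace (L * L) = (\<Sum>i<n. real (deg A i)^2) + (\<Sum>i<n. real (deg A i))"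
  using laplacian_carrier by (simp add: mat_trace_def laplacian_square_diag sum.distrib del: index_mult_mat(1))

text \<open>
  Only entries of \<open>L\<^sup>2\<close> at adjacent positions enter the trace of \<open>L\<^sup>3\<close>; they count the
  triangles on the edge.
\<close>

lemma laplacian_square_adj:
  assumes "A i j"
  shows "(L * L) $$ (j, i) = real (card {l. A j l \<and> A i l}) - real (deg A i) - real (deg A j)"
proof -
  have ij: "i < n" "j < n" "i \<noteq> j" "A j i" using assms adj_less adj_less2 adj_neq adj_sym by auto
  have "(\<Sum>l | A j l. L $$ (l, i)) = (\<Sum>l | A j l. (if l = i then real (deg A i) else 0) - (if A i l then 1 else 0))"
    using ij adj_less2 adj_irrefl by (intro sum.cong) (auto simp: laplacian_index adj_commute)
  also have "\<dots> = real (deg A i) - real (card {l. A j l \<and> A i l})"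
  proof -
    have "(\<Sum>l | A j l. if A i l then 1 else 0) = (\<Sum>l\<in>{l \<in> {l. A j l}. A i l}. 1 :: real)"
      by (rule sum.inter_filter[symmetric]) simp
    moreover have "(\<Sum>l | A j l. if l = i then real (deg A i) else 0) = real (deg A i)"
      using ij by simp
    ultimately show ?thesis by (simp add: sum_subtractf)
  qed
  finally show ?thesis using ij by (simp add: laplacian_mult_index laplacian_carrier laplacian_index)
qed

lemma card_triangles: "card (triangles A) = (\<Sum>(i, j)\<in>{(i, j). A i j}. card {l. A j l \<and> A i l})"
proof -
  let ?S = "Sigma {(i, j). A i j} (\<lambda>(i, j). {l. A j l \<and> A i l})"
  have "triangles A = (\<lambda>((i, j), l). (i, j, l)) ` ?S"
    unfolding triangles_def image_def by auto
  moreover have "inj_on (\<lambda>((i, j), l). (i, j, l)) ?S" by (auto simp: inj_on_def)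
  ultimately have "card (triangles A) = card ?S" by (simp only: card_image)
  also have "\<dots> = (\<Sum>e\<in>{(i, j). A i j}. card ((\<lambda>(i, j). {l. A j l \<and> A i l}) e))"
    by (rule card_SigmaI) auto
  finally show ?thesis by (simp add: case_prod_unfold)
qed

lemma trace_laplacian_cube:
  "mat_trace (L * (L * L)) = (\<Sum>i<n. real (deg A i)^3) + 3 * (\<Sum>i<n. real (deg A i)^2) - real (card (triangles A))"
proof -
  have LL: "L * L \<in> carrier_mat n n" using laplacian_carrier by simp
  have "mat_trace (L * (L * L)) = (\<Sum>i<n. real (deg A i) * (real (deg A i)^2 + real (deg A i)) - (\<Sum>j | A i j. (L * L) $$ (j, i)))"
    using laplacian_carrier by (simp add: mat_trace_def laplacian_mult_index[OF LL] laplacian_square_diag del: index_mult_mat(1))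
  also have "\<dots> = (\<Sum>i<n. real (deg A i)^3 + real (deg A i)^2) - (\<Sum>(i, j)\<in>{(i, j). A i j}. (L * L) $$ (j, i))"
    by (subst sum_arcs) (simp add: sum_subtractf power2_eq_square power3_eq_cube algebra_simps del: index_mult_mat(1))
  also have "(\<Sum>(i, j)\<in>{(i, j). A i j}. (L * L) $$ (j, i)) =
     (\<Sum>(i, j)\<in>{(i, j). A i j}. real (card {l. A j l \<and> A i l})) - (\<Sum>(i, j)\<in>{(i, j). A i j}. real (deg A i)) - (\<Sum>(i, j)\<in>{(i, j). A i j}. real (deg A j))"
    unfolding sum_subtractf[symmetric] by (rule sum.cong) (auto simp: laplacian_square_adj simp del: index_mult_mat(1))
  also have "(\<Sum>(i, j)\<in>{(i, j). A i j}. real (card {l. A j l \<and> A i l})) = real (card (triangles A))"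
    by (simp add: card_triangles case_prod_unfold)
  also have "(\<Sum>(i, j)\<in>{(i, j). A i j}. real (deg A i)) = (\<Sum>i<n. real (deg A i)^2)"
    by (subst sum_arcs_fst) (simp add: power2_eq_square)
  also have "(\<Sum>(i, j)\<in>{(i, j). A i j}. real (deg A j)) = (\<Sum>i<n. real (deg A i)^2)"
    by (subst sum_arcs_snd) (simp add: power2_eq_square)
  finally show ?thesis by (simp add: sum.distrib)
qed

lemma energy_eq_form:
  assumes "v \<in> carrier_vec n"
  shows "energy A (\<lambda>i. v $ i) = 2 * (v \<bullet> (L *\<^sub>v v))"
proof -
  have "v \<bullet> (L *\<^sub>v v) = (\<Sum>i<n. v $ i * (\<Sum>j<n. L $$ (i, j) * v $ j))"
    using assms laplacian_carrier by (simp add: scalar_prod_def atLeast0LessThan)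
  also have "\<dots> = (\<Sum>i<n. real (deg A i) * (v $ i)^2) - (\<Sum>i<n. \<Sum>j | A i j. v $ i * v $ j)"
    unfolding sum_subtractf[symmetric]
  proof (rule sum.cong)
    fix i assume "i \<in> {..<n}"
    then have "(\<Sum>j<n. L $$ (i, j) * v $ j) = real (deg A i) * v $ i - (\<Sum>j | A i j. v $ j)"
      by (intro laplacian_row_sum) simp
    then show "v $ i * (\<Sum>j<n. L $$ (i, j) * v $ j) = real (deg A i) * (v $ i)^2 - (\<Sum>j | A i j. v $ i * v $ j)"
      by (simp add: right_diff_distrib sum_distrib_left power2_eq_square)
  qed simp
  finally have form: "v \<bullet> (L *\<^sub>v v) = (\<Sum>i<n. real (deg A i) * (v $ i)^2) - (\<Sum>(i, j)\<in>{(i, j). A i j}. v $ i * v $ j)"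
    by (simp only: sum_arcs)
  have "energy A (\<lambda>i. v $ i) = (\<Sum>(i, j)\<in>{(i, j). A i j}. (v $ i)^2) + (\<Sum>(i, j)\<in>{(i, j). A i j}. (v $ j)^2)
     - (\<Sum>(i, j)\<in>{(i, j). A i j}. 2 * (v $ i * v $ j))"
    unfolding energy_def sum_subtractf[symmetric] sum.distrib[symmetric]
    by (rule sum.cong) (auto simp: power2_eq_square algebra_simps)
  also have "\<dots> = 2 * (\<Sum>i<n. real (deg A i) * (v $ i)^2) - 2 * (\<Sum>(i, j)\<in>{(i, j). A i j}. v $ i * v $ j)"
  proof -
    have "(\<Sum>(i, j)\<in>{(i, j). A i j}. (v $ i)^2) = (\<Sum>i<n. real (deg A i) * (v $ i)^2)"
      by (rule sum_arcs_fst)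
    moreover have "(\<Sum>(i, j)\<in>{(i, j). A i j}. (v $ j)^2) = (\<Sum>i<n. real (deg A i) * (v $ i)^2)"
      by (rule sum_arcs_snd)
    moreover have "(\<Sum>(i, j)\<in>{(i, j). A i j}. 2 * (v $ i * v $ j)) = 2 * (\<Sum>(i, j)\<in>{(i, j). A i j}. v $ i * v $ j)"
      by (subst sum_distrib_left) (rule sum.cong, auto)
    ultimately show ?thesis by linarith
  qed
  finally show ?thesis unfolding form by (simp only: right_diff_distrib)
qed

lemma energy_cong: "(\<And>i. i < n \<Longrightarrow> x i = y i) \<Longrightarrow> energy A x = energy A y"
  unfolding energy_def
proof (rule sum.cong)
  fix e assume eq: "\<And>i. i < n \<Longrightarrow> x i = y i" and "e \<in> {(i, j). A i j}"
  then obtain i j where e: "e = (i, j)" "A i j" by blast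
  have "x i = y i" "x j = y j" using eq[OF adj_less[OF e(2)]] eq[OF adj_less2[OF e(2)]] .
  then show "(case e of (i, j) \<Rightarrow> (x i - x j)\<^sup>2) = (case e of (i, j) \<Rightarrow> (y i - y j)\<^sup>2)" by (simp add: e)
qed simp

lemma energy_0_iff: "energy A x = 0 \<longleftrightarrow> (\<forall>i j. A i j \<longrightarrow> x i = x j)"
proof -
  have "energy A x = 0 \<longleftrightarrow> (\<forall>e\<in>{(i, j). A i j}. (case e of (i, j) \<Rightarrow> (x i - x j)\<^sup>2) = 0)"
    unfolding energy_def by (rule sum_nonneg_eq_0_iff[OF finite_arcs]) (simp add: case_prod_unfold)
  then show ?thesis by simp
qed

end

text \<open>
  These five statements are what the determination of the degrees uses of the spectrum.  Here \<open>r\<close>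
  is an orthogonal matrix that conjugates the one Laplacian into the other.
\<close>

theorem cospectral_isometry:
  assumes "nat_graph n A" "nat_graph n B"
    and cp: "char_poly (laplacian n B) = char_poly (laplacian n A)"
  obtains r where
    "\<And>x. (\<Sum>i<n. (\<Sum>j<n. r i j * x j)\<^sup>2) = (\<Sum>i<n. (x i)\<^sup>2)"
    "\<And>x. energy A (\<lambda>i. \<Sum>j<n. r i j * x j) = energy B x"
    "(\<Sum>i<n. real (deg B i)) = (\<Sum>i<n. real (deg A i))"
    "(\<Sum>i<n. real (deg B i)^2) = (\<Sum>i<n. real (deg A i)^2)"
    "(\<Sum>i<n. real (deg B i)^3) - real (card (triangles B)) = (\<Sum>i<n. real (deg A i)^3) - real (card (triangles A))"
proof -
  interpret A: nat_graph n A by fact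
  interpret B: nat_graph n B by fact
  obtain R where R: "orthogonal_matrix n R" and LB: "laplacian n B = R\<^sup>T * laplacian n A * R"
    using symmetric_cospectral_imp_orthogonally_similar[OF B.laplacian_carrier B.laplacian_transpose
        A.laplacian_carrier A.laplacian_transpose cp] by blast
  note R' = orthogonal_matrixD[OF R]
  have t1: "mat_trace (laplacian n B) = mat_trace (laplacian n A)"
    unfolding LB by (rule mat_trace_conj[OF R A.laplacian_carrier])
  have LL: "laplacian n A * laplacian n A \<in> carrier_mat n n" using A.laplacian_carrier by simp
  have LB2: "laplacian n B * laplacian n B = R\<^sup>T * (laplacian n A * laplacian n A) * R"
    unfolding LB by (rule conj_mult[OF R A.laplacian_carrier A.laplacian_carrier])
  have t2: "mat_trace (laplacian n B * laplacian n B) = mat_trace (laplacian n A * laplacian n A)"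
    unfolding LB2 by (rule mat_trace_conj[OF R LL])
  have LB3: "laplacian n B * (laplacian n B * laplacian n B) = R\<^sup>T * (laplacian n A * (laplacian n A * laplacian n A)) * R"
    unfolding LB2 unfolding LB by (rule conj_mult[OF R A.laplacian_carrier LL])
  have t3: "mat_trace (laplacian n B * (laplacian n B * laplacian n B)) = mat_trace (laplacian n A * (laplacian n A * laplacian n A))"
    unfolding LB3 by (rule mat_trace_conj[OF R]) (use A.laplacian_carrier in auto)
  define r where "r i j = R $$ (i, j)" for i j
  have Rv: "(\<Sum>j<n. r i j * x j) = (R *\<^sub>v vec n x) $ i" if "i < n" for x i
    using that R'(1) by (simp add: r_def scalar_prod_def atLeast0LessThan)
  have norm: "(\<Sum>i<n. (\<Sum>j<n. r i j * x j)\<^sup>2) = (\<Sum>i<n. (x i)\<^sup>2)" for x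
  proof -
    have v: "vec n x \<in> carrier_vec n" by simp
    have Rx: "R *\<^sub>v vec n x \<in> carrier_vec n" using R'(1) by simp
    have "(\<Sum>i<n. (\<Sum>j<n. r i j * x j)\<^sup>2) = (R *\<^sub>v vec n x) \<bullet> (R *\<^sub>v vec n x)"
      using R'(1) by (simp add: scalar_prod_def[of _ "R *\<^sub>v vec n x"] Rv power2_eq_square atLeast0LessThan)
    also have "\<dots> = (R\<^sup>T *\<^sub>v (R *\<^sub>v vec n x)) \<bullet> vec n x"
      by (rule transpose_vec_mult_scalar[OF R'(1) v Rx, symmetric])
    also have "R\<^sup>T *\<^sub>v (R *\<^sub>v vec n x) = (R\<^sup>T * R) *\<^sub>v vec n x"
      by (rule assoc_mult_mat_vec[symmetric]) (use R'(1) in auto)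
    also have "\<dots> = vec n x" by (simp add: R'(2))
    finally show ?thesis by (simp add: scalar_prod_def power2_eq_square atLeast0LessThan)
  qed
  have en: "energy A (\<lambda>i. \<Sum>j<n. r i j * x j) = energy B x" for x
  proof -
    have v: "vec n x \<in> carrier_vec n" by simp
    have Rx: "R *\<^sub>v vec n x \<in> carrier_vec n" using R'(1) by simp
    have LRx: "laplacian n A *\<^sub>v (R *\<^sub>v vec n x) \<in> carrier_vec n"
      by (rule mult_mat_vec_carrier[OF A.laplacian_carrier Rx])
    have "energy A (\<lambda>i. \<Sum>j<n. r i j * x j) = energy A (\<lambda>i. (R *\<^sub>v vec n x) $ i)"
      by (rule A.energy_cong) (rule Rv)
    also have "\<dots> = 2 * ((R *\<^sub>v vec n x) \<bullet> (laplacian n A *\<^sub>v (R *\<^sub>v vec n x)))"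
      by (rule A.energy_eq_form[OF Rx])
    also have "(R *\<^sub>v vec n x) \<bullet> (laplacian n A *\<^sub>v (R *\<^sub>v vec n x)) = (laplacian n A *\<^sub>v (R *\<^sub>v vec n x)) \<bullet> (R *\<^sub>v vec n x)"
      by (rule comm_scalar_prod[OF Rx LRx])
    also have "\<dots> = (R\<^sup>T *\<^sub>v (laplacian n A *\<^sub>v (R *\<^sub>v vec n x))) \<bullet> vec n x"
      by (rule transpose_vec_mult_scalar[OF R'(1) v LRx, symmetric])
    also have "R\<^sup>T *\<^sub>v (laplacian n A *\<^sub>v (R *\<^sub>v vec n x)) = laplacian n B *\<^sub>v vec n x"
      unfolding LB using R'(1) A.laplacian_carrier by (simp add: assoc_mult_mat_vec[of _ n n _ n])
    also have "(laplacian n B *\<^sub>v vec n x) \<bullet> vec n x = vec n x \<bullet> (laplacian n B *\<^sub>v vec n x)"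
      by (rule comm_scalar_prod) (use B.laplacian_carrier in auto)
    also have "2 * \<dots> = energy B (\<lambda>i. vec n x $ i)"
      by (rule B.energy_eq_form[OF v, symmetric])
    also have "\<dots> = energy B x" by (rule B.energy_cong) simp
    finally show ?thesis .
  qed
  note T = A.trace_laplacian B.trace_laplacian A.trace_laplacian_square
    B.trace_laplacian_square A.trace_laplacian_cube B.trace_laplacian_cube
  have s1: "(\<Sum>i<n. real (deg B i)) = (\<Sum>i<n. real (deg A i))" using t1 unfolding T .
  have s2: "(\<Sum>i<n. real (deg B i)^2) = (\<Sum>i<n. real (deg A i)^2)" using t2 s1 unfolding T by linarith
  have s3: "(\<Sum>i<n. real (deg B i)^3) - real (card (triangles B)) = (\<Sum>i<n. real (deg A i)^3) - real (card (triangles A))"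
    using t3 s2 unfolding T by linarith
  show ?thesis by (rule that[of r, OF norm en s1 s2 s3])
qed

section \<open>Propeller graphs on the naturals\<close>

text \<open>
  The two cycles without their common vertex are the intervals \<open>{0..<a}\<close> and \<open>{a..<a+b}\<close>, so
  the cycles have lengths \<open>a + 1\<close> and \<open>b + 1\<close>.  The path is \<open>{a+b..<a+b+k}\<close>, counted from the
  leaf, and \<open>a + b + k\<close> is the common vertex.  Putting the leaf first and the common vertex last
  is the order in which the elimination below proceeds.
\<close>

definition propeller_adj :: "nat \<Rightarrow> nat \<Rightarrow> nat \<Rightarrow> nat \<Rightarrow> nat \<Rightarrow> bool" where
  "propeller_adj a b k i j \<longleftrightarrow>
     (j = Suc i \<or> i = Suc j) \<and>
       (i < a \<and> j < a \<or> a \<le> i \<and> i < a+b \<and> a \<le> j \<and> j < a+b \<or>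
        a+b \<le> i \<and> i < a+b+k \<and> a+b \<le> j \<and> j < a+b+k) \<or>
     i = a+b+k \<and> j \<in> {0, a-1, a, a+b-1, a+b+k-1} \<or>
     j = a+b+k \<and> i \<in> {0, a-1, a, a+b-1, a+b+k-1}"

locale propeller =
  fixes a b k :: nat
  assumes a: "a \<ge> 2" and b: "b \<ge> 2" and k: "k \<ge> 1"
begin

abbreviation hub :: nat where "hub \<equiv> a + b + k"
abbreviation Adj :: "nat \<Rightarrow> nat \<Rightarrow> bool" where "Adj \<equiv> propeller_adj a b k"

lemma adj_cycle1:
  assumes "i < a"
  shows "Adj i j \<longleftrightarrow> (j = Suc i \<or> i = Suc j) \<and> j < a \<or> j = hub \<and> (i = 0 \<or> i = a-1)"
proof -
  have "\<not> a \<le> i" "\<not> a+b \<le> i" "i \<noteq> hub" "i \<noteq> a" "i \<noteq> a+b-1" "i \<noteq> hub-1" using assms b k by arith+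
  then show ?thesis unfolding propeller_adj_def using assms by blast
qed

lemma adj_cycle2:
  assumes "a \<le> i" "i < a+b"
  shows "Adj i j \<longleftrightarrow> (j = Suc i \<or> i = Suc j) \<and> a \<le> j \<and> j < a+b \<or> j = hub \<and> (i = a \<or> i = a+b-1)"
proof -
  have "\<not> i < a" "\<not> a+b \<le> i" "i \<noteq> hub" "i \<noteq> 0" "i \<noteq> a-1" "i \<noteq> hub-1" using assms a k by arith+
  then show ?thesis unfolding propeller_adj_def using assms by blast
qed

lemma adj_path:
  assumes "a+b \<le> i" "i < hub"
  shows "Adj i j \<longleftrightarrow> (j = Suc i \<or> i = Suc j) \<and> a+b \<le> j \<and> j < hub \<or> j = hub \<and> i = hub-1"
proof -
  have "\<not> i < a" "\<not> i < a+b" "i \<noteq> hub" "i \<noteq> 0" "i \<noteq> a-1" "i \<noteq> a" "i \<noteq> a+b-1" using assms a b by arith+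
  then show ?thesis unfolding propeller_adj_def using assms by blast
qed

lemma adj_hub: "Adj hub j \<longleftrightarrow> j \<in> {0, a-1, a, a+b-1, hub-1}"
proof -
  have "\<not> hub < a" "\<not> hub < a+b" "\<not> hub < hub" "hub \<noteq> 0" "hub \<noteq> a-1" "hub \<noteq> a" "hub \<noteq> a+b-1" "hub \<noteq> hub-1"
    using a b k by arith+
  then show ?thesis unfolding propeller_adj_def by blast
qed

lemma adj_range:
  assumes "Adj i j" shows "i \<le> hub" "i \<noteq> j"
proof -
  have *: "0 \<le> hub" "a-1 \<le> hub" "a \<le> hub" "a+b-1 \<le> hub" "hub-1 \<le> hub" by arith+
  have **: "hub \<notin> {0, a-1, a, a+b-1, hub-1}" using a b k by auto
  have "i < hub \<or> i = hub \<or> i \<in> {0, a-1, a, a+b-1, hub-1}"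
    using assms unfolding propeller_adj_def by linarith
  then show "i \<le> hub" using * by auto
  show "i \<noteq> j"
  proof
    assume "i = j"
    then have "i = hub" "i \<in> {0, a-1, a, a+b-1, hub-1}" using assms unfolding propeller_adj_def by auto
    then show False using ** by simp
  qed
qed

sublocale nat_graph "Suc hub" Adj
proof
  show "Adj j i" if "Adj i j" for i j using that unfolding propeller_adj_def by blast
  show "i < Suc hub" if "Adj i j" for i j using adj_range(1)[OF that] by simp
  show "\<not> Adj i i" for i using adj_range(2) by blast
qed

lemma nbrs_cycle1: "i < a \<Longrightarrow> {j. Adj i j} = {if i = 0 then hub else i-1, if i = a-1 then hub else Suc i}"
  by (cases i) (auto simp: adj_cycle1)

lemma nbrs_cycle2: 
  assumes "a \<le> i" "i < a+b"
  shows "{j. Adj i j} = {if i = a then hub else i-1, if i = a+b-1 then hub else Suc i}"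
proof -
  obtain m where "i = a + m" using assms le_Suc_ex by blast
  then show ?thesis using assms by (cases m) (auto simp: adj_cycle2)
qed

lemma nbrs_path: 
  assumes "a+b \<le> i" "i < hub"
  shows "{j. Adj i j} = (if i = a+b then {Suc i} else {i-1, Suc i})"
proof -
  obtain m where "i = a + b + m" using assms le_Suc_ex by blast
  then show ?thesis using assms by (cases m) (auto simp: adj_path)
qed

lemma nbrs_hub: "{j. Adj hub j} = {0, a-1, a, a+b-1, hub-1}"
  by (auto simp only: adj_hub)

lemma nbrs_hub_distinct: "distinct [0, a-1, a, a+b-1, hub-1]"
proof -
  have "0 \<noteq> a-1" "0 \<noteq> a" "0 \<noteq> a+b-1" "0 \<noteq> hub-1" "a-1 \<noteq> a" "a-1 \<noteq> a+b-1" "a-1 \<noteq> hub-1"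
    "a \<noteq> a+b-1" "a \<noteq> hub-1" "a+b-1 \<noteq> hub-1" using a b k by arith+
  then show ?thesis by simp
qed

lemma sum_nbrs_hub:
  fixes g :: "nat \<Rightarrow> 'b :: comm_monoid_add"
  shows "(\<Sum>l | Adj hub l. g l) = g 0 + (g (a-1) + (g a + (g (a+b-1) + g (hub-1))))"
proof -
  have "{l. Adj hub l} = set [0, a-1, a, a+b-1, hub-1]" by (simp add: nbrs_hub)
  then have "(\<Sum>l | Adj hub l. g l) = sum_list (map g [0, a-1, a, a+b-1, hub-1])"
    using nbrs_hub_distinct by (simp only: sum.distinct_set_conv_list)
  then show ?thesis by simp
qed

lemma deg_hub: "deg Adj hub = 5"
proof -
  have "deg Adj hub = card (set [0, a-1, a, a+b-1, hub-1])" by (simp add: deg_def nbrs_hub)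
  also have "\<dots> = 5" by (subst distinct_card[OF nbrs_hub_distinct]) simp
  finally show ?thesis .
qed

lemma deg_leaf: "deg Adj (a+b) = 1"
  using a b k by (simp add: deg_def nbrs_path)

lemma deg_inner: "i < hub \<Longrightarrow> i \<noteq> a+b \<Longrightarrow> deg Adj i = 2"
  using a b k nbrs_cycle1[of i] nbrs_cycle2[of i] nbrs_path[of i]
  by (cases "i < a"; cases "i < a+b") (auto simp: deg_def card_insert_if)

end

context propeller
begin

text \<open>
  Connectedness, in the form in which it is used here and in which it is transferred to a
  cospectral graph.
\<close>

lemma closed_set_is_everything:
  assumes ne: "T \<noteq> {}" and sub: "T \<subseteq> {..<Suc hub}" and cl: "\<And>i j. i \<in> T \<Longrightarrow> Adj i j \<Longrightarrow> j \<in> T"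
  shows "T = {..<Suc hub}"
proof -
  have c1: "0 \<in> T" if "i < a" "i \<in> T" for i
    using that by (induction i) (use cl adj_cycle1 in auto)
  have c2: "a \<in> T" if "m < b" "a + m \<in> T" for m
    using that
  proof (induction m)
    case (Suc m)
    have "Adj (a + Suc m) (a + m)" using Suc.prems(1) by (subst adj_cycle2) auto
    then show ?case using Suc cl by auto
  qed simp
  have c3: "hub - 1 \<in> T" if "a + b \<le> i" "i + d = hub - 1" "i \<in> T" for i d
    using that
  proof (induction d arbitrary: i)
    case (Suc d)
    have "Adj i (Suc i)" using Suc.prems(1,2) by (subst adj_path) auto
    then have "Suc i \<in> T" using Suc.prems(3) cl by blast
    then show ?case using Suc.IH[of "Suc i"] Suc.prems by simp
  qed simp
  have hub: "hub \<in> T"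
  proof -
    obtain i where i: "i \<in> T" "i \<le> hub" using ne sub by fastforce
    consider "i < a" | "a \<le> i" "i < a+b" | "a+b \<le> i" "i < hub" | "i = hub" using i(2) by linarith
    then have "\<exists>j \<in> T. Adj hub j \<or> j = hub"
    proof cases
      case 1
      then show ?thesis using c1 i(1) adj_hub by auto
    next
      case 2
      then obtain m where "i = a + m" using le_Suc_ex by blast
      then show ?thesis using c2[of m] 2 i(1) adj_hub by auto
    next
      case 3
      then have "hub - 1 \<in> T" using c3[of i "hub - 1 - i"] i(1) by simp
      then show ?thesis using adj_hub by auto
    next
      case 4
      then show ?thesis using i(1) by blast
    qed
    then show ?thesis using cl adj_commute by blast
  qed
  have "0 \<in> T" "a \<in> T" "hub - 1 \<in> T" using cl[OF hub] adj_hub by auto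
  have d1: "i < a \<Longrightarrow> i \<in> T" for i
  proof (induction i)
    case (Suc i)
    have "Adj i (Suc i)" using Suc.prems by (subst adj_cycle1) auto
    then show ?case using Suc cl by auto
  qed (use \<open>0 \<in> T\<close> in simp)
  have d2: "m < b \<Longrightarrow> a + m \<in> T" for m
  proof (induction m)
    case (Suc m)
    have "Adj (a + m) (a + Suc m)" using Suc.prems by (subst adj_cycle2) auto
    then show ?case using Suc cl by auto
  qed (use \<open>a \<in> T\<close> in simp)
  have d3: "a + b \<le> i \<Longrightarrow> i + d = hub - 1 \<Longrightarrow> i \<in> T" for i d
  proof (induction d arbitrary: i)
    case (Suc d)
    have "Adj (Suc i) i" using Suc.prems by (subst adj_path) auto
    then show ?case using Suc.IH[of "Suc i"] Suc.prems cl by auto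
  qed (use \<open>hub - 1 \<in> T\<close> in simp)
  have "i \<in> T" if iu: "i \<le> hub" for i
  proof -
    consider "i < a" | "a \<le> i" "i < a+b" | "a+b \<le> i" "i < hub" | "i = hub" using iu by linarith
    then show ?thesis
    proof cases
      case 2
      then show ?thesis using d2[of "i - a"] by simp
    next
      case 3
      then show ?thesis using d3[of i "hub - 1 - i"] by simp
    qed (use d1 hub in auto)
  qed
  then show ?thesis using sub by auto
qed

lemma sum_deg:
  fixes f :: "nat \<Rightarrow> real"
  shows "(\<Sum>i<Suc hub. f (deg Adj i)) = f 5 + f 1 + (real hub - 1) * f 2"
proof -
  have "(\<Sum>i<hub. f (deg Adj i)) = (\<Sum>i<hub. (if i = a+b then f 1 - f 2 else 0) + f 2)"
    by (rule sum.cong) (auto simp: deg_inner deg_leaf)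
  also have "\<dots> = f 1 - f 2 + real hub * f 2" using k by (simp add: sum.distrib)
  finally have "(\<Sum>i<hub. f (deg Adj i)) = f 1 + (real hub - 1) * f 2" by (simp add: left_diff_distrib)
  then show ?thesis by (simp only: sum.lessThan_Suc deg_hub)
qed

lemma deg_le_2: "i \<noteq> hub \<Longrightarrow> deg Adj i \<le> 2"
proof (cases "i < hub")
  case True
  then show ?thesis by (cases "i = a + b") (simp_all add: deg_leaf deg_inner)
next
  case False
  assume "i \<noteq> hub"
  then have "{j. Adj i j} = {}" using False adj_less[of i] by auto
  then show ?thesis by (simp add: deg_def)
qed

text \<open>
  Edges that avoid the hub stay inside a block, so the other two vertices of a triangle at the hub
  are its two neighbours on one of the cycles.
\<close>

lemma hub_triangle:
  assumes "Adj hub j" "Adj hub l" "Adj j l"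
  shows "(j, l) \<in> {(0, a-1), (a-1, 0), (a, a+b-1), (a+b-1, a)}"
proof -
  have lu: "l \<noteq> hub" using assms(2) adj_neq by blast
  have l: "l \<in> {0, a-1, a, a+b-1, hub-1}" and j: "j \<in> {0, a-1, a, a+b-1, hub-1}"
    using assms(1,2) by (simp_all only: adj_hub)
  have jl: "j \<noteq> l" using assms(3) adj_neq by blast
  consider "j < a" "j = 0 \<or> j = a - 1" | "a \<le> j" "j < a+b" "j = a \<or> j = a+b-1" | "a+b \<le> j" "j < hub" "j = hub-1"
    using j a b k by (auto; linarith)
  then show ?thesis
  proof cases
    case 1
    then have "l < a" using assms(3) lu adj_cycle1 by blast
    then have "l = 0 \<or> l = a - 1" using l a b k by (auto; linarith)
    then show ?thesis using 1(2) jl by auto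
  next
    case 2
    then have "a \<le> l" "l < a+b" using assms(3) lu adj_cycle2 by blast+
    then have "l = a \<or> l = a+b-1" using l a b k by (auto; linarith)
    then show ?thesis using 2(3) jl by auto
  next
    case 3
    then have "a+b \<le> l" "l < hub" using assms(3) lu adj_path by blast+
    then have "l = hub - 1" using l a b k by (auto; linarith)
    then show ?thesis using 3 jl by simp
  qed
qed

lemma non_hub_adj: "Adj i j \<Longrightarrow> i \<noteq> hub \<Longrightarrow> j \<noteq> hub \<Longrightarrow> j = Suc i \<or> i = Suc j"
  unfolding propeller_adj_def by blast

text \<open>
  Every triangle contains the hub, since without the hub the graph is a union of paths.  There are
  three places for the hub in a triple and at most four ordered pairs for the other two vertices.
\<close>

lemma card_triangles_le: "card (triangles Adj) \<le> 12"
proof -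
  let ?P = "[(0, a-1), (a-1, 0), (a, a+b-1), (a+b-1, a)]"
  let ?L = "map (\<lambda>(j, l). (hub, j, l)) ?P @ map (\<lambda>(j, l). (j, hub, l)) ?P @ map (\<lambda>(j, l). (j, l, hub)) ?P"
  have "triangles Adj \<subseteq> set ?L"
  proof
    fix t assume "t \<in> triangles Adj"
    then obtain i j l where t: "t = (i, j, l)" and adj: "Adj i j" "Adj j l" "Adj i l"
      by (auto simp: triangles_def)
    have "i = hub \<or> j = hub \<or> l = hub"
      using non_hub_adj[OF adj(1)] non_hub_adj[OF adj(2)] non_hub_adj[OF adj(3)] by linarith
    then show "t \<in> set ?L"
    proof (elim disjE)
      assume "i = hub"
      then have "(j, l) \<in> set ?P" using hub_triangle[of j l] adj by simp
      then show ?thesis using t \<open>i = hub\<close> by auto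
    next
      assume "j = hub"
      then have "(i, l) \<in> set ?P" using hub_triangle[of i l] adj adj_sym[OF adj(1)] by simp
      then show ?thesis using t \<open>j = hub\<close> by auto
    next
      assume "l = hub"
      then have "(i, j) \<in> set ?P" using hub_triangle[of i j] adj adj_sym[OF adj(2)] adj_sym[OF adj(3)] by simp
      then show ?thesis using t \<open>l = hub\<close> by auto
    qed
  qed
  then have "card (triangles Adj) \<le> card (set ?L)" by (intro card_mono) auto
  also have "\<dots> \<le> length ?L" by (rule card_length)
  also have "length ?L = 12" by simp
  finally show ?thesis .
qed

lemma energy_0_imp_constant:
  assumes "energy Adj x = 0" "i \<le> hub"
  shows "x i = x hub"
proof -
  have eq: "x i = x j" if "Adj i j" for i j
    using assms(1) that unfolding energy_0_iff by blast
  have "{i. i < Suc hub \<and> x i = x hub} = {..<Suc hub}"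
  proof (rule closed_set_is_everything)
    fix i j assume "i \<in> {i. i < Suc hub \<and> x i = x hub}" "Adj i j"
    then have "j < Suc hub" "x i = x j" "x i = x hub" using adj_less2[of i j] eq[of i j] by blast+
    then show "j \<in> {i. i < Suc hub \<and> x i = x hub}" by simp
  next
    have "hub \<in> {i. i < Suc hub \<and> x i = x hub}" by simp
    then show "{i. i < Suc hub \<and> x i = x hub} \<noteq> {}" by blast
  qed blast
  moreover have "i \<in> {..<Suc hub}" using assms(2) by simp
  ultimately show ?thesis by blast
qed

text \<open>
  All degrees but that of the hub are at most 2.  For \<open>x\<close> vanishing at the hub, the
  sum of \<open>(x i - x j)\<^sup>2 + (x i + x j)\<^sup>2\<close> over the arcs is therefore at most \<open>8|x|\<^sup>2\<close>.  So if the
  energy reaches this bound, then \<open>x j = - x i\<close> along every arc, and the zero at the hub spreads over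
  the connected graph.
\<close>

lemma energy_hyperplane:
  assumes xu: "x hub = 0" and en: "energy Adj x \<ge> 8 * (\<Sum>i<Suc hub. (x i)\<^sup>2)" and i: "i \<le> hub"
  shows "x i = 0"
proof -
  let ?E = "{(i, j). Adj i j}"
  have "energy Adj x + (\<Sum>(i, j)\<in>?E. (x i + x j)\<^sup>2) = (\<Sum>(i, j)\<in>?E. 2 * (x i)\<^sup>2) + (\<Sum>(i, j)\<in>?E. 2 * (x j)\<^sup>2)"
    unfolding energy_def sum.distrib[symmetric]
    by (rule sum.cong) (auto simp: power2_eq_square algebra_simps)
  also have "\<dots> = (\<Sum>i<Suc hub. real (deg Adj i) * (2 * (x i)\<^sup>2)) + (\<Sum>i<Suc hub. real (deg Adj i) * (2 * (x i)\<^sup>2))"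
    using sum_arcs_fst[of "\<lambda>i. 2 * (x i)\<^sup>2"] sum_arcs_snd[of "\<lambda>i. 2 * (x i)\<^sup>2"] by simp
  also have "\<dots> \<le> (\<Sum>i<Suc hub. 4 * (x i)\<^sup>2) + (\<Sum>i<Suc hub. 4 * (x i)\<^sup>2)"
  proof (intro add_mono sum_mono)
    fix i
    show "real (deg Adj i) * (2 * (x i)\<^sup>2) \<le> 4 * (x i)\<^sup>2"
    proof (cases "i = hub")
      case False
      then have "real (deg Adj i) \<le> 2" using deg_le_2[of i] by simp
      then have "real (deg Adj i) * (2 * (x i)\<^sup>2) \<le> 2 * (2 * (x i)\<^sup>2)" by (rule mult_right_mono) simp
      then show ?thesis by simp
    qed (simp add: xu)
    then show "real (deg Adj i) * (2 * (x i)\<^sup>2) \<le> 4 * (x i)\<^sup>2" .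
  qed
  also have "\<dots> = 8 * (\<Sum>i<Suc hub. (x i)\<^sup>2)" by (simp only: sum_distrib_left[symmetric])
  finally have "(\<Sum>(i, j)\<in>?E. (x i + x j)\<^sup>2) \<le> 0" using en by linarith
  moreover have "(\<Sum>(i, j)\<in>?E. (x i + x j)\<^sup>2) \<ge> 0" by (rule sum_nonneg) (simp add: case_prod_unfold)
  ultimately have "(\<Sum>(i, j)\<in>?E. (x i + x j)\<^sup>2) = 0" by linarith
  then have "\<forall>e\<in>?E. (case e of (i, j) \<Rightarrow> (x i + x j)\<^sup>2) = 0"
    by (subst (asm) sum_nonneg_eq_0_iff[OF finite_arcs]) (simp_all add: case_prod_unfold)
  then have neg: "x j = - x i" if "Adj i j" for i j
  proof -
    have "(x i + x j)\<^sup>2 = 0" using bspec[OF \<open>\<forall>e\<in>?E. _ e\<close>, of "(i, j)"] that by simp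
    then show ?thesis by simp
  qed
  have "{i. i < Suc hub \<and> x i = 0} = {..<Suc hub}"
  proof (rule closed_set_is_everything)
    fix i j assume "i \<in> {i. i < Suc hub \<and> x i = 0}" "Adj i j"
    then have "j < Suc hub" "x j = - x i" "x i = 0" using adj_less2[of i j] neg[of i j] by blast+
    then show "j \<in> {i. i < Suc hub \<and> x i = 0}" by simp
  next
    have "hub \<in> {i. i < Suc hub \<and> x i = 0}" using xu by simp
    then show "{i. i < Suc hub \<and> x i = 0} \<noteq> {}" by blast
  qed blast
  moreover have "i \<in> {..<Suc hub}" using i by simp
  ultimately show ?thesis by blast
qed

end

section \<open>Degrees in a cospectral mate\<close>

text \<open>
  If some \<open>e h > 2\<close>, then the sum of squares forces \<open>e h = 3\<close> and leaves 1 for the rest.  Otherwise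
  all values lie in \<open>{-1, 0, 1, 2}\<close>, where \<open>x\<^sup>3 = x\<close> except at 2, so that the sum of cubes
  is 2 plus six times the number of entries 2; the sum of squares allows at most two of these, the
  sum of cubes requires at least two.
\<close>

lemma degree_defects:
  fixes e :: "'i \<Rightarrow> real"
  assumes fin: "finite I" and int: "\<And>i. i \<in> I \<Longrightarrow> e i \<in> \<int>" and ge: "\<And>i. i \<in> I \<Longrightarrow> e i \<ge> -1"
    and s1: "(\<Sum>i\<in>I. e i) = 2" and s2: "(\<Sum>i\<in>I. (e i)^2) = 10"
    and s3: "(\<Sum>i\<in>I. (e i)^3) \<ge> 14"
  shows "(\<exists>h\<in>I. \<exists>l\<in>I. l \<noteq> h \<and> e h = 3 \<and> e l = -1 \<and> (\<forall>i\<in>I - {h, l}. e i = 0)) \<or>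
    ((\<Sum>i\<in>I. (e i)^3) = 14 \<and> (\<exists>p\<in>I. \<exists>q\<in>I. p \<noteq> q \<and> e p = 2 \<and> e q = 2))"
proof (cases "\<exists>h\<in>I. e h > 2")
  case True
  then obtain h where h: "h \<in> I" "e h > 2" by blast
  obtain z where z: "e h = of_int z" using int[OF h(1)] by (auto elim: Ints_cases)
  have r: "(\<Sum>i\<in>I. f i) = f h + (\<Sum>i\<in>I - {h}. f i)" for f :: "'i \<Rightarrow> real"
    using fin h(1) by (rule sum.remove)
  have n2: "(\<Sum>i\<in>I - {h}. (e i)^2) \<ge> 0" by (rule sum_nonneg) simp
  have "(e h)^2 \<le> 10" using s2 r[of "\<lambda>i. (e i)^2"] n2 by linarith
  then have "e h < 4" by (rule_tac power2_less_imp_less) auto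
  then have "z = 3" using h(2) z by linarith
  then have eh: "e h = 3" using z by simp
  have t1: "(\<Sum>i\<in>I - {h}. e i) = -1" using s1 r[of e] eh by simp
  have t2: "(\<Sum>i\<in>I - {h}. (e i)^2) = 1" using s2 r[of "\<lambda>i. (e i)^2"] eh by simp
  have "\<exists>l\<in>I - {h}. e l \<noteq> 0"
  proof (rule ccontr)
    assume "\<not> ?thesis"
    then have "(\<Sum>i\<in>I - {h}. e i) = 0" by simp
    then show False using t1 by simp
  qed
  then obtain l where l: "l \<in> I" "l \<noteq> h" "e l \<noteq> 0" by blast
  obtain y where y: "e l = of_int y" using int[OF l(1)] by (auto elim: Ints_cases)
  have "finite (I - {h})" "l \<in> I - {h}" using fin l by auto
  then have r': "(\<Sum>i\<in>I - {h}. f i) = f l + (\<Sum>i\<in>I - {h} - {l}. f i)" for f :: "'i \<Rightarrow> real"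
    by (rule sum.remove)
  have n3: "(\<Sum>i\<in>I - {h} - {l}. (e i)^2) \<ge> 0" by (rule sum_nonneg) simp
  have "y^2 \<ge> 1" using l(3) y by (simp add: int_one_le_iff_zero_less)
  then have "(e l)^2 \<ge> 1" unfolding y by (metis of_int_1_le_iff of_int_power)
  then have z0: "(\<Sum>i\<in>I - {h} - {l}. (e i)^2) = 0" using t2 r'[of "\<lambda>i. (e i)^2"] n3 by linarith
  have zero: "e i = 0" if "i \<in> I - {h, l}" for i
  proof -
    have "\<forall>i\<in>I - {h} - {l}. (e i)^2 = 0"
      using z0 fin by (subst (asm) sum_nonneg_eq_0_iff) auto
    then show ?thesis using that by auto
  qed
  then have "(\<Sum>i\<in>I - {h} - {l}. e i) = 0" by (intro sum.neutral) auto
  then have "e l = -1" using t1 r'[of e] by simp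
  then show ?thesis using h l eh zero by blast
next
  case False
  define J where "J = {i \<in> I. e i = 2}"
  have vals: "e i \<in> {-1, 0, 1, 2}" if i: "i \<in> I" for i
  proof -
    obtain z where z: "e i = of_int z" using int[OF i] by (auto elim: Ints_cases)
    have "e i \<le> 2" using False i by (meson not_le)
    then have "z \<le> 2" "-1 \<le> z" using ge[OF i] unfolding z by linarith+
    then have "z = -1 \<or> z = 0 \<or> z = 1 \<or> z = 2" by linarith
    then show ?thesis using z by auto
  qed
  have JI: "(\<Sum>i\<in>I. if e i = 2 then c else 0) = c * real (card J)" for c :: real
    using fin by (simp add: J_def sum.inter_filter[symmetric])
  have "(\<Sum>i\<in>I. (e i)^3) = (\<Sum>i\<in>I. e i + (if e i = 2 then 6 else 0))"
  proof (rule sum.cong)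
    fix i assume "i \<in> I"
    then consider "e i = -1" | "e i = 0" | "e i = 1" | "e i = 2" using vals by blast
    then show "(e i)^3 = e i + (if e i = 2 then 6 else 0)" by cases simp_all
  qed simp
  then have c3: "(\<Sum>i\<in>I. (e i)^3) = 2 + 6 * real (card J)" by (simp add: sum.distrib s1 JI)
  have "4 * real (card J) \<le> (\<Sum>i\<in>I. (e i)^2)"
    unfolding JI[symmetric] by (rule sum_mono) simp
  then have "real (card J) < 3" using s2 by simp
  then have "card J = 2" using c3 s3 by linarith
  then obtain p q where "J = {p, q}" "p \<noteq> q" by (meson card_2_iff)
  then have "p \<in> I" "q \<in> I" "e p = 2" "e q = 2" "p \<noteq> q" by (auto simp: J_def)
  moreover have "(\<Sum>i\<in>I. (e i)^3) = 14" using c3 \<open>card J = 2\<close> by simp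
  ultimately show ?thesis by blast
qed

lemma (in nat_graph) energy_two_stars:
  assumes pq: "p \<noteq> q" and P: "\<And>j. j \<in> P \<Longrightarrow> A p j" and Q: "\<And>j. j \<in> Q \<Longrightarrow> A q j" and out: "q \<notin> P" "p \<notin> Q"
  shows "energy A x \<ge> 2 * ((\<Sum>j\<in>P. (x p - x j)\<^sup>2) + (\<Sum>j\<in>Q. (x q - x j)\<^sup>2))"
proof -
  let ?f = "\<lambda>(i, j). (x i - x j)\<^sup>2"
  have fin: "finite P" "finite Q"
    using finite_subset[OF _ finite_nbrs[of p], of P] finite_subset[OF _ finite_nbrs[of q], of Q] P Q by auto
  have pP: "p \<notin> P" "q \<notin> Q" using P Q adj_irrefl by auto
  have le: "sum ?f (({p} \<times> P \<union> P \<times> {p}) \<union> ({q} \<times> Q \<union> Q \<times> {q})) \<le> sum ?f ({(i, j). A i j})"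
    by (rule sum_mono2) (use P Q adj_sym in auto)
  have split: "sum ?f (({p} \<times> P \<union> P \<times> {p}) \<union> ({q} \<times> Q \<union> Q \<times> {q}))
    = (sum ?f ({p} \<times> P) + sum ?f (P \<times> {p})) + (sum ?f ({q} \<times> Q) + sum ?f (Q \<times> {q}))"
    using fin pq pP out by (subst sum.union_disjoint; (subst sum.union_disjoint)?; auto)+
  have s1: "sum ?f ({p} \<times> P) = (\<Sum>j\<in>P. (x p - x j)\<^sup>2)" "sum ?f ({q} \<times> Q) = (\<Sum>j\<in>Q. (x q - x j)\<^sup>2)"
    by (simp_all flip: sum.cartesian_product)
  have s2: "sum ?f (P \<times> {p}) = (\<Sum>j\<in>P. (x p - x j)\<^sup>2)" "sum ?f (Q \<times> {q}) = (\<Sum>j\<in>Q. (x q - x j)\<^sup>2)"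
    by (simp_all add: power2_commute flip: sum.cartesian_product)
  have "2 * (y + z) = (y + y) + (z + z)" for y z :: real by simp
  then show ?thesis using le unfolding split s1 s2 energy_def by simp
qed

lemma (in nat_graph) finite_triangles: "finite (triangles A)"
proof (rule finite_subset)
  show "triangles A \<subseteq> {..<n} \<times> {..<n} \<times> {..<n}"
  proof
    fix t assume "t \<in> triangles A"
    then obtain i j l where "t = (i, j, l)" "A i j" "A j l" unfolding triangles_def by blast
    then show "t \<in> {..<n} \<times> {..<n} \<times> {..<n}" using adj_less[of i j] adj_less[of j l] adj_less2[of j l] by simp
  qed
qed simp

text \<open>
  If \<open>p\<close> and \<open>q\<close> are not adjacent, take their indicator functions.  If they are adjacent, give the
  three other neighbours of each of them the value \<open>-1/3\<close>: the two stars are disjoint because there is no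
  triangle, each of the six edges contributes a difference of \<open>4/3\<close>, in both directions, and the quotient of
  energy and squared norm is at least \<open>2 \<cdot> 3 \<cdot> (16/9) / (1 + 3/9) = 8\<close>, even if the edge \<open>p q\<close> and
  all edges outside the stars are ignored.
\<close>

lemma (in nat_graph) two_hubs_energy:
  assumes pq: "p \<noteq> q" "p < n" "q < n" and deg: "deg A p = 4" "deg A q = 4" and tri: "triangles A = {}"
  obtains y z where "y p = 1" "y q = 0" "z p = 0" "z q = 1"
    "\<And>\<alpha> \<beta>. energy A (\<lambda>i. \<alpha> * y i + \<beta> * z i) \<ge> 8 * (\<Sum>i<n. (\<alpha> * y i + \<beta> * z i)\<^sup>2)"
proof (cases "A p q")
  case False
  define y z :: "nat \<Rightarrow> real" where "y i = (if i = p then 1 else 0)" and "z i = (if i = q then 1 else 0)" for i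
  have "energy A (\<lambda>i. \<alpha> * y i + \<beta> * z i) \<ge> 8 * (\<Sum>i<n. (\<alpha> * y i + \<beta> * z i)\<^sup>2)" for \<alpha> \<beta>
  proof -
    let ?x = "\<lambda>i. \<alpha> * y i + \<beta> * z i"
    let ?P = "{j. A p j}" and ?Q = "{j. A q j}"
    have xp: "?x p = \<alpha>" "?x q = \<beta>" using pq(1) by (simp_all add: y_def z_def)
    have x0: "?x j = 0" if "j \<noteq> p" "j \<noteq> q" for j using that by (simp add: y_def z_def)
    have P: "j \<noteq> p" "j \<noteq> q" if "j \<in> ?P" for j using that False adj_irrefl by auto
    have Q: "j \<noteq> p" "j \<noteq> q" if "j \<in> ?Q" for j using that False adj_irrefl adj_commute by auto
    have "(\<Sum>i<n. (?x i)\<^sup>2) = (\<Sum>i<n. (if i = p then \<alpha>\<^sup>2 else 0) + (if i = q then \<beta>\<^sup>2 else 0))"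
      by (rule sum.cong) (use pq(1) in \<open>auto simp: y_def z_def\<close>)
    also have "\<dots> = \<alpha>\<^sup>2 + \<beta>\<^sup>2" using pq by (simp add: sum.distrib)
    finally have norm: "(\<Sum>i<n. (?x i)\<^sup>2) = \<alpha>\<^sup>2 + \<beta>\<^sup>2" .
    have sP: "(\<Sum>j\<in>?P. (?x p - ?x j)\<^sup>2) = 4 * \<alpha>\<^sup>2"
    proof -
      have "(\<Sum>j\<in>?P. (?x p - ?x j)\<^sup>2) = (\<Sum>j\<in>?P. \<alpha>\<^sup>2)"
        by (rule sum.cong) (simp_all only: xp x0[OF P] diff_zero)
      then show ?thesis using deg(1) by (simp add: deg_def)
    qed
    have sQ: "(\<Sum>j\<in>?Q. (?x q - ?x j)\<^sup>2) = 4 * \<beta>\<^sup>2"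
    proof -
      have "(\<Sum>j\<in>?Q. (?x q - ?x j)\<^sup>2) = (\<Sum>j\<in>?Q. \<beta>\<^sup>2)"
        by (rule sum.cong) (simp_all only: xp x0[OF Q] diff_zero)
      then show ?thesis using deg(2) by (simp add: deg_def)
    qed
    have "2 * ((\<Sum>j\<in>?P. (?x p - ?x j)\<^sup>2) + (\<Sum>j\<in>?Q. (?x q - ?x j)\<^sup>2)) \<le> energy A ?x"
      by (rule energy_two_stars[OF pq(1)]) (use P Q in blast)+
    then show ?thesis unfolding sP sQ norm by simp
  qed
  moreover have "y p = 1" "y q = 0" "z p = 0" "z q = 1" using pq(1) by (simp_all add: y_def z_def)
  ultimately show thesis using that[of y z] by blast
next
  case True
  let ?P = "{j. A p j} - {q}" and ?Q = "{j. A q j} - {p}"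
  have adj: "A p q" "A q p" using True adj_sym by blast+
  have disj: "?P \<inter> ?Q = {}"
  proof (rule ccontr)
    assume "?P \<inter> ?Q \<noteq> {}"
    then obtain j where "A p j" "A q j" by blast
    then have "(p, q, j) \<in> triangles A" using adj by (simp add: triangles_def)
    then show False using tri by simp
  qed
  have out: "p \<notin> ?P" "q \<notin> ?P" "p \<notin> ?Q" "q \<notin> ?Q" using adj_irrefl by auto
  have sub: "?P \<subseteq> {..<n}" "?Q \<subseteq> {..<n}" using nbrs_subset by blast+
  have "card ?P = 3" "card ?Q = 3" using deg adj by (simp_all add: deg_def)
  define y z :: "nat \<Rightarrow> real" where "y i = (if i = p then 1 else if i \<in> ?P then -1/3 else 0)"
    and "z i = (if i = q then 1 else if i \<in> ?Q then -1/3 else 0)" for i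
  have "energy A (\<lambda>i. \<alpha> * y i + \<beta> * z i) \<ge> 8 * (\<Sum>i<n. (\<alpha> * y i + \<beta> * z i)\<^sup>2)" for \<alpha> \<beta>
  proof -
    define x where "x i = \<alpha> * y i + \<beta> * z i" for i
    define P Q where "P = ?P" and "Q = ?Q"
    note dj = disj[folded P_def Q_def] and ou = out[folded P_def Q_def] and su = sub[folded P_def Q_def]
    have cP: "card P = 3" "card Q = 3" using \<open>card ?P = 3\<close> \<open>card ?Q = 3\<close> by (simp_all add: P_def Q_def)
    have yz: "y i = (if i = p then 1 else if i \<in> P then -1/3 else 0)"
      "z i = (if i = q then 1 else if i \<in> Q then -1/3 else 0)" for i
      by (simp_all only: y_def z_def P_def Q_def)
    have xp: "x p = \<alpha>" "x q = \<beta>" using pq(1) ou by (simp_all add: x_def yz)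
    have xP: "x j = - \<alpha> / 3" if "j \<in> P" for j
    proof -
      have "j \<noteq> p" "j \<noteq> q" "j \<notin> Q" using that ou dj by blast+
      then show ?thesis using that by (simp add: x_def yz)
    qed
    have xQ: "x j = - \<beta> / 3" if "j \<in> Q" for j
    proof -
      have "j \<noteq> p" "j \<noteq> q" "j \<notin> P" using that ou dj by blast+
      then show ?thesis using that by (simp add: x_def yz)
    qed
    have x0: "x j = 0" if "j \<noteq> p" "j \<noteq> q" "j \<notin> P" "j \<notin> Q" for j
      using that by (simp add: x_def yz)
    have pt: "(x i)\<^sup>2 = (if i = p then \<alpha>\<^sup>2 else 0) + (if i = q then \<beta>\<^sup>2 else 0)
        + (if i \<in> P then \<alpha>\<^sup>2 / 9 else 0) + (if i \<in> Q then \<beta>\<^sup>2 / 9 else 0)" for i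
    proof -
      consider "i = p" | "i = q" | "i \<in> P" | "i \<in> Q" | "i \<noteq> p" "i \<noteq> q" "i \<notin> P" "i \<notin> Q" by blast
      then show ?thesis
      proof cases
        case 1
        then show ?thesis using pq(1) ou xp by simp
      next
        case 2
        then show ?thesis using pq(1) ou xp by simp
      next
        case 3
        then have "i \<noteq> p" "i \<noteq> q" "i \<notin> Q" using ou dj by blast+
        then show ?thesis using 3 by (simp add: xP power_divide)
      next
        case 4
        then have "i \<noteq> p" "i \<noteq> q" "i \<notin> P" using ou dj by blast+
        then show ?thesis using 4 by (simp add: xQ power_divide)
      next
        case 5
        then show ?thesis by (simp add: x0)
      qed
    qed
    have ind: "(\<Sum>i<n. if i \<in> M then c else 0) = real (card M) * c" if "M \<subseteq> {..<n}" for M and c :: real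
      using that by (simp add: sum.If_cases Int_absorb1)
    have norm: "(\<Sum>i<n. (x i)\<^sup>2) = 4/3 * (\<alpha>\<^sup>2 + \<beta>\<^sup>2)"
      unfolding pt sum.distrib ind[OF su(1)] ind[OF su(2)] cP using pq by simp
    have sP: "(\<Sum>j\<in>P. (x p - x j)\<^sup>2) = 16/3 * \<alpha>\<^sup>2"
    proof -
      have "(\<Sum>j\<in>P. (x p - x j)\<^sup>2) = (\<Sum>j\<in>P. 16/9 * \<alpha>\<^sup>2)"
        by (rule sum.cong) (simp_all add: xp xP power2_eq_square)
      then show ?thesis by (simp add: cP)
    qed
    have sQ: "(\<Sum>j\<in>Q. (x q - x j)\<^sup>2) = 16/3 * \<beta>\<^sup>2"
    proof -
      have "(\<Sum>j\<in>Q. (x q - x j)\<^sup>2) = (\<Sum>j\<in>Q. 16/9 * \<beta>\<^sup>2)"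
        by (rule sum.cong) (simp_all add: xp xQ power2_eq_square)
      then show ?thesis by (simp add: cP)
    qed
    have "2 * ((\<Sum>j\<in>P. (x p - x j)\<^sup>2) + (\<Sum>j\<in>Q. (x q - x j)\<^sup>2)) \<le> energy A x"
      by (rule energy_two_stars[OF pq(1) _ _ ou(2,3)]) (simp_all add: P_def Q_def)
    then have "8 * (\<Sum>i<n. (x i)\<^sup>2) \<le> energy A x" unfolding sP sQ norm by simp
    then show ?thesis unfolding x_def .
  qed
  moreover have "y p = 1" "y q = 0" "z p = 0" "z q = 1" using pq(1) out by (simp_all add: y_def z_def)
  ultimately show thesis using that[of y z] by blast
qed

context propeller
begin

context
  fixes B r
  assumes B: "nat_graph (Suc hub) B"
    and norm: "\<And>x. (\<Sum>i<Suc hub. (\<Sum>j<Suc hub. r i j * x j)\<^sup>2) = (\<Sum>i<Suc hub. (x i)\<^sup>2)"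
    and en: "\<And>x. energy Adj (\<lambda>i. \<Sum>j<Suc hub. r i j * x j) = energy B x"
begin

interpretation B: nat_graph "Suc hub" B by (fact B)

abbreviation transport :: "(nat \<Rightarrow> real) \<Rightarrow> nat \<Rightarrow> real" where
  "transport x i \<equiv> \<Sum>j<Suc hub. r i j * x j"

lemma transport_combination: "transport (\<lambda>j. c * x j + d * y j) i = c * transport x i + d * transport y i"
proof -
  have "transport (\<lambda>j. c * x j + d * y j) i = (\<Sum>j<Suc hub. c * (r i j * x j) + d * (r i j * y j))"
    by (rule sum.cong) (simp_all add: algebra_simps)
  then show ?thesis by (simp only: sum.distrib sum_distrib_left[symmetric])
qed

lemma transport_zero_imp_zero:
  assumes "\<And>i. i \<le> hub \<Longrightarrow> transport x i = 0" "i \<le> hub"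
  shows "x i = 0"
proof -
  have "(\<Sum>i<Suc hub. (transport x i)\<^sup>2) = 0" by (rule sum.neutral) (use assms(1) in simp)
  then have "(\<Sum>i<Suc hub. (x i)\<^sup>2) = 0" using norm[of x] by simp
  then have "\<forall>i\<in>{..<Suc hub}. (x i)\<^sup>2 = 0"
    by (subst (asm) sum_nonneg_eq_0_iff) simp_all
  then show ?thesis using assms(2) by simp
qed

text \<open>
  The indicator function of a closed set and the constant function 1 both have energy zero.  Their
  images are constant, hence linearly dependent, and so are the two functions themselves.
\<close>

lemma mate_connected:
  assumes ne: "X \<noteq> {}" and sub: "X \<subseteq> {..<Suc hub}" and cl: "\<And>i j. i \<in> X \<Longrightarrow> B i j \<Longrightarrow> j \<in> X"
  shows "X = {..<Suc hub}"
proof -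
  define f :: "nat \<Rightarrow> real" where "f i = (if i \<in> X then 1 else 0)" for i
  define g :: "nat \<Rightarrow> real" where "g i = 1" for i
  have "f i = f j" if "B i j" for i j
  proof -
    have "i \<in> X \<longleftrightarrow> j \<in> X" using cl that B.adj_sym by blast
    then show ?thesis by (simp add: f_def)
  qed
  then have "energy B f = 0" unfolding B.energy_0_iff by blast
  then have cf: "transport f i = transport f hub" if "i \<le> hub" for i
    using energy_0_imp_constant[of "transport f" i] that en[of f] by simp
  have "energy B g = 0" unfolding B.energy_0_iff g_def by simp
  then have cg: "transport g i = transport g hub" if "i \<le> hub" for i
    using energy_0_imp_constant[of "transport g" i] that en[of g] by simp
  \<comment> \<open>an isometry does not annihilate the constant function\<close>
  have gu: "transport g hub \<noteq> 0"
  proof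
    assume "transport g hub = 0"
    then have "transport g i = 0" if "i \<le> hub" for i using cg[OF that] by simp
    then have "g hub = 0" using transport_zero_imp_zero[of g hub] by blast
    then show False by (simp add: g_def)
  qed
  have z: "transport g hub * f i + (- transport f hub) * g i = 0" if "i \<le> hub" for i
  proof (rule transport_zero_imp_zero[OF _ that])
    fix i assume "i \<le> hub"
    then show "transport (\<lambda>i. transport g hub * f i + (- transport f hub) * g i) i = 0"
      unfolding transport_combination cf[OF \<open>i \<le> hub\<close>] cg[OF \<open>i \<le> hub\<close>] by (simp only: mult.commute[of "transport g hub"] distrib_right[symmetric] right_minus mult_zero_left)
  qed
  have z': "transport g hub * f i = transport f hub" if "i \<le> hub" for i using z[OF that] by (simp add: g_def)
  obtain s where s: "s \<in> X" "s \<le> hub" using ne sub by fastforce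
  then have f1: "f i = 1" if "i \<le> hub" for i using z'[OF that] z'[OF s(2)] gu by (simp add: f_def split: if_splits)
  have "i \<in> X" if "i < Suc hub" for i using f1[of i] that by (simp add: f_def split: if_splits)
  then show ?thesis using sub by blast
qed

text \<open>
  Some nonzero function in the span of \<open>y\<close> and \<open>z\<close> is mapped to a function that vanishes at the
  hub, which contradicts the bound on that hyperplane.
\<close>

lemma mate_no_energetic_plane:
  assumes pq: "p \<le> hub" "q \<le> hub" and y: "y p = 1" "y q = 0" and z: "z p = 0" "z q = 1"
    and big: "\<And>\<alpha> \<beta>. energy B (\<lambda>i. \<alpha> * y i + \<beta> * z i) \<ge> 8 * (\<Sum>i<Suc hub. (\<alpha> * y i + \<beta> * z i)\<^sup>2)"
  shows False
proof -
  have "\<exists>\<alpha> \<beta>. (\<alpha> \<noteq> 0 \<or> \<beta> \<noteq> 0) \<and> \<alpha> * v + \<beta> * w = 0" for v w :: real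
  proof (cases "v = 0 \<and> w = 0")
    case False
    then show ?thesis by (intro exI[of _ w] exI[of _ "- v"]) auto
  qed (auto intro: exI[of _ 1])
  then obtain \<alpha> \<beta> where ab: "\<alpha> \<noteq> 0 \<or> \<beta> \<noteq> 0" "\<alpha> * transport y hub + \<beta> * transport z hub = 0" by blast
  define x where "x i = \<alpha> * y i + \<beta> * z i" for i
  have xe: "x = (\<lambda>i. \<alpha> * y i + \<beta> * z i)" by (simp add: x_def fun_eq_iff)
  have tu: "transport x hub = 0" unfolding xe transport_combination by (rule ab(2))
  have "8 * (\<Sum>i<Suc hub. (transport x i)\<^sup>2) \<le> energy Adj (transport x)"
    unfolding norm en using big[of \<alpha> \<beta>] unfolding xe .
  then have "transport x i = 0" if "i \<le> hub" for i
    using energy_hyperplane[of "transport x" i] tu that by blast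
  then have "x i = 0" if "i \<le> hub" for i using transport_zero_imp_zero[of x i] that by blast
  then have "x p = 0" "x q = 0" using pq by blast+
  then show False using ab(1) y z by (simp add: x_def)
qed

end

text \<open>
  The first two power sums of the defects \<open>e\<close> are those of the propeller graph, and the third
  is \<open>26\<close> minus the difference of the numbers of ordered triangles, hence at least \<open>14\<close>, with
  equality only if the mate has no triangles.
\<close>

theorem cospectral_mate_degrees:
  assumes B: "nat_graph (Suc hub) B" and cp: "char_poly (laplacian (Suc hub) B) = char_poly (laplacian (Suc hub) Adj)"
  shows "\<exists>h l. h < Suc hub \<and> l < Suc hub \<and> l \<noteq> h \<and> deg B h = 5 \<and> deg B l = 1 \<and>
      (\<forall>i<Suc hub. i \<noteq> h \<longrightarrow> i \<noteq> l \<longrightarrow> deg B i = 2)"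
    and "\<And>X. X \<noteq> {} \<Longrightarrow> X \<subseteq> {..<Suc hub} \<Longrightarrow> (\<And>i j. i \<in> X \<Longrightarrow> B i j \<Longrightarrow> j \<in> X) \<Longrightarrow> X = {..<Suc hub}"
proof -
  interpret B: nat_graph "Suc hub" B by fact
  obtain r where norm: "\<And>x. (\<Sum>i<Suc hub. (\<Sum>j<Suc hub. r i j * x j)\<^sup>2) = (\<Sum>i<Suc hub. (x i)\<^sup>2)"
    and en: "\<And>x. energy Adj (\<lambda>i. \<Sum>j<Suc hub. r i j * x j) = energy B x"
    and t1: "(\<Sum>i<Suc hub. real (deg B i)) = (\<Sum>i<Suc hub. real (deg Adj i))"
    and t2: "(\<Sum>i<Suc hub. real (deg B i)^2) = (\<Sum>i<Suc hub. real (deg Adj i)^2)"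
    and t3: "(\<Sum>i<Suc hub. real (deg B i)^3) - real (card (triangles B)) = (\<Sum>i<Suc hub. real (deg Adj i)^3) - real (card (triangles Adj))"
    by (rule cospectral_isometry[OF nat_graph_axioms B cp]) (rule that, assumption+)
  \<comment> \<open>the isometry makes the mate inherit connectedness, and with it positive degrees\<close>
  note conn = mate_connected[OF B norm en]
  show "\<And>X. X \<noteq> {} \<Longrightarrow> X \<subseteq> {..<Suc hub} \<Longrightarrow> (\<And>i j. i \<in> X \<Longrightarrow> B i j \<Longrightarrow> j \<in> X) \<Longrightarrow> X = {..<Suc hub}"
    by (rule conn)
  define e where "e i = real (deg B i) - 2" for i
  have s1: "(\<Sum>i<Suc hub. real (deg B i)) = 2 * real hub + 4" using t1 sum_deg[of real] by simp
  have s2: "(\<Sum>i<Suc hub. real (deg B i)^2) = 4 * real hub + 22" using t2 sum_deg[of "\<lambda>d. real d^2"] by simp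
  have s3: "(\<Sum>i<Suc hub. real (deg B i)^3) = 8 * real hub + 118 - real (card (triangles Adj)) + real (card (triangles B))"
    using t3 sum_deg[of "\<lambda>d. real d^3"] by simp
  have e1: "(\<Sum>i<Suc hub. e i) = 2"
    unfolding e_def sum_subtractf s1 by simp
  have "(\<Sum>i<Suc hub. (e i)^2) = (\<Sum>i<Suc hub. real (deg B i)^2 - 4 * real (deg B i) + 4)"
    by (rule sum.cong) (simp_all add: e_def power2_eq_square algebra_simps)
  also have "\<dots> = (\<Sum>i<Suc hub. real (deg B i)^2) - 4 * (\<Sum>i<Suc hub. real (deg B i)) + 4 * real (Suc hub)"
    unfolding sum.distrib sum_subtractf sum_distrib_left by simp
  finally have e2: "(\<Sum>i<Suc hub. (e i)^2) = 10" unfolding s1 s2 by simp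
  have "(\<Sum>i<Suc hub. (e i)^3) = (\<Sum>i<Suc hub. real (deg B i)^3 - 6 * real (deg B i)^2 + 12 * real (deg B i) - 8)"
    by (rule sum.cong) (simp_all add: e_def power2_eq_square power3_eq_cube algebra_simps)
  also have "\<dots> = (\<Sum>i<Suc hub. real (deg B i)^3) - 6 * (\<Sum>i<Suc hub. real (deg B i)^2) + 12 * (\<Sum>i<Suc hub. real (deg B i)) - 8 * real (Suc hub)"
    unfolding sum.distrib sum_subtractf sum_distrib_left by simp
  finally have e3: "(\<Sum>i<Suc hub. (e i)^3) = 26 - real (card (triangles Adj)) + real (card (triangles B))"
    unfolding s1 s2 s3 by simp
  have tA: "real (card (triangles Adj)) \<le> 12" using card_triangles_le by simp
  have ge: "e i \<ge> -1" if i: "i \<in> {..<Suc hub}" for i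
  proof (rule ccontr)
    assume "\<not> ?thesis"
    then have "deg B i = 0" by (simp add: e_def)
    then have N: "{j. B i j} = {}" using B.finite_nbrs[of i] by (simp add: deg_def)
    have "{i} = {..<Suc hub}" by (rule conn) (use i N in auto)
    then have "card {i} = card {..<Suc hub}" by (rule arg_cong)
    then show False using a by simp
  qed
  have "e i \<in> \<int>" for i by (simp add: e_def)
  then consider (star) h l where "h < Suc hub" "l < Suc hub" "l \<noteq> h" "e h = 3" "e l = -1" "\<And>i. i < Suc hub \<Longrightarrow> i \<noteq> h \<Longrightarrow> i \<noteq> l \<Longrightarrow> e i = 0"
    | (hubs) p q where "(\<Sum>i<Suc hub. (e i)^3) = 14" "p < Suc hub" "q < Suc hub" "p \<noteq> q" "e p = 2" "e q = 2"
    using degree_defects[of "{..<Suc hub}" e] ge e1 e2 e3 tA by fastforce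
  then show "\<exists>h l. h < Suc hub \<and> l < Suc hub \<and> l \<noteq> h \<and> deg B h = 5 \<and> deg B l = 1 \<and>
      (\<forall>i<Suc hub. i \<noteq> h \<longrightarrow> i \<noteq> l \<longrightarrow> deg B i = 2)"
  proof cases
    case star
    have "deg B h = 5" "deg B l = 1" using star(4,5) by (simp_all add: e_def)
    moreover have "deg B i = 2" if "i < Suc hub" "i \<noteq> h" "i \<noteq> l" for i using star(6)[OF that] by (simp add: e_def)
    ultimately show ?thesis using star(1-3) by blast
  next
    case hubs
    have "card (triangles B) = 0" using hubs(1) e3 tA by simp
    then have tri: "triangles B = {}" using B.finite_triangles by simp
    have d: "deg B p = 4" "deg B q = 4" using hubs(5,6) by (simp_all add: e_def)
    obtain y z where yz: "y p = 1" "y q = 0" "z p = 0" "z q = 1"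
      and big: "\<And>\<alpha> \<beta>. energy B (\<lambda>i. \<alpha> * y i + \<beta> * z i) \<ge> 8 * (\<Sum>i<Suc hub. (\<alpha> * y i + \<beta> * z i)\<^sup>2)"
      by (rule B.two_hubs_energy[OF hubs(4,2,3) d tri]) (rule that, assumption+)
    have "p \<le> hub" "q \<le> hub" using hubs(2,3) by simp_all
    then have False using mate_no_energetic_plane[OF B norm en _ _ yz big] by blast
    then show ?thesis ..
  qed
qed

end

section \<open>Connected graphs with the degrees of a propeller graph\<close>

lemma path_arcs_iff_nth:
  "(x, y) \<in> path_arcs l \<longleftrightarrow> (\<exists>i j. i < length l \<and> j < length l \<and> (j = Suc i \<or> i = Suc j) \<and> x = l ! i \<and> y = l ! j)"
proof (induction l rule: path_arcs.induct)
  case (1 v w xs)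
  have "(\<exists>i j. i < length (v#w#xs) \<and> j < length (v#w#xs) \<and> (j = Suc i \<or> i = Suc j) \<and> x = (v#w#xs) ! i \<and> y = (v#w#xs) ! j)
    \<longleftrightarrow> (x, y) \<in> {(v,w),(w,v)} \<or> (\<exists>i j. i < length (w#xs) \<and> j < length (w#xs) \<and> (j = Suc i \<or> i = Suc j) \<and> x = (w#xs) ! i \<and> y = (w#xs) ! j)"
    (is "?L \<longleftrightarrow> ?R1 \<or> ?R2")
  proof
    assume ?L
    then obtain i j where ij: "i < length (v#w#xs)" "j < length (v#w#xs)" "j = Suc i \<or> i = Suc j"
      "x = (v#w#xs) ! i" "y = (v#w#xs) ! j" by blast
    show "?R1 \<or> ?R2"
    proof (cases "i = 0 \<or> j = 0")
      case True
      then show ?thesis using ij by auto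
    next
      case False
      then obtain i' j' where "i = Suc i'" "j = Suc j'" by (metis not0_implies_Suc)
      then have ?R2 using ij by auto
      then show ?thesis ..
    qed
  next
    assume "?R1 \<or> ?R2"
    then show ?L
    proof
      assume ?R1
      then have "(x = (v#w#xs)!0 \<and> y = (v#w#xs)!1) \<or> (x = (v#w#xs)!1 \<and> y = (v#w#xs)!0)" by auto
      then show ?L by (metis One_nat_def length_Cons zero_less_Suc Suc_less_eq)
    next
      assume ?R2
      then obtain i j where "i < length (w#xs)" "j < length (w#xs)" "j = Suc i \<or> i = Suc j"
        "x = (w#xs) ! i" "y = (w#xs) ! j" by blast
      then show ?L by (intro exI[of _ "Suc i"] exI[of _ "Suc j"]) auto
    qed
  qed
  then show ?case using 1 by simp
qed auto

lemma path_arcs_nbrs: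
  assumes "distinct l" "i < length l"
  shows "{y. (l ! i, y) \<in> path_arcs l} = (!) l ` {j. j < length l \<and> (j = Suc i \<or> i = Suc j)}"
  using assms by (auto simp: path_arcs_iff_nth nth_eq_iff_index_eq)

lemma card_path_arcs_nbrs:
  assumes "distinct l" "i < length l"
  shows "card {y. (l ! i, y) \<in> path_arcs l} =
    (if length l = 1 then 0 else if i = 0 \<or> Suc i = length l then 1 else 2)"
proof -
  have "card {y. (l ! i, y) \<in> path_arcs l} = card {j. j < length l \<and> (j = Suc i \<or> i = Suc j)}"
    unfolding path_arcs_nbrs[OF assms]
    by (rule card_image) (use assms in \<open>auto simp: inj_on_def nth_eq_iff_index_eq\<close>)
  also have "{j. j < length l \<and> (j = Suc i \<or> i = Suc j)} = (if Suc i < length l then {Suc i} else {}) \<union> (if i = 0 then {} else {i - 1})"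
    using assms by auto
  finally show ?thesis using assms by (auto simp: card_insert_if)
qed

lemma path_arcs_closed:
  assumes "\<And>x y. (x, y) \<in> path_arcs l \<Longrightarrow> x \<in> S \<Longrightarrow> y \<in> S" "set l \<inter> S \<noteq> {}"
  shows "set l \<subseteq> S"
  using assms
proof (induction l rule: path_arcs.induct)
  case (1 v w xs)
  have "set (w # xs) \<inter> S \<noteq> {}"
    using 1(2)[of v w] 1(3) by auto
  then have "set (w # xs) \<subseteq> S"
    by (rule "1.IH"[rotated]) (use 1(2) in \<open>simp add: disj_commute; blast\<close>)
  then show ?case using 1(2)[of w v] by auto
qed auto

lemma path_arcs_append:
  assumes "xs \<noteq> []" "ys \<noteq> []"
  shows "path_arcs (xs @ ys) = path_arcs xs \<union> path_arcs ys \<union> {(last xs, hd ys), (hd ys, last xs)}"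
  using assms
proof (induction xs rule: path_arcs.induct)
  case ("2_2" v)
  then show ?case by (cases ys) auto
qed auto

lemma path_arcs_block:
  assumes "distinct (ps @ ys @ ss)" "i < length (ps @ ys @ ss)" "j < length (ps @ ys @ ss)"
  shows "((ps @ ys @ ss) ! i, (ps @ ys @ ss) ! j) \<in> path_arcs ys \<longleftrightarrow>
    length ps \<le> i \<and> i < length ps + length ys \<and> length ps \<le> j \<and> j < length ps + length ys \<and> (j = Suc i \<or> i = Suc j)"
    (is "?L \<longleftrightarrow> ?R")
proof
  let ?l = "ps @ ys @ ss"
  have n: "ys ! m = ?l ! (length ps + m)" if "m < length ys" for m using that by (simp add: nth_append)
  {
    assume ?L
    then obtain i' j' where *: "i' < length ys" "j' < length ys" "j' = Suc i' \<or> i' = Suc j'"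
      "?l ! i = ys ! i'" "?l ! j = ys ! j'" by (auto simp: path_arcs_iff_nth)
    then have "i = length ps + i'" "j = length ps + j'"
      using n[of i'] n[of j'] nth_eq_iff_index_eq[OF assms(1,2), of "length ps + i'"]
        nth_eq_iff_index_eq[OF assms(1,3), of "length ps + j'"] by simp_all
    then show ?R using * by auto
  next
    assume ?R
    then show ?L unfolding path_arcs_iff_nth
      by (intro exI[of _ "i - length ps"] exI[of _ "j - length ps"]) (auto simp: n)
  }
qed

text \<open>
  This is the passage from lists of vertices to positions; it serves both for the given propeller
  graph and for the one found in its cospectral mate.
\<close>

lemma propeller_arcs_nth:
  fixes xs ys zs :: "'a list" and u :: 'a
  defines "l \<equiv> xs @ ys @ zs @ [u]" 
  assumes d: "distinct l" and len: "length xs \<ge> 2" "length ys \<ge> 2" "length zs \<ge> 1"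
    and E: "E = path_arcs xs \<union> path_arcs ys \<union> path_arcs zs \<union>
      (\<Union>w\<in>{hd xs, last xs, hd ys, last ys, last zs}. {(u, w), (w, u)})"
    and ij: "i < length l" "j < length l"
  shows "(l ! i, l ! j) \<in> E \<longleftrightarrow> propeller_adj (length xs) (length ys) (length zs) i j"
proof -
  let ?a = "length xs" and ?b = "length ys" and ?k = "length zs"
  let ?u = "?a + ?b + ?k"
  have n: "length l = Suc ?u" by (simp add: l_def)
  have ne: "xs \<noteq> []" "ys \<noteq> []" "zs \<noteq> []" using len by auto
  have p: "l ! 0 = hd xs" "l ! (?a - 1) = last xs" "l ! ?a = hd ys" "l ! (?a + ?b - 1) = last ys"
    "l ! (?u - 1) = last zs" "l ! ?u = u"
    using ne len by (auto simp: l_def nth_append hd_conv_nth last_conv_nth)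
  have e: "l ! i' = l ! j' \<longleftrightarrow> i' = j'" if "i' < Suc ?u" "j' < Suc ?u" for i' j'
    using that d n by (simp add: nth_eq_iff_index_eq)
  have 1: "(l ! i, l ! j) \<in> path_arcs xs \<longleftrightarrow> i < ?a \<and> j < ?a \<and> (j = Suc i \<or> i = Suc j)"
    using path_arcs_block[of "[]" xs "ys @ zs @ [u]" i j] d ij by (simp add: l_def)
  have 2: "(l ! i, l ! j) \<in> path_arcs ys \<longleftrightarrow> ?a \<le> i \<and> i < ?a+?b \<and> ?a \<le> j \<and> j < ?a+?b \<and> (j = Suc i \<or> i = Suc j)"
    using path_arcs_block[of xs ys "zs @ [u]" i j] d ij by (simp add: l_def)
  have 3: "(l ! i, l ! j) \<in> path_arcs zs \<longleftrightarrow> ?a+?b \<le> i \<and> i < ?u \<and> ?a+?b \<le> j \<and> j < ?u \<and> (j = Suc i \<or> i = Suc j)"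
    using path_arcs_block[of "xs @ ys" zs "[u]" i j] d ij by (simp add: l_def)
  have 4: "(l ! i, l ! j) \<in> (\<Union>w\<in>{hd xs, last xs, hd ys, last ys, last zs}. {(u, w), (w, u)}) \<longleftrightarrow>
    i = ?u \<and> j \<in> {0, ?a-1, ?a, ?a+?b-1, ?u-1} \<or> j = ?u \<and> i \<in> {0, ?a-1, ?a, ?a+?b-1, ?u-1}"
  proof -
    have b: "0 < Suc ?u" "?a-1 < Suc ?u" "?a < Suc ?u" "?a+?b-1 < Suc ?u" "?u-1 < Suc ?u" "?u < Suc ?u" by auto
    have "i < Suc ?u" "j < Suc ?u" using ij n by auto
    then show ?thesis unfolding p[symmetric] using b by (auto simp: e)
  qed
  show ?thesis unfolding E Un_iff 1 2 3 4 propeller_adj_def by blast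
qed

context nat_graph
begin

text \<open>
  A longest path that starts at \<open>v\<close> and avoids \<open>u\<close> is a whole component of the graph without \<open>u\<close>.  Its first and its inner
  vertices have no room for further neighbours.  By maximality all neighbours of its last vertex
  lie on the path, and among the vertices of the path only the last but one has room for it.
\<close>

lemma path_extraction:
  assumes v: "v < n" "v \<noteq> u" and le2: "\<And>w. w \<noteq> u \<Longrightarrow> card ({j. A w j} - {u}) \<le> 2"
    and le1: "card ({j. A v j} - {u}) \<le> 1"
  obtains xs where "xs \<noteq> []" "hd xs = v" "distinct xs" "set xs \<subseteq> {..<n} - {u}"
    "\<And>w. w \<in> set xs \<Longrightarrow> {j. A w j} - {u} = {y. (w, y) \<in> path_arcs xs}"
proof -
  define P where "P xs \<longleftrightarrow> xs \<noteq> [] \<and> hd xs = v \<and> distinct xs \<and> set xs \<subseteq> {..<n} - {u} \<and>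
     (\<forall>x y. (x, y) \<in> path_arcs xs \<longrightarrow> A x y)" for xs
  have "P [v]" using v by (simp add: P_def)
  moreover have "length xs < Suc n" if "P xs" for xs
  proof -
    have "length xs = card (set xs)" using that by (simp add: P_def distinct_card)
    also have "\<dots> \<le> card {..<n}" using that by (intro card_mono) (auto simp: P_def)
    finally show ?thesis by simp
  qed
  ultimately obtain xs where P: "P xs" and max: "\<And>ys. P ys \<Longrightarrow> length ys \<le> length xs"
    using ex_has_greatest_nat[of P "[v]" length "Suc n"] by blast
  have ne: "xs \<noteq> []" and hd: "hd xs = v" and d: "distinct xs" and sub: "set xs \<subseteq> {..<n} - {u}"
    and pa: "\<And>x y. (x, y) \<in> path_arcs xs \<Longrightarrow> A x y" using P by (auto simp: P_def)
  define m where "m = length xs - 1"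
  have len: "length xs = Suc m" using ne by (simp add: m_def)
  have last: "xs ! m = last xs" using ne by (simp add: last_conv_nth m_def)
  let ?N = "\<lambda>w. {j. A w j} - {u}"
  let ?p = "\<lambda>w. {y. (w, y) \<in> path_arcs xs}"
  have super: "?p w \<subseteq> ?N w" for w
    using pa path_arcs_subset[of xs] sub by blast
  have last_in: "?N (last xs) \<subseteq> set xs"
  proof
    fix j assume j: "j \<in> ?N (last xs)"
    show "j \<in> set xs"
    proof (rule ccontr)
      assume "j \<notin> set xs"
      then have "P (xs @ [j])"
        using ne hd d sub pa j adj_less2 adj_sym by (auto simp: P_def path_arcs_append)
      then show False using max by force
    qed
  qed
  have inner: "?N (xs ! i) = ?p (xs ! i)" if i: "i < m" for i
  proof (rule card_seteq[OF _ super, symmetric])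
    show "finite (?N (xs ! i))" by simp
    have "xs ! i \<in> set xs" using i len by simp
    then have "xs ! i \<noteq> u" using sub by blast
    then show "card (?N (xs ! i)) \<le> card (?p (xs ! i))"
      using i len le2[of "xs ! i"] le1 hd ne
      by (subst card_path_arcs_nbrs[OF d]) (auto simp: hd_conv_nth)
  qed
  have final: "?N (xs ! m) = ?p (xs ! m)"
  proof (rule antisym[OF _ super], rule subsetI)
    fix j assume j: "j \<in> ?N (xs ! m)"
    then have "j \<in> set xs" using last_in by (auto simp: last)
    then obtain i where i: "i < Suc m" "xs ! i = j" by (auto simp: len in_set_conv_nth)
    then have "i \<noteq> m" using j adj_irrefl by auto
    then have "i < m" using i by simp
    have "xs ! m \<in> set xs" using len by simp
    then have "xs ! m \<noteq> u" using sub by blast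
    then have "xs ! m \<in> ?N (xs ! i)" using j i adj_sym by auto
    then have "(xs ! i, xs ! m) \<in> path_arcs xs" using inner[OF \<open>i < m\<close>] by blast
    then show "j \<in> ?p (xs ! m)" using sym_path_arcs[of xs] i by (auto dest: symD)
  qed
  show ?thesis
  proof (rule that[OF ne hd d sub])
    fix w assume "w \<in> set xs"
    then obtain i where "i < Suc m" "w = xs ! i" by (auto simp: in_set_conv_nth len)
    then show "?N w = ?p w" using inner final by (cases "i = m") auto
  qed
qed

text \<open>
  Extract the component of the leaf after removing \<open>u\<close>; degrees show that only its last vertex is
  adjacent to \<open>u\<close>.  Any other neighbour of \<open>u\<close> begins a component without the leaf, whose two
  ends and no other vertices are adjacent to \<open>u\<close>.  Two such components and the first one
  use up the five neighbours of \<open>u\<close>, and connectedness leaves nothing else.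
\<close>

theorem propeller_structure:
  assumes u: "u < n" "deg A u = 5" and l: "l < n" "l \<noteq> u" "deg A l = 1"
    and two: "\<And>i. i < n \<Longrightarrow> i \<noteq> u \<Longrightarrow> i \<noteq> l \<Longrightarrow> deg A i = 2"
    and conn: "\<And>T. T \<noteq> {} \<Longrightarrow> T \<subseteq> {..<n} \<Longrightarrow> (\<And>i j. i \<in> T \<Longrightarrow> A i j \<Longrightarrow> j \<in> T) \<Longrightarrow> T = {..<n}"
  obtains a b k f where "a \<ge> 2" "b \<ge> 2" "k \<ge> 1" "b \<le> a" "n = Suc (a + b + k)" "bij_betw f {..<n} {..<n}"
    "\<And>i j. i < n \<Longrightarrow> j < n \<Longrightarrow> A (f i) (f j) \<longleftrightarrow> propeller_adj a b k i j"
proof -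
  note result = that
  let ?N = "\<lambda>w. {j. A w j} - {u}"
  have degN: "deg A w = card (?N w) + (if A w u then 1 else 0)" for w
  proof (cases "A w u")
    case True
    then have "deg A w = card (insert u (?N w))" unfolding deg_def by (intro arg_cong[of _ _ card]) auto
    also have "\<dots> = Suc (card (?N w))" by (rule card_insert_disjoint) auto
    finally show ?thesis using True by simp
  next
    case False
    then have "card {j. A w j} = card (?N w)" by (intro arg_cong[of _ _ card]) auto
    then show ?thesis using False by (simp add: deg_def)
  qed
  have le2: "card (?N w) \<le> 2" if "w \<noteq> u" for w
  proof (cases "w < n")
    case True
    then show ?thesis using degN[of w] two[of w] l that by (cases "w = l") auto
  next
    case False
    then have "{j. A w j} = {}" using adj_less by blast
    then show ?thesis by simp
  qed
  have le1: "card (?N l) \<le> 1" using degN[of l] l by simp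
  obtain zs where zs: "zs \<noteq> []" "hd zs = l" "distinct zs" "set zs \<subseteq> {..<n} - {u}"
    and Nz: "\<And>w. w \<in> set zs \<Longrightarrow> ?N w = {y. (w, y) \<in> path_arcs zs}"
    using path_extraction[OF l(1,2) le2 le1] by blast
  have uz: "A w u \<longleftrightarrow> w = last zs" if w: "w \<in> set zs" for w
  proof -
    obtain i where i: "i < length zs" "w = zs ! i" using w by (auto simp: in_set_conv_nth)
    have "w = l \<longleftrightarrow> i = 0" "w = last zs \<longleftrightarrow> Suc i = length zs"
      using i zs by (auto simp: hd_conv_nth last_conv_nth nth_eq_iff_index_eq)
    moreover have "card (?N w) = (if length zs = 1 then 0 else if i = 0 \<or> Suc i = length zs then 1 else 2)"
      unfolding Nz[OF w] unfolding i(2) by (rule card_path_arcs_nbrs[OF zs(3) i(1)])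
    moreover have "w < n" "w \<noteq> u" using w zs(4) by blast+
    moreover have "deg A w = (if w = l then 1 else 2)" using l(3) two[of w] calculation(4,5) by auto
    moreover have "length zs = 1 \<longleftrightarrow> i = 0 \<and> Suc i = length zs" using i(1) by auto
    ultimately have "(if i = 0 then 1 else 2) = (if i = 0 \<and> Suc i = length zs then 0 else if i = 0 \<or> Suc i = length zs then 1 else 2) + (if A w u then 1 else 0 :: nat)"
      using degN[of w] by presburger
    then show ?thesis unfolding \<open>w = last zs \<longleftrightarrow> _\<close> by (cases "i = 0"; cases "Suc i = length zs"; cases "A w u") simp_all
  qed
  \<comment> \<open>what is needed of the component of \<open>c\<close>, which is extracted twice, once for each cycle\<close>
  define good where "good c xs \<longleftrightarrow> length xs \<ge> 2 \<and> hd xs = c \<and> distinct xs \<and> set xs \<subseteq> {..<n} - {u} \<and> set xs \<inter> set zs = {} \<and>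
     (\<forall>w\<in>set xs. ?N w = {y. (w, y) \<in> path_arcs xs}) \<and> (\<forall>w\<in>set xs. A w u \<longleftrightarrow> w \<in> {hd xs, last xs})" for c xs
  have loop: "\<exists>xs. good c xs" if c: "A u c" "c \<notin> set zs" for c
  proof -
    have cn: "c < n" "c \<noteq> u" "c \<noteq> l" using c adj_less2 adj_irrefl zs hd_in_set[of zs] by auto
    have "card (?N c) = 1" using degN[of c] two[OF cn] adj_sym[OF c(1)] by simp
    then have le: "card (?N c) \<le> 1" and nonempty: "?N c \<noteq> {}" by (simp, metis card.empty zero_neq_one)
    obtain xs where xs: "xs \<noteq> []" "hd xs = c" "distinct xs" "set xs \<subseteq> {..<n} - {u}"
      and Nx: "\<And>w. w \<in> set xs \<Longrightarrow> ?N w = {y. (w, y) \<in> path_arcs xs}"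
      using path_extraction[OF cn(1,2) le2 le] by blast
    have disj: "set xs \<inter> set zs = {}"
    proof (rule ccontr)
      assume *: "set xs \<inter> set zs \<noteq> {}"
      have "set xs \<subseteq> set zs"
      proof (rule path_arcs_closed[OF _ *])
        fix x y assume xy: "(x, y) \<in> path_arcs xs" "x \<in> set zs"
        then have "x \<in> set xs" using path_arcs_subset[of xs] by auto
        then have "y \<in> ?N x" using Nx xy by blast
        then show "y \<in> set zs" using Nz[OF xy(2)] path_arcs_subset[of zs] by auto
      qed
      then show False using c(2) xs(2) hd_in_set[OF xs(1)] by auto
    qed
    have "length xs \<noteq> 1"
    proof
      assume "length xs = 1"
      then have "xs = [c]" using xs by (cases xs) auto
      then show False using Nx[of c] nonempty by auto
    qed
    then have len: "length xs \<ge> 2" using xs(1) by (cases xs; cases "tl xs") auto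
    have "A w u \<longleftrightarrow> w \<in> {hd xs, last xs}" if w: "w \<in> set xs" for w
    proof -
      obtain i where i: "i < length xs" "w = xs ! i" using w by (auto simp: in_set_conv_nth)
      have "w = hd xs \<longleftrightarrow> i = 0" "w = last xs \<longleftrightarrow> Suc i = length xs"
        using i xs by (auto simp: hd_conv_nth last_conv_nth nth_eq_iff_index_eq)
      then have iff: "w \<in> {hd xs, last xs} \<longleftrightarrow> i = 0 \<or> Suc i = length xs" by simp
      have "card (?N w) = (if i = 0 \<or> Suc i = length xs then 1 else 2)"
        unfolding Nx[OF w] unfolding i(2) using card_path_arcs_nbrs[OF xs(3) i(1)] len by simp
      moreover have "w < n" "w \<noteq> u" using w xs(4) by blast+
      moreover have "w \<noteq> l" using w disj zs(2) hd_in_set[OF zs(1)] by blast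
      ultimately have "2 = (if i = 0 \<or> Suc i = length xs then 1 else 2) + (if A w u then 1 else 0 :: nat)"
        using degN[of w] two[of w] by presburger
      then show ?thesis unfolding iff by (cases "i = 0 \<or> Suc i = length xs"; cases "A w u") simp_all
    qed
    then have "good c xs" unfolding good_def using xs(2-4) Nx disj len by blast
    then show ?thesis ..
  qed
  have cu: "card {j. A u j} = 5" using u by (simp add: deg_def)
  have lz: "{j. A u j} \<inter> set zs = {last zs}" using uz adj_sym zs(1) by auto
  have "\<not> {j. A u j} \<subseteq> set zs"
  proof
    assume "{j. A u j} \<subseteq> set zs"
    then have "{j. A u j} = {last zs}" using lz by auto
    then show False using cu by simp
  qed
  then obtain c where c: "A u c" "c \<notin> set zs" by auto
  obtain xs where gxs: "good c xs" using loop[OF c] ..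
  have xs: "length xs \<ge> 2" "hd xs = c" "distinct xs" "set xs \<subseteq> {..<n} - {u}" "set xs \<inter> set zs = {}"
    using gxs unfolding good_def by blast+
  have Nx: "?N w = {y. (w, y) \<in> path_arcs xs}" if "w \<in> set xs" for w
    using gxs that unfolding good_def by blast
  have ux: "A w u \<longleftrightarrow> w \<in> {hd xs, last xs}" if "w \<in> set xs" for w
    using gxs that unfolding good_def by blast
  have xne: "xs \<noteq> []" using xs by auto
  have lx: "{j. A u j} \<inter> set xs = {hd xs, last xs}" using ux adj_sym xne by auto
  have "\<not> {j. A u j} \<subseteq> set zs \<union> set xs"
  proof
    assume "{j. A u j} \<subseteq> set zs \<union> set xs"
    then have "{j. A u j} = {last zs, hd xs, last xs}" using lz lx by blast
    then have "card {j. A u j} \<le> 3" by (simp add: card_insert_if)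
    then show False using cu by simp
  qed
  then obtain d where d: "A u d" "d \<notin> set zs" "d \<notin> set xs" by auto
  obtain ys where gys: "good d ys" using loop[OF d(1,2)] ..
  have ys: "length ys \<ge> 2" "hd ys = d" "distinct ys" "set ys \<subseteq> {..<n} - {u}" "set ys \<inter> set zs = {}"
    using gys unfolding good_def by blast+
  have Ny: "?N w = {y. (w, y) \<in> path_arcs ys}" if "w \<in> set ys" for w
    using gys that unfolding good_def by blast
  have uy: "A w u \<longleftrightarrow> w \<in> {hd ys, last ys}" if "w \<in> set ys" for w
    using gys that unfolding good_def by blast
  have yne: "ys \<noteq> []" using ys by auto
  have ly: "{j. A u j} \<inter> set ys = {hd ys, last ys}" using uy adj_sym yne by auto
  have xy: "set ys \<inter> set xs = {}"
  proof (rule ccontr)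
    assume *: "set ys \<inter> set xs \<noteq> {}"
    have "set ys \<subseteq> set xs"
    proof (rule path_arcs_closed[OF _ *])
      fix x y assume xy: "(x, y) \<in> path_arcs ys" "x \<in> set xs"
      then have "x \<in> set ys" using path_arcs_subset[of ys] by auto
      then have "y \<in> ?N x" using Ny xy by blast
      then show "y \<in> set xs" using Nx[OF xy(2)] path_arcs_subset[of xs] by auto
    qed
    then show False using d(3) ys(2) hd_in_set[OF yne] by auto
  qed
  have hl: "hd ws \<noteq> last ws" if "length ws \<ge> 2" "distinct ws" for ws :: "nat list"
  proof -
    have "ws \<noteq> []" using that by auto
    then show ?thesis using that by (simp add: hd_conv_nth last_conv_nth nth_eq_iff_index_eq)
  qed
  let ?M = "{hd xs, last xs, hd ys, last ys, last zs}"
  have "card ?M = 5"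
  proof -
    have "hd xs \<in> set xs" "last xs \<in> set xs" "hd ys \<in> set ys" "last ys \<in> set ys" "last zs \<in> set zs"
      using xne yne zs(1) by auto
    then have "distinct [hd xs, last xs, hd ys, last ys, last zs]"
      using xs(5) ys(5) xy hl[OF xs(1,3)] hl[OF ys(1,3)] by auto
    from distinct_card[OF this] show ?thesis by simp
  qed
  moreover have "?M \<subseteq> {j. A u j}" using lx ly lz by blast
  ultimately have Nu: "{j. A u j} = ?M" using cu card_subset_eq[of "{j. A u j}" ?M] by simp
  define T where "T = set xs \<union> set ys \<union> set zs \<union> {u}"
  have "T = {..<n}"
  proof (rule conn)
    show "T \<noteq> {}" "T \<subseteq> {..<n}" using xs ys zs u by (auto simp: T_def)
    fix i j assume i: "i \<in> T" and ij: "A i j"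
    consider "i = u" | "j = u" | "j \<in> ?N i" "i \<in> set xs" | "j \<in> ?N i" "i \<in> set ys" | "j \<in> ?N i" "i \<in> set zs"
      using i ij by (auto simp: T_def)
    then show "j \<in> T"
    proof cases
      case 1
      then have "j \<in> ?M" using ij Nu by blast
      then show ?thesis using xne yne zs(1) by (auto simp: T_def)
    next
      case 3
      then show ?thesis using Nx[OF 3(2)] path_arcs_subset[of xs] by (auto simp: T_def)
    next
      case 4
      then show ?thesis using Ny[OF 4(2)] path_arcs_subset[of ys] by (auto simp: T_def)
    next
      case 5
      then show ?thesis using Nz[OF 5(2)] path_arcs_subset[of zs] by (auto simp: T_def)
    qed (auto simp: T_def)
  qed
  define E where "E = {(i, j). A i j}"
  have E: "E = path_arcs xs \<union> path_arcs ys \<union> path_arcs zs \<union>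
      (\<Union>w\<in>{hd xs, last xs, hd ys, last ys, last zs}. {(u, w), (w, u)})" (is "_ = ?R")
  proof (intro equalityI subsetI)
    fix e assume "e \<in> E"
    then obtain i j where e: "e = (i, j)" and ij: "A i j" by (auto simp: E_def)
    then have "i \<in> T" using adj_less \<open>T = {..<n}\<close> by auto
    then consider "i = u" | "j = u" | "j \<in> ?N i" "i \<in> set xs" | "j \<in> ?N i" "i \<in> set ys" | "j \<in> ?N i" "i \<in> set zs"
      using ij by (auto simp: T_def)
    then show "e \<in> ?R"
    proof cases
      case 1
      then have "j \<in> ?M" using ij Nu by blast
      then show ?thesis using e 1 by blast
    next
      case 2
      then have "i \<in> ?M" using ij Nu adj_sym by blast
      then show ?thesis using e 2 by blast
    qed (use e Nx Ny Nz in auto)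
  next
    fix e assume "e \<in> ?R"
    then consider "e \<in> path_arcs xs" | "e \<in> path_arcs ys" | "e \<in> path_arcs zs" | w where "w \<in> ?M" "e = (u, w) \<or> e = (w, u)"
      by blast
    then show "e \<in> E"
    proof cases
      case 1
      then show ?thesis using Nx path_arcs_subset[of xs] by (cases e) (auto simp: E_def)
    next
      case 2
      then show ?thesis using Ny path_arcs_subset[of ys] by (cases e) (auto simp: E_def)
    next
      case 3
      then show ?thesis using Nz path_arcs_subset[of zs] by (cases e) (auto simp: E_def)
    next
      case 4
      then have "A u w" using Nu by blast
      then show ?thesis using 4 adj_sym by (auto simp: E_def)
    qed
  qed
  have main: thesis
    if E: "E = path_arcs xs \<union> path_arcs ys \<union> path_arcs zs \<union>
      (\<Union>w\<in>{hd xs, last xs, hd ys, last ys, last zs}. {(u, w), (w, u)})"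
      and d: "distinct (xs @ ys @ zs @ [u])" and s: "set (xs @ ys @ zs @ [u]) = {..<n}"
      and len: "length xs \<ge> 2" "length ys \<ge> 2" "length ys \<le> length xs" for xs ys
  proof -
    let ?l = "xs @ ys @ zs @ [u]"
    have k: "length zs \<ge> 1" using zs(1) by (cases zs) auto
    have n: "length ?l = n" using distinct_card[OF d] s by simp
    have "n = Suc (length xs + length ys + length zs)" using n by simp
    moreover have "bij_betw ((!) ?l) {..<n} {..<n}"
      using bij_betw_nth[OF d] n s by metis
    moreover have "A (?l ! i) (?l ! j) \<longleftrightarrow> propeller_adj (length xs) (length ys) (length zs) i j" if "i < n" "j < n" for i j
      using propeller_arcs_nth[OF d len(1,2) k E, of i j] that n by (simp add: E_def)
    ultimately show thesis using result[OF len(1,2) k len(3)] by blast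
  qed
  have ds: "distinct (xs @ ys @ zs @ [u])" "set (xs @ ys @ zs @ [u]) = {..<n}"
    "distinct (ys @ xs @ zs @ [u])" "set (ys @ xs @ zs @ [u]) = {..<n}"
    using xs ys zs xy \<open>T = {..<n}\<close> by (auto simp: T_def)
  show thesis
  proof (cases "length ys \<le> length xs")
    case True
    show thesis by (rule main[OF E ds(1,2) xs(1) ys(1) True])
  next
    case False
    then have le: "length xs \<le> length ys" by simp
    have M: "?M = {hd ys, last ys, hd xs, last xs, last zs}" by blast
    have E2: "E = path_arcs ys \<union> path_arcs xs \<union> path_arcs zs \<union>
      (\<Union>w\<in>{hd ys, last ys, hd xs, last xs, last zs}. {(u, w), (w, u)})"
      unfolding M[symmetric] using E by (simp only: Un_ac)
    show thesis by (rule main[OF E2 ds(3,4) ys(1) xs(1) le])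
  qed
qed

end

section \<open>Recovering the parameters from a sum of hyperbolic sines\<close>

text \<open>
  Up to simple factors this is the characteristic polynomial of a propeller graph with \<open>P = 2p\<close>, \<open>Q = 2q\<close>
  and \<open>K = 2k + 1\<close>, see \<open>propeller_fun_eq_det\<close>.
\<close>

definition propeller_fun :: "int \<Rightarrow> int \<Rightarrow> int \<Rightarrow> real \<Rightarrow> real" where
  "propeller_fun P Q K t =
     cosh t * sinh (P*t) * sinh (Q*t) * sinh (K*t)
     + 2 * cosh t * (cosh (P*t) - 1) * sinh (Q*t) * cosh (K*t)
     + 2 * cosh t * sinh (P*t) * (cosh (Q*t) - 1) * cosh (K*t)
     - 3 * sinh t * sinh (P*t) * sinh (Q*t) * cosh (K*t)"

text \<open>
  Coefficients and frequencies of the expansion of \<open>4 propeller_fun P Q K\<close> into hyperbolic sines,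
  without the two frequencies \<open>P + Q + K \<plusminus> 1\<close> that depend on the number of vertices only.
\<close>

definition low_terms :: "int \<Rightarrow> int \<Rightarrow> int \<Rightarrow> (real \<times> int) list" where
  "low_terms P Q K = 
    [(3, P+Q-K-1), (1, P-Q+K+1), (-2, P-Q+K-1), (1, Q-P+K+1), (-2, Q-P+K-1),
     (-2, P+K+1), (-2, P+K-1), (-2, Q+K+1), (-2, Q+K-1),
     (-2, P-K+1), (-2, P-K-1), (-2, Q-K+1), (-2, Q-K-1)]"

definition sinh_sum :: "(real \<times> int) list \<Rightarrow> real \<Rightarrow> real" where
  "sinh_sum xs t = (\<Sum>(c,f)\<leftarrow>xs. c * sinh (real_of_int f * t))"

lemma propeller_fun_sinh_sum:
  "4 * propeller_fun P Q K t = sinh ((P+Q+K+1)*t) + 4 * sinh ((P+Q+K-1)*t)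
     + sinh_sum (low_terms P Q K) t"
  unfolding propeller_fun_def low_terms_def sinh_sum_def
  by (simp add: ring_distribs sinh_add cosh_add sinh_diff cosh_diff)

lemma sinh_over_exp_limit:
  fixes f M :: int
  assumes "\<bar>f\<bar> \<le> M" "M > 0"
  shows "((\<lambda>t::real. sinh (f*t) / exp (M*t)) \<longlongrightarrow> (if f = M then 1/2 else if f = -M then -1/2 else 0)) at_top"
proof -
  have eq: "sinh (f*t) / exp (M*t) = (exp (-(real_of_int (M-f)*t)) - exp (-(real_of_int (M+f)*t))) / 2" for t :: real
    by (simp add: sinh_field_def exp_minus exp_add exp_diff field_simps ring_distribs)
  have l: "((\<lambda>t::real. exp (-(real_of_int c*t))) \<longlongrightarrow> (if c = 0 then 1 else 0)) at_top" if "c \<ge> 0" for c :: int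
  proof (cases "c = 0")
    case False
    then have "real_of_int c > 0" using that by simp
    then have "((\<lambda>t::real. exp (-(real_of_int c*t))) \<longlongrightarrow> 0) at_top" by real_asymp
    then show ?thesis using False by simp
  qed simp
  have "((\<lambda>t::real. (exp (-(real_of_int (M-f)*t)) - exp (-(real_of_int (M+f)*t))) / 2) \<longlongrightarrow>
     ((if M-f = 0 then 1 else 0) - (if M+f=0 then 1 else 0)) / 2) at_top"
    by (intro tendsto_intros l) (use assms in auto)
  moreover have "((if M-f = 0 then 1 else 0) - (if M+f=0 then 1 else 0)) / 2 = (if f = M then 1/2 else if f = -M then -1/2 else (0::real))"
    using assms by auto
  ultimately show ?thesis by (simp only: eq)
qed

lemma sinh_sum_over_exp_limit:
  fixes M :: int
  assumes "\<And>c f. (c,f) \<in> set xs \<Longrightarrow> \<bar>f\<bar> \<le> M" "M > 0"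
  shows "((\<lambda>t::real. sinh_sum (xs) t / exp (M*t)) \<longlongrightarrow>
      (\<Sum>(c,f)\<leftarrow>xs. c * (if f = M then 1/2 else if f = -M then -1/2 else 0))) at_top"
  using assms(1)
proof (induction xs)
  case (Cons x xs)
  obtain c f where x: "x = (c,f)" by (cases x)
  have *: "((\<lambda>t::real. c * (sinh (f*t) / exp (M*t))) \<longlongrightarrow> c * (if f = M then 1/2 else if f = -M then -1/2 else 0)) at_top"
    by (intro tendsto_intros sinh_over_exp_limit assms Cons.prems[of c]) (simp add: x)
  have **: "((\<lambda>t::real. sinh_sum (xs) t / exp (M*t)) \<longlongrightarrow>
      (\<Sum>(c,f)\<leftarrow>xs. c * (if f = M then 1/2 else if f = -M then -1/2 else 0))) at_top"
    by (rule Cons.IH) (use Cons.prems in auto)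
  show ?case using tendsto_add[OF * **] by (simp add: x sinh_sum_def add_divide_distrib)
qed (simp add: sinh_sum_def)

lemma propeller_fun_at_0:
  assumes "P > 0" "Q > 0" "K > 0"
  shows "((\<lambda>t::real. propeller_fun P Q K t / t^3) \<longlongrightarrow> P * Q * (P + Q + K - 3)) (at_right 0)"
proof -
  have s: "((\<lambda>t::real. sinh (c*t) / t) \<longlongrightarrow> c) (at_right 0)" if "c > 0" for c :: real
    using that by real_asymp
  have c: "((\<lambda>t::real. cosh (c*t)) \<longlongrightarrow> 1) (at_right 0)" if "c > 0" for c :: real
    using that by real_asymp
  have c2: "((\<lambda>t::real. (cosh (c*t) - 1) / t^2) \<longlongrightarrow> c^2/2) (at_right 0)" if "c > 0" for c :: real
    unfolding power2_eq_square[of c] using that by real_asymp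
  have c1: "((\<lambda>t::real. cosh t) \<longlongrightarrow> 1) (at_right 0)" and s1: "((\<lambda>t::real. sinh t / t) \<longlongrightarrow> 1) (at_right 0)"
    using c[of 1] s[of 1] by simp_all
  have "((\<lambda>t::real. cosh t * (sinh (P*t)/t) * (sinh (Q*t)/t) * (sinh (K*t)/t)
     + 2 * cosh t * ((cosh (P*t) - 1)/t^2) * (sinh (Q*t)/t) * cosh (K*t)
     + 2 * cosh t * (sinh (P*t)/t) * ((cosh (Q*t) - 1)/t^2) * cosh (K*t)
     - 3 * (sinh t/t) * (sinh (P*t)/t) * (sinh (Q*t)/t) * cosh (K*t)) \<longlongrightarrow>
     1 * real_of_int P * real_of_int Q * real_of_int K + 2 * 1 * (real_of_int P^2/2) * real_of_int Q * 1 + 2 * 1 * real_of_int P * (real_of_int Q^2/2) * 1 - 3 * 1 * real_of_int P * real_of_int Q * 1) (at_right 0)"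
    by (intro tendsto_add tendsto_diff tendsto_mult tendsto_const s c c2 c1 s1) (use assms in auto)
  also have "(\<lambda>t::real. cosh t * (sinh (P*t)/t) * (sinh (Q*t)/t) * (sinh (K*t)/t)
     + 2 * cosh t * ((cosh (P*t) - 1)/t^2) * (sinh (Q*t)/t) * cosh (K*t)
     + 2 * cosh t * (sinh (P*t)/t) * ((cosh (Q*t) - 1)/t^2) * cosh (K*t)
     - 3 * (sinh t/t) * (sinh (P*t)/t) * (sinh (Q*t)/t) * cosh (K*t)) = (\<lambda>t. propeller_fun P Q K t / t^3)"
    unfolding propeller_fun_def by (simp add: power3_eq_cube power2_eq_square field_simps diff_divide_distrib add_divide_distrib)
  finally show ?thesis by (simp add: algebra_simps power2_eq_square)
qed

text \<open>
  The leading exponential on the left is that of \<open>P + K + 1\<close> or of \<open>P + Q - K - 1\<close>, whichever is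
  larger.  The coefficient is \<open>-2\<close> (or \<open>-4\<close> if \<open>P = Q\<close>) for the first, 3 for the second, and in the
  case of a tie the sum \<open>1\<close> or \<open>-1\<close>: it never vanishes.  As \<open>P + K = N - Q\<close> and \<open>P + Q - K = N - 2 K\<close>
  with the common value \<open>N\<close> of \<open>P + Q + K\<close>, all frequencies on the right are smaller.
\<close>

lemma low_terms_neq:
  fixes P Q K P' Q' K' :: int
  assumes "Q \<le> P" "Q' \<le> P'" "Q < Q'" "P' < P" "K < K'" "Q \<ge> 6" "K \<ge> 3"
    and N: "P + Q + K = P' + Q' + K'"
  shows "\<exists>t::real>0. sinh_sum (low_terms P Q K) t \<noteq>
          sinh_sum (low_terms P' Q' K') t"
proof (rule ccontr)
  assume *: "\<not> ?thesis"
  \<comment> \<open>the two candidates for the largest frequency on the left\<close>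
  define M where "M = max (P+K+1) (P+Q-K-1)"
  let ?l = "\<lambda>f. if f = M then 1/2 else if f = -M then -1/2 else (0::real)"
  have M: "M > 0" using assms by (simp add: M_def)
  have eq: "\<forall>\<^sub>F t::real in at_top. sinh_sum (low_terms P Q K) t / exp (real_of_int M*t) =
          sinh_sum (low_terms P' Q' K') t / exp (M*t)"
    using eventually_gt_at_top[of "0::real"] by eventually_elim (use * in auto)
  have b1: "\<bar>f\<bar> \<le> M" if "(c,f) \<in> set (low_terms P Q K)" for c f
    using that assms by (auto simp: low_terms_def M_def)
  have b2: "\<bar>f\<bar> < M" if "(c,f) \<in> set (low_terms P' Q' K')" for c f
    using that assms by (auto simp: low_terms_def M_def)
  have l1: "((\<lambda>t::real. sinh_sum (low_terms P Q K) t / exp (M*t)) \<longlongrightarrow>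
      (\<Sum>(c,f)\<leftarrow>low_terms P Q K. c * ?l f)) at_top"
    by (rule sinh_sum_over_exp_limit[OF b1 M])
  have l2: "((\<lambda>t::real. sinh_sum (low_terms P' Q' K') t / exp (M*t)) \<longlongrightarrow>
      (\<Sum>(c,f)\<leftarrow>low_terms P' Q' K'. c * ?l f)) at_top"
    by (rule sinh_sum_over_exp_limit[OF _ M]) (use b2 in fastforce)
  have "(\<Sum>(c,f)\<leftarrow>low_terms P Q K. c * ?l f) = (\<Sum>(c,f)\<leftarrow>low_terms P' Q' K'. c * ?l f)"
    using tendsto_unique[OF _ Lim_transform_eventually[OF l1 eq] l2] by simp
  also have "map (\<lambda>(c,f). c * ?l f) (low_terms P' Q' K') = map (\<lambda>_. 0) (low_terms P' Q' K')"
    by (rule map_cong) (use b2 in fastforce)+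
  also have "sum_list \<dots> = 0" by (simp add: sum_list_0)
  finally have z: "(\<Sum>(c,f)\<leftarrow>low_terms P Q K. c * ?l f) = 0" .
  define l where "l f = ?l f" for f
  have n: "l f = 0" if "f < M" "-M < f" for f using that by (auto simp: l_def)
  \<comment> \<open>only three frequencies can be as large as \<open>M\<close>\<close>
  have zeros: "l (P-Q+K+1) = 0" "l (P-Q+K-1) = 0" "l (Q-P+K+1) = 0" "l (Q-P+K-1) = 0"
    "l (P+K-1) = 0" "l (Q+K-1) = 0" "l (P-K+1) = 0" "l (P-K-1) = 0" "l (Q-K+1) = 0" "l (Q-K-1) = 0"
    using assms(1-7) by (auto intro!: n simp: M_def)
  have "(\<Sum>(c,f)\<leftarrow>low_terms P Q K. c * l f) = 3 * l (P+Q-K-1) - 2 * l (P+K+1) - 2 * l (Q+K+1)"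
    unfolding low_terms_def by (simp add: zeros)
  also have "\<dots> \<noteq> 0"
  proof (cases "P+K+1 < P+Q-K-1")
    case True
    then have "l (P+Q-K-1) = 1/2" "l (P+K+1) = 0" "l (Q+K+1) = 0"
      using assms(1-7) by (auto simp: l_def M_def)
    then show ?thesis by simp
  next
    case False
    then have "l (P+K+1) = 1/2" "l (Q+K+1) \<in> {0, 1/2}" "l (P+Q-K-1) \<in> {0, 1/2}"
      using assms(1-7) by (auto simp: l_def M_def)
    then show ?thesis by auto
  qed
  finally have "(\<Sum>(c,f)\<leftarrow>low_terms P Q K. c * l f) \<noteq> 0" .
  then show False using z by (simp add: l_def)
qed

text \<open>
  The limit at 0 gives \<open>P Q = P' Q'\<close>.  Suppose \<open>Q < Q'\<close>.  Among the factorisations of a given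
  number, the one with the smaller factor \<open>Q\<close> has the larger sum, so \<open>P + Q > P' + Q'\<close> and \<open>K < K'\<close>, and
  \<open>low_terms_neq\<close> applies.
\<close>

theorem propeller_fun_inj:
  fixes P Q K P' Q' K' :: int
  assumes "Q \<le> P" "Q' \<le> P'" "Q \<ge> 6" "Q' \<ge> 6" "K \<ge> 3" "K' \<ge> 3"
    and N: "P + Q + K = P' + Q' + K'"
    and eq: "\<And>t. t > 0 \<Longrightarrow> propeller_fun P Q K t = propeller_fun P' Q' K' t"
  shows "P = P' \<and> Q = Q' \<and> K = K'"
proof -
  have "\<forall>\<^sub>F t::real in at_right 0. t > 0" by (simp add: eventually_at_right_less)
  then have ev: "\<forall>\<^sub>F t in at_right 0. propeller_fun P Q K t / t^3 = propeller_fun P' Q' K' t / t^3"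
    by eventually_elim (simp add: eq)
  have "real_of_int (P * Q * (P + Q + K - 3)) = real_of_int (P' * Q' * (P' + Q' + K' - 3))"
    by (rule tendsto_unique[OF _ Lim_transform_eventually[OF propeller_fun_at_0 ev] propeller_fun_at_0])
      (use assms in auto)
  then have "P * Q * (P + Q + K - 3) = P' * Q' * (P + Q + K - 3)" unfolding N of_int_eq_iff .
  then have PQ: "P * Q = P' * Q'" using assms by simp
  have main: False if hyps: "Q < Q'" "Q \<le> P" "Q' \<le> P'" "Q \<ge> 6" "Q' \<ge> 6" "K \<ge> 3" "K' \<ge> 3" 
    "P + Q + K = P' + Q' + K'" "P * Q = P' * Q'"
    "\<And>t. t > 0 \<Longrightarrow> propeller_fun P Q K t = propeller_fun P' Q' K' t" for P Q K P' Q' K'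
  proof -
    \<comment> \<open>otherwise \<open>P Q\<close> would be less than \<open>P' Q'\<close>\<close>
    have "P' < P"
    proof (rule ccontr)
      assume "\<not> P' < P"
      then have "P * Q \<le> P' * Q" using hyps(4) by (simp add: mult_right_mono)
      also have "\<dots> < P' * Q'" using hyps(1,3,5) by simp
      finally show False using hyps(9) by simp
    qed
    have "(P + Q - P' - Q') * Q = (P' - Q) * (Q' - Q)"
      using hyps(9) by (simp add: algebra_simps)
    also have "\<dots> > 0" using hyps(1,3) by simp
    finally have "P + Q - P' - Q' > 0" using hyps(4) by (simp add: zero_less_mult_iff)
    then have "K < K'" using hyps(8) by simp
    obtain t :: real where "t > 0" "sinh_sum (low_terms P Q K) t \<noteq>
          sinh_sum (low_terms P' Q' K') t"
      using low_terms_neq[OF hyps(2,3,1) \<open>P' < P\<close> \<open>K < K'\<close> hyps(4,6,8)] by blast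
    moreover have "real_of_int P + real_of_int Q + real_of_int K = real_of_int P' + real_of_int Q' + real_of_int K'"
      using hyps(8) by linarith
    ultimately show False
      using propeller_fun_sinh_sum[of P Q K t] propeller_fun_sinh_sum[of P' Q' K' t] hyps(10)[of t] by simp
  qed
  have "\<not> Q < Q'" using main[OF _ assms(1-6) N PQ eq] by blast
  moreover have "\<not> Q' < Q"
    using main[OF _ assms(2,1,4,3,6,5) N[symmetric] PQ[symmetric] eq[symmetric]] by blast
  ultimately have "Q = Q'" by simp
  then show ?thesis using PQ assms by simp
qed

section \<open>The characteristic polynomial of a propeller graph\<close>

text \<open>
  Gaussian elimination on the columns of \<open>M\<close>: the vectors \<open>h i\<close> are the columns of a unitriangular \<open>U\<close> for which \<open>M U\<close> is lower triangular with the diagonal \<open>c\<close>.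
\<close>

lemma det_by_unitriangular:
  fixes M :: "'a :: idom mat"
  assumes M: "M \<in> carrier_mat n n"
    and h1: "\<And>i. i < n \<Longrightarrow> h i i = 1" and h0: "\<And>i j. i < j \<Longrightarrow> j < n \<Longrightarrow> h i j = 0"
    and z: "\<And>i j. j < i \<Longrightarrow> i < n \<Longrightarrow> (\<Sum>l<n. M $$ (j, l) * h i l) = 0"
    and c: "\<And>i. i < n \<Longrightarrow> (\<Sum>l<n. M $$ (i, l) * h i l) = c i"
  shows "det M = (\<Prod>i<n. c i)"
proof -
  define U where "U = mat n n (\<lambda>(j, i). h i j)"
  have U: "U \<in> carrier_mat n n" by (simp add: U_def)
  have MU: "M * U \<in> carrier_mat n n" using M U by simp
  have e: "(M * U) $$ (j, i) = (\<Sum>l<n. M $$ (j, l) * h i l)" if "i < n" "j < n" for i j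
    using that M by (simp add: U_def scalar_prod_def atLeast0LessThan)
  have "det U = prod_list (diag_mat U)"
    by (rule det_upper_triangular[OF _ U]) (use h0 in \<open>auto simp: U_def\<close>)
  also have "diag_mat U = map (\<lambda>_. 1) [0..<n]"
    unfolding diag_mat_def by (rule map_cong) (use h1 in \<open>auto simp: U_def\<close>)
  finally have "det U = 1" by (simp add: map_replicate_const)
  then have "det M = det (M * U)" using det_mult[OF M U] by simp
  also have "\<dots> = prod_list (diag_mat (M * U))"
    by (rule det_lower_triangular[OF _ MU]) (simp add: e z)
  also have "diag_mat (M * U) = map c [0..<n]"
    unfolding diag_mat_def by (rule map_cong) (use M U in \<open>auto simp: e c simp del: index_mult_mat(1)\<close>)
  finally show ?thesis by (simp add: prod.distinct_set_conv_list[symmetric] atLeast0LessThan)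
qed

context propeller
begin

text \<open>
  Solutions of \<open>y (m + 2) = 2 cosh 2t \<cdot> y (m + 1) - y m\<close>, which is the equation \<open>(L - x) y = 0\<close> at a
  vertex of degree 2 when \<open>x = 2 - 2 cosh 2t\<close>: \<open>sn\<close> vanishes at 0, \<open>cn\<close> also satisfies the
  equation at the leaf, and \<open>arch t m\<close> takes the value 1 at both ends of \<open>{0..m + 1}\<close>.
\<close>

definition sn :: "real \<Rightarrow> nat \<Rightarrow> real" where "sn t m = sinh (2*t*real m)"
definition cn :: "real \<Rightarrow> nat \<Rightarrow> real" where "cn t m = cosh ((2*real m+1)*t)"
definition arch :: "real \<Rightarrow> nat \<Rightarrow> nat \<Rightarrow> real" where
  "arch t m j = cosh ((real m + 1 - 2 * real j) * t) / cosh ((real m + 1) * t)"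

lemma sn_0: "sn t 0 = 0" by (simp add: sn_def)
lemma sn_rec: "sn t (Suc (Suc m)) = 2 * cosh (2*t) * sn t (Suc m) - sn t m"
proof -
  have "sn t (Suc (Suc m)) = sinh (2*t*real (Suc m) + 2*t)" "sn t m = sinh (2*t*real (Suc m) - 2*t)"
    by (simp_all add: sn_def algebra_simps)
  then show ?thesis by (simp add: sn_def sinh_add sinh_diff)
qed
lemma cn_rec: "cn t (Suc (Suc m)) = 2 * cosh (2*t) * cn t (Suc m) - cn t m"
proof -
  have "cn t (Suc (Suc m)) = cosh ((2*real (Suc m)+1)*t + 2*t)" "cn t m = cosh ((2*real (Suc m)+1)*t - 2*t)"
    by (simp_all add: cn_def algebra_simps)
  then show ?thesis by (simp add: cn_def cosh_add cosh_diff)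
qed
lemma cn_1: "cn t (Suc 0) = (2 * cosh (2*t) - 1) * cn t 0"
proof -
  have "cn t (Suc 0) = cosh (2*t+t)" "cn t 0 = cosh (2*t-t)" by (simp_all add: cn_def algebra_simps)
  then have "cn t (Suc 0) + cn t 0 = 2 * cosh (2*t) * cosh t" by (simp only: cosh_add cosh_diff)
  moreover have "cn t 0 = cosh t" by (simp add: cn_def)
  ultimately show ?thesis by (simp add: left_diff_distrib)
qed
lemma arch_rec: "arch t m (Suc (Suc j)) = 2 * cosh (2*t) * arch t m (Suc j) - arch t m j"
proof -
  have e: "(real m + 1 - 2 * real (Suc (Suc j))) * t = (real m + 1 - 2 * real (Suc j)) * t - 2*t"
    "(real m + 1 - 2 * real j) * t = (real m + 1 - 2 * real (Suc j)) * t + 2*t"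
    by (simp_all add: algebra_simps)
  show ?thesis unfolding arch_def e 
    by (simp add: cosh_add cosh_diff diff_divide_distrib add_divide_distrib)
qed
lemma arch_0: "arch t m 0 = 1" by (simp add: arch_def)
lemma arch_last: "arch t m (Suc m) = 1"
proof -
  have "(real m + 1 - 2 * real (Suc m)) * t = - ((real m + 1) * t)" by (simp add: algebra_simps)
  then show ?thesis unfolding arch_def by simp
qed
lemma cn_nz: "cn t m \<noteq> 0" by (simp add: cn_def)
lemma sn_nz: "t > 0 \<Longrightarrow> m > 0 \<Longrightarrow> sn t m \<noteq> 0" by (simp add: sn_def)

text \<open>
  The vector whose last nonzero entry is 1, at position \<open>i\<close>, and that solves \<open>(L - x) y = 0\<close> at
  all earlier positions.  Inside a cycle or the path it is supported on the part of that block up to \<open>i\<close>; for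
  the hub it solves the equation at all other vertices.
\<close>

definition elim_vec :: "real \<Rightarrow> nat \<Rightarrow> nat \<Rightarrow> real" where
  "elim_vec t i j =
    (if i < a then (if j \<le> i then sn t (Suc j) / sn t (Suc i) else 0)
     else if i < a+b then (if a \<le> j \<and> j \<le> i then sn t (Suc j - a) / sn t (Suc i - a) else 0)
     else if i < hub then (if a+b \<le> j \<and> j \<le> i then cn t (j-a-b) / cn t (i-a-b) else 0)
     else if j < a then arch t a (Suc j) else if j < a+b then arch t b (Suc j - a) else cn t (j-a-b) / cn t k)"

definition pivot :: "real \<Rightarrow> nat \<Rightarrow> real" where
  "pivot t i =
    (if i < a then sn t (Suc (Suc i)) / sn t (Suc i)
     else if i < a+b then sn t (Suc (Suc i) - a) / sn t (Suc i - a)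
     else if i < hub then cn t (Suc i-a-b) / cn t (i-a-b)
     else 3 + 2 * cosh (2*t) - 2 * arch t a 1 - 2 * arch t b 1 - cn t (k-1) / cn t k)"

text \<open>
  The rows of \<open>L - x\<close> for \<open>x = 2 - 2 cosh 2t\<close>.
\<close>

definition shifted_row :: "real \<Rightarrow> (nat \<Rightarrow> real) \<Rightarrow> nat \<Rightarrow> real" where
  "shifted_row t g j = (real (deg Adj j) + 2 * cosh (2*t) - 2) * g j - (\<Sum>l | Adj j l. g l)"

lemma shifted_row_cycle1:
  assumes "j < a"
  shows "shifted_row t g j = 2 * cosh (2*t) * g j - g (if j = 0 then hub else j-1) - g (if j = a-1 then hub else Suc j)"
  using assms a b k by (auto simp: shifted_row_def nbrs_cycle1 deg_inner)
lemma shifted_row_cycle2: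
  assumes "a \<le> j" "j < a+b"
  shows "shifted_row t g j = 2 * cosh (2*t) * g j - g (if j = a then hub else j-1) - g (if j = a+b-1 then hub else Suc j)"
  using assms a b k by (auto simp: shifted_row_def nbrs_cycle2 deg_inner)
lemma shifted_row_path:
  assumes "a+b < j" "j < hub"
  shows "shifted_row t g j = 2 * cosh (2*t) * g j - g (j-1) - g (Suc j)"
  using assms a b k by (auto simp: shifted_row_def nbrs_path deg_inner)
lemma shifted_row_leaf: "shifted_row t g (a+b) = (2 * cosh (2*t) - 1) * g (a+b) - g (Suc (a+b))"
  using a b k by (auto simp: shifted_row_def nbrs_path deg_leaf algebra_simps)
lemma shifted_row_hub: "shifted_row t g hub = (3 + 2 * cosh (2*t)) * g hub - g 0 - g (a-1) - g a - g (a+b-1) - g (hub-1)"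
  by (simp add: shifted_row_def sum_nbrs_hub deg_hub)

lemma shifted_row_elim_vec:
  assumes "j \<le> i" "i \<le> hub" and t: "t > 0"
  shows "shifted_row t (elim_vec t i) j = (if j = i then pivot t i else 0)"
proof -
  consider "i < a" | "a \<le> i" "i < a+b" | "a+b \<le> i" "i < hub" | "i = hub" using assms by linarith
  then show ?thesis
  proof cases
    case 1
    then have "j < a" using assms by simp
    have e1: "elim_vec t i (if j = 0 then hub else j-1) = sn t j / sn t (Suc i)"
      using 1 assms by (auto simp: elim_vec_def sn_0)
    have e2: "elim_vec t i (if j = a-1 then hub else Suc j) = (if j = i then 0 else sn t (Suc (Suc j)) / sn t (Suc i))"
      using 1 assms by (auto simp: elim_vec_def)
    have e3: "elim_vec t i j = sn t (Suc j) / sn t (Suc i)" using 1 assms by (simp add: elim_vec_def)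
    show ?thesis unfolding shifted_row_cycle1[OF \<open>j < a\<close>] e1 e2 e3
      using 1 sn_rec[of t j] sn_nz[OF t, of "Suc i"] by (auto simp: pivot_def diff_divide_distrib)
  next
    case 2
    show ?thesis
    proof (cases "j < a")
      case True
      then show ?thesis using 2 assms a b k by (auto simp: shifted_row_cycle1 elim_vec_def)
    next
      case False
      then obtain m where m: "j = a + m" using le_Suc_ex not_less by blast
      obtain l where l: "i = a + l" using 2 le_Suc_ex by blast
      have e1: "elim_vec t i (if j = a then hub else j-1) = sn t m / sn t (Suc l)"
        using 2 m l assms by (auto simp: elim_vec_def sn_0 Suc_diff_le)
      have e2: "elim_vec t i (if j = a+b-1 then hub else Suc j) = (if m = l then 0 else sn t (Suc (Suc m)) / sn t (Suc l))"
        using 2 m l assms by (auto simp: elim_vec_def)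
      have e3: "elim_vec t i j = sn t (Suc m) / sn t (Suc l)"
        using 2 m l assms by (auto simp: elim_vec_def)
      have j: "a \<le> j" "j < a+b" using 2 m assms by auto
      show ?thesis unfolding shifted_row_cycle2[OF j] e1 e2 e3
        using 2 m l sn_rec[of t m] sn_nz[OF t, of "Suc l"] by (auto simp: pivot_def diff_divide_distrib)
    qed
  next
    case 3
    consider "j < a" | "a \<le> j" "j < a+b" | "a+b \<le> j" by linarith
    then show ?thesis
    proof cases
      case 1
      then show ?thesis using 3 assms a b k by (auto simp: shifted_row_cycle1 elim_vec_def)
    next
      case 2
      then show ?thesis using 3 assms a b k by (auto simp: shifted_row_cycle2 elim_vec_def)
    next
      case j: 3
      obtain l where l: "i = a + b + l" using 3 le_Suc_ex by blast
      obtain m where m: "j = a + b + m" using j le_Suc_ex by blast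
      have g: "elim_vec t i (a+b+l') = (if l' \<le> l then cn t l' / cn t l else 0)" for l'
        using 3 l by (simp add: elim_vec_def)
      have ml: "m \<le> l" using m l assms by simp
      show ?thesis
      proof (cases m)
        case 0
        then show ?thesis using 3 m l g[of 0] g[of 1] cn_1[of t] cn_nz[of t l]
          by (cases l) (auto simp: shifted_row_leaf pivot_def)
      next
        case (Suc m')
        then show ?thesis using 3 ml m l g[of m'] g[of "Suc m'"] g[of "Suc (Suc m')"] cn_rec[of t m'] cn_nz[of t l]
          by (cases "m = l") (auto simp: shifted_row_path pivot_def diff_divide_distrib)
      qed
    qed
  next
    case i: 4
    consider "j < a" | "a \<le> j" "j < a+b" | "a+b \<le> j" "j < hub" | "j = hub" using assms by linarith
    then show ?thesis
    proof cases
      case 1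
      have "elim_vec t hub (if j = 0 then hub else j-1) = arch t a j"
        using 1 a b k by (auto simp: elim_vec_def arch_0 cn_nz)
      moreover have "elim_vec t hub (if j = a-1 then hub else Suc j) = arch t a (Suc (Suc j))"
        using 1 a b k by (auto simp: elim_vec_def arch_last cn_nz)
      moreover have "elim_vec t hub j = arch t a (Suc j)" using 1 by (simp add: elim_vec_def)
      ultimately show ?thesis using 1 i by (simp add: shifted_row_cycle1 arch_rec del: if_split)
    next
      case 2
      then obtain m where m: "j = a + m" using le_Suc_ex by blast
      have "elim_vec t hub (if j = a then hub else j-1) = arch t b m"
        using 2 m a b k by (auto simp: elim_vec_def arch_0 cn_nz)
      moreover have "Suc m = b" if "j = a+b-1" using that 2 m by simp
      then have "elim_vec t hub (if j = a+b-1 then hub else Suc j) = arch t b (Suc (Suc m))"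
        using 2 m a b k by (auto simp: elim_vec_def arch_last cn_nz)
      moreover have "elim_vec t hub j = arch t b (Suc m)" using 2 m by (simp add: elim_vec_def)
      ultimately show ?thesis using 2 i by (simp add: shifted_row_cycle2 arch_rec del: if_split)
    next
      case 3
      then obtain m where m: "j = a + b + m" using le_Suc_ex by blast
      have g: "elim_vec t hub (a+b+l) = cn t l / cn t k" for l by (simp add: elim_vec_def)
      show ?thesis
      proof (cases m)
        case 0
        then show ?thesis using 3 m i g[of 0] g[of 1] cn_1[of t] cn_nz[of t k] k
          by (simp add: shifted_row_leaf)
      next
        case (Suc m')
        then show ?thesis using 3 m i g[of m'] g[of "Suc m'"] g[of "Suc (Suc m')"] cn_rec[of t m'] cn_nz[of t k] k
          by (simp add: shifted_row_path diff_divide_distrib)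
      qed
    next
      case 4
      have "arch t a a = arch t a 1"
      proof -
        have "(real a + 1 - 2 * real a) * t = - ((real a + 1 - 2 * real 1) * t)" by (simp add: algebra_simps)
        then show ?thesis unfolding arch_def by simp
      qed
      moreover have "arch t b b = arch t b 1"
      proof -
        have "(real b + 1 - 2 * real b) * t = - ((real b + 1 - 2 * real 1) * t)" by (simp add: algebra_simps)
        then show ?thesis unfolding arch_def by simp
      qed
      ultimately show ?thesis using a b k 4 i cn_nz[of t k]
        by (auto simp: shifted_row_hub elim_vec_def pivot_def)
    qed
  qed
qed

lemma det_laplacian_shift:
  assumes t: "t > 0"
  shows "det (laplacian (Suc hub) Adj + (2 * cosh (2*t) - 2) \<cdot>\<^sub>m 1\<^sub>m (Suc hub)) = (\<Prod>i<Suc hub. pivot t i)"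
proof (rule det_by_unitriangular[where h = "elim_vec t" and c = "pivot t"])
  let ?M = "laplacian (Suc hub) Adj + (2 * cosh (2*t) - 2) \<cdot>\<^sub>m 1\<^sub>m (Suc hub)"
  show "?M \<in> carrier_mat (Suc hub) (Suc hub)" using laplacian_carrier by simp
  have r: "(\<Sum>l<Suc hub. ?M $$ (j, l) * g l) = shifted_row t g j" if "j < Suc hub" for j g
  proof -
    have "(\<Sum>l<Suc hub. ?M $$ (j, l) * g l) = (\<Sum>l<Suc hub. laplacian (Suc hub) Adj $$ (j, l) * g l + (if l = j then (2 * cosh (2*t) - 2) * g l else 0))"
      using that laplacian_carrier by (intro sum.cong) (auto simp: algebra_simps)
    also have "\<dots> = shifted_row t g j"
      using that laplacian_row_sum[OF that, of g] by (simp add: sum.distrib shifted_row_def algebra_simps del: sum.lessThan_Suc)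
    finally show ?thesis .
  qed
  show "(\<Sum>l<Suc hub. ?M $$ (j, l) * elim_vec t i l) = 0" if "j < i" "i < Suc hub" for i j
    using that t by (subst r) (auto simp: shifted_row_elim_vec)
  show "(\<Sum>l<Suc hub. ?M $$ (i, l) * elim_vec t i l) = pivot t i" if "i < Suc hub" for i
    using that t by (subst r) (auto simp: shifted_row_elim_vec)
  show "elim_vec t i i = 1" if "i < Suc hub" for i
    using that sn_nz[OF t] cn_nz by (cases "i = hub") (auto simp: elim_vec_def)
  show "elim_vec t i j = 0" if "i < j" "j < Suc hub" for i j using that by (auto simp: elim_vec_def)
qed

text \<open>
  Within each block the pivots are quotients of consecutive values, so their products telescope.
\<close>

lemma prod_pivot:
  assumes t: "t > 0"
  shows "(\<Prod>i<Suc hub. pivot t i) = sn t (Suc a) / sn t 1 * (sn t (Suc b) / sn t 1) * (cn t k / cn t 0) * pivot t hub"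
proof -
  have "(\<Prod>i<m. sn t (Suc (Suc i)) / sn t (Suc i)) = sn t (Suc m) / sn t 1" for m
    by (induction m) (use sn_nz[OF t] in auto)
  then have 1: "(\<Prod>i<a. pivot t i) = sn t (Suc a) / sn t 1" and 
    2: "(\<Prod>i<b. pivot t (a+i)) = sn t (Suc b) / sn t 1" by (simp_all add: pivot_def Suc_diff_le)
  have "(\<Prod>i<m. cn t (Suc i) / cn t i) = cn t m / cn t 0" for m
    by (induction m) (use cn_nz in auto)
  then have 3: "(\<Prod>i<k. pivot t (a+b+i)) = cn t k / cn t 0" by (simp add: pivot_def)
  have split: "(\<Prod>i<m+l. f i) = (\<Prod>i<m. f i) * (\<Prod>i<l. f (m+i))" for m l and f :: "nat \<Rightarrow> real"
    by (induction l) (auto simp: mult.assoc)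
  show ?thesis by (simp add: split 1 2 3)
qed

lemma cosh_double_sinh: "cosh (2 * x) = 1 + 2 * (sinh x)\<^sup>2" for x :: real
  by (simp add: cosh_double_cosh cosh_square_eq)

theorem propeller_fun_eq_det:
  assumes t: "t > 0"
  shows "propeller_fun (2 * (int a + 1)) (2 * (int b + 1)) (2 * int k + 1) t =
    det (laplacian (Suc hub) Adj + (2 * cosh (2*t) - 2) \<cdot>\<^sub>m 1\<^sub>m (Suc hub)) * sinh (2*t) * (cosh t)^2"
proof -
  define p q K :: real where "p = real a + 1" and "q = real b + 1" and "K = 2 * real k + 1"
  have H1: "arch t a 1 = cosh (2*t) - sinh (2*t) * sinh (p*t) / cosh (p*t)"
  proof -
    have "(real a + 1 - 2 * real 1) * t = p * t - 2*t" by (simp add: p_def algebra_simps)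
    then show ?thesis by (simp only: arch_def p_def[symmetric] cosh_diff) (simp add: diff_divide_distrib)
  qed
  have H2: "arch t b 1 = cosh (2*t) - sinh (2*t) * sinh (q*t) / cosh (q*t)"
  proof -
    have "(real b + 1 - 2 * real 1) * t = q * t - 2*t" by (simp add: q_def algebra_simps)
    then show ?thesis by (simp only: arch_def q_def[symmetric] cosh_diff) (simp add: diff_divide_distrib)
  qed
  have H3: "cn t (k-1) / cn t k = cosh (2*t) - sinh (2*t) * sinh (K*t) / cosh (K*t)"
  proof -
    have "(2 * real (k-1) + 1) * t = K * t - 2*t" using k by (simp add: K_def of_nat_diff algebra_simps)
    then show ?thesis by (simp only: cn_def K_def[symmetric] cosh_diff) (simp add: diff_divide_distrib)
  qed
  have "pivot t hub = 3 - 3 * cosh (2*t) + sinh (2*t) * (2 * (sinh (p*t) / cosh (p*t)) + 2 * (sinh (q*t) / cosh (q*t)) + sinh (K*t) / cosh (K*t))"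
    unfolding pivot_def H1 H2 H3 by (simp add: algebra_simps)
  also have "cosh (2*t) = 1 + sinh (2*t) * (sinh t / cosh t)"
    by (simp only: cosh_double_sinh sinh_double) (simp add: power2_eq_square)
  finally have pu: "pivot t hub = sinh (2*t) * (2 * (sinh (p*t) / cosh (p*t)) + 2 * (sinh (q*t) / cosh (q*t)) + sinh (K*t) / cosh (K*t) - 3 * (sinh t / cosh t))"
    by (simp add: algebra_simps)
  have "sn t (Suc a) = sinh (2*(p*t))" "sn t (Suc b) = sinh (2*(q*t))"
    by (simp_all add: sn_def p_def q_def algebra_simps)
  then have SS: "sn t (Suc a) = 2 * sinh (p*t) * cosh (p*t)" "sn t (Suc b) = 2 * sinh (q*t) * cosh (q*t)"
    "sn t 1 = sinh (2*t)" "cn t k = cosh (K*t)" "cn t 0 = cosh t"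
    by (simp_all only: sinh_double[of "p*t"] sinh_double[of "q*t"]) (simp_all add: sn_def cn_def K_def)
  have nz: "sinh (2*t) \<noteq> 0" using t by simp
  have I: "real_of_int (2 * (int a + 1)) * t = 2 * (p * t)" "real_of_int (2 * (int b + 1)) * t = 2 * (q*t)"
    "real_of_int (2 * int k + 1) = K"
    by (simp_all add: p_def q_def K_def algebra_simps)
  have alg: "ct * (2*sp*cp) * (2*sq*cq) * sK + 2 * ct * (1 + 2*sp\<^sup>2 - 1) * (2*sq*cq) * cK
      + 2 * ct * (2*sp*cp) * (1 + 2*sq\<^sup>2 - 1) * cK - 3 * st * (2*sp*cp) * (2*sq*cq) * cK
    = (2*sp*cp) / s * ((2*sq*cq) / s) * (cK / ct) * (s * (2*(sp/cp) + 2*(sq/cq) + sK/cK - 3*(st/ct))) * s * ct\<^sup>2"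
    if "cp \<noteq> 0" "cq \<noteq> 0" "cK \<noteq> 0" "ct \<noteq> 0" "s \<noteq> 0" for ct st sp cp sq cq sK cK s :: real
  proof -
    define x y z w where "x = sp / cp" "y = sq / cq" "z = sK / cK" "w = st / ct"
    then have "sp = x * cp" "sq = y * cq" "sK = z * cK" "st = w * ct"
      using that by simp_all
    moreover have r: "X / s * (Y / s) * (cK / ct) * (s * Z) * s * ct\<^sup>2 = X * Y * cK * ct * Z" for X Y Z
      using that by (simp add: power2_eq_square)
    ultimately show ?thesis unfolding r using that by (simp add: power2_eq_square algebra_simps)
  qed
  show ?thesis
    unfolding det_laplacian_shift[OF t] prod_pivot[OF t] pu SS propeller_fun_def I
      sinh_double[of "p*t"] sinh_double[of "q*t"] cosh_double_sinh[of "p*t"] cosh_double_sinh[of "q*t"]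
    by (rule alg) (use nz in auto)
qed

end

section \<open>Propeller graphs are determined by their Laplacian spectra\<close>

lemma cospectral_det_shift:
  fixes M N :: "real mat"
  assumes M: "M \<in> carrier_mat n n" and N: "N \<in> carrier_mat n n" and cp: "char_poly M = char_poly N"
  shows "det (M + c \<cdot>\<^sub>m 1\<^sub>m n) = det (N + c \<cdot>\<^sub>m 1\<^sub>m n)"
proof -
  have d: "poly (char_poly K) (- c) = (- 1) ^ n * det (K + c \<cdot>\<^sub>m 1\<^sub>m n)" if K: "K \<in> carrier_mat n n" for K :: "real mat"
  proof -
    have "- char_matrix K (- c) = (- 1) \<cdot>\<^sub>m (K + c \<cdot>\<^sub>m 1\<^sub>m n)"
      by (rule eq_matI) (use K in \<open>auto simp: char_matrix_def\<close>)
    then have "poly (char_poly K) (- c) = det ((- 1) \<cdot>\<^sub>m (K + c \<cdot>\<^sub>m 1\<^sub>m n))"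
      using char_poly_matrix[OF K, of "- c"] by simp
    also have "\<dots> = (- 1) ^ n * det (K + c \<cdot>\<^sub>m 1\<^sub>m n)"
      unfolding det_smult using K by simp
    finally show ?thesis .
  qed
  have "(- 1) ^ n * det (M + c \<cdot>\<^sub>m 1\<^sub>m n) = (- 1) ^ n * det (N + c \<cdot>\<^sub>m 1\<^sub>m n)"
    using d[OF M] d[OF N] cp by simp
  then show ?thesis by simp
qed

lemma laplacian_reindex:
  assumes B: "nat_graph n B" and f: "bij_betw f {..<n} {..<n}"
    and A: "nat_graph n A" and AB: "\<And>i j. i < n \<Longrightarrow> j < n \<Longrightarrow> B (f i) (f j) \<longleftrightarrow> A i j"
  shows "char_poly (laplacian n A) = char_poly (laplacian n B)"
proof -
  interpret A: nat_graph n A by fact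
  interpret B: nat_graph n B by fact
  define p where "p i = (if i < n then f i else i)" for i
  have inj: "inj_on f {..<n}" and im: "f ` {..<n} = {..<n}" using f by (auto simp: bij_betw_def)
  have fl: "f i < n" if "i < n" for i using im that by blast
  have "bij_betw p {..<n} {..<n}"
    using f by (rule bij_betw_cong[THEN iffD1, rotated]) (simp add: p_def)
  then have p: "p permutes {0..<n}"
    unfolding atLeast0LessThan by (rule bij_imp_permutes) (simp add: p_def)
  have fe: "f i = f j \<longleftrightarrow> i = j" if "i < n" "j < n" for i j
    using inj_on_eq_iff[OF inj, of i j] that by simp
  have dg: "deg A i = deg B (f i)" if i: "i < n" for i
  proof -
    have "{j. B (f i) j} = f ` {j. A i j}"
    proof (intro equalityI subsetI)
      fix j assume j: "j \<in> {j. B (f i) j}"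
      then have "j < n" using B.adj_less2 by blast
      then have "j \<in> f ` {..<n}" using im by simp
      then obtain j' where "j' < n" "j = f j'" by blast
      then show "j \<in> f ` {j. A i j}" using j AB[OF i] by blast
    next
      fix j assume "j \<in> f ` {j. A i j}"
      then obtain j' where "A i j'" "j = f j'" by blast
      then show "j \<in> {j. B (f i) j}" using AB[OF i A.adj_less2] by blast
    qed
    moreover have "inj_on f {j. A i j}" by (rule inj_on_subset[OF inj A.nbrs_subset])
    ultimately show ?thesis by (simp add: deg_def card_image)
  qed
  have "laplacian n A = mat n n (\<lambda>(i, j). laplacian n B $$ (p i, p j))"
    by (rule eq_matI) (simp_all add: laplacian_def p_def fl fe dg AB)
  then show ?thesis using char_poly_reindex[OF B.laplacian_carrier p] by simp
qed

text \<open>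
  The mate is a propeller graph by its degrees, and its parameters are those of the given graph
  because both have the same characteristic polynomial.  The assumption \<open>b \<le> a\<close> removes the
  ambiguity of exchanging the two cycles.
\<close>

theorem propeller_determined:
  assumes P: "propeller a b k" and ba: "b \<le> a" and B: "nat_graph n B"
    and n: "n = Suc (a + b + k)" and cp: "char_poly (laplacian n B) = char_poly (laplacian n (propeller_adj a b k))"
  obtains f where "bij_betw f {..<n} {..<n}" "\<And>i j. i < n \<Longrightarrow> j < n \<Longrightarrow> B (f i) (f j) \<longleftrightarrow> propeller_adj a b k i j"
proof -
  interpret A: propeller a b k by fact
  interpret B: nat_graph n B by fact
  obtain h l where h: "h < n" "deg B h = 5" and l: "l < n" "l \<noteq> h" "deg B l = 1"
    and two: "\<And>i. i < n \<Longrightarrow> i \<noteq> h \<Longrightarrow> i \<noteq> l \<Longrightarrow> deg B i = 2"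
    using A.cospectral_mate_degrees(1)[OF B[unfolded n] cp[unfolded n]] unfolding n by blast
  note conn = A.cospectral_mate_degrees(2)[OF B[unfolded n] cp[unfolded n], folded n]
  obtain a' b' k' f where *: "a' \<ge> 2" "b' \<ge> 2" "k' \<ge> 1" "b' \<le> a'" "n = Suc (a' + b' + k')"
    and f: "bij_betw f {..<n} {..<n}" and BA: "\<And>i j. i < n \<Longrightarrow> j < n \<Longrightarrow> B (f i) (f j) \<longleftrightarrow> propeller_adj a' b' k' i j"
    by (rule B.propeller_structure[OF h l two conn]) (assumption+, rule that, assumption+)
  interpret A': propeller a' b' k' by unfold_locales (use * in auto)
  have A': "nat_graph n (propeller_adj a' b' k')" using A'.nat_graph_axioms * by simp
  have cp': "char_poly (laplacian n (propeller_adj a' b' k')) = char_poly (laplacian n (propeller_adj a b k))"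
    using laplacian_reindex[OF B f A' BA] cp by simp
  have Ac: "laplacian n (propeller_adj a b k) \<in> carrier_mat n n" and Ac': "laplacian n (propeller_adj a' b' k') \<in> carrier_mat n n"
    by (simp_all add: laplacian_def)
  have "propeller_fun (2 * (int a + 1)) (2 * (int b + 1)) (2 * int k + 1) t = propeller_fun (2 * (int a' + 1)) (2 * (int b' + 1)) (2 * int k' + 1) t"
    if "t > 0" for t
    unfolding A.propeller_fun_eq_det[OF that] A'.propeller_fun_eq_det[OF that] n[symmetric] *(5)[symmetric]
    by (simp only: cospectral_det_shift[OF Ac Ac' cp'[symmetric]])
  then have "2 * (int a + 1) = 2 * (int a' + 1) \<and> 2 * (int b + 1) = 2 * (int b' + 1) \<and> 2 * int k + 1 = 2 * int k' + 1"
    by (intro propeller_fun_inj) (use * n ba A.a A.b A.k in auto)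
  then have eqs: "a' = a" "b' = b" "k' = k" by auto
  show thesis by (rule that[OF f BA[unfolded eqs]])
qed

lemma path_arcs_snoc_overlap: "path_arcs (xs @ v # ys) = path_arcs (xs @ [v]) \<union> path_arcs (v # ys)"
  by (induction xs rule: path_arcs.induct) auto

lemma path_arcs_rev: "path_arcs (rev xs) = path_arcs xs"
proof (induction xs rule: path_arcs.induct)
  case (1 x y xs)
  have "path_arcs (rev (x # y # xs)) = path_arcs (rev xs @ [y] @ [x])" by simp
  also have "\<dots> = path_arcs (rev xs @ [y]) \<union> path_arcs [y, x]"
    using path_arcs_snoc_overlap[of "rev xs" y "[x]"] by simp
  finally show ?case using 1 by auto
qed auto

lemma cycle_arcs_at:
  assumes "bs @ as \<noteq> []"
  shows "cycle_arcs (as @ v # bs) = path_arcs (bs @ as) \<union> (\<Union>w\<in>{hd (bs @ as), last (bs @ as)}. {(v, w), (w, v)})"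
proof -
  consider "as = []" "bs \<noteq> []" | "as \<noteq> []" "bs = []" | "as \<noteq> []" "bs \<noteq> []" using assms by auto
  then show ?thesis
  proof cases
    case 1
    have "path_arcs (v # bs) = path_arcs bs \<union> {(v, hd bs), (hd bs, v)}"
      using path_arcs_append[of "[v]" bs] 1 by simp
    then show ?thesis using 1 by (auto simp: cycle_arcs_def)
  next
    case 2
    have "path_arcs (as @ [v]) = path_arcs as \<union> {(last as, v), (v, last as)}"
      using path_arcs_append[of as "[v]"] 2 by simp
    then show ?thesis using 2 by (auto simp: cycle_arcs_def)
  next
    case 3
    have "path_arcs (v # bs) = path_arcs bs \<union> {(v, hd bs), (hd bs, v)}"
      using path_arcs_append[of "[v]" bs] 3 by simp
    moreover have "path_arcs (as @ [v]) = path_arcs as \<union> {(last as, v), (v, last as)}"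
      using path_arcs_append[of as "[v]"] 3 by simp
    moreover have "path_arcs (bs @ as) = path_arcs bs \<union> path_arcs as \<union> {(last bs, hd as), (hd as, last bs)}"
      using path_arcs_append[of bs as] 3 by simp
    moreover have "path_arcs (as @ v # bs) = path_arcs (as @ [v]) \<union> path_arcs (v # bs)"
      by (rule path_arcs_snoc_overlap)
    moreover have "last (as @ v # bs) = last bs" "hd (as @ v # bs) = hd as" "hd (bs @ as) = hd bs" "last (bs @ as) = last as"
      using 3 by simp_all
    ultimately show ?thesis unfolding cycle_arcs_def by auto
  qed
qed

definition nth_adj :: "'a list \<Rightarrow> ('a \<times> 'a) set \<Rightarrow> nat \<Rightarrow> nat \<Rightarrow> bool" where
  "nth_adj vs E i j \<longleftrightarrow> i < length vs \<and> j < length vs \<and> (vs ! i, vs ! j) \<in> E"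

lemma propeller_graph_enumeration:
  assumes "propeller_graph G"
  obtains vs a b k where "distinct vs" "set vs = pverts G" "propeller a b k" "b \<le> a" "length vs = Suc (a + b + k)"
    "nth_adj vs (parcs G) = propeller_adj a b k"
proof -
  note result = that
  obtain cs ds ps u where d: "distinct cs" "length cs \<ge> 3" "distinct ds" "length ds \<ge> 3"
    "distinct ps" "length ps \<ge> 1" and u: "set cs \<inter> set ds = {u}"
    and dis: "set ps \<inter> (set cs \<union> set ds) = {}"
    and V: "pverts G = set cs \<union> set ds \<union> set ps"
    and E: "parcs G = cycle_arcs cs \<union> cycle_arcs ds \<union> path_arcs ps \<union> {(u, hd ps), (hd ps, u)}"
    using assms unfolding propeller_graph_def by blast
  have "u \<in> set cs" "u \<in> set ds" using u by blast+
  then obtain c1 c2 d1 d2 where cs: "cs = c1 @ u # c2" and ds: "ds = d1 @ u # d2"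
    by (meson split_list)
  define xs ys zs where "xs = c2 @ c1" and "ys = d2 @ d1" and "zs = rev ps"
  have len: "length xs \<ge> 2" "length ys \<ge> 2" "length zs \<ge> 1"
    using d(2,4,6) by (simp_all add: cs ds xs_def ys_def zs_def)
  have pne: "ps \<noteq> []" using d(6) by auto
  have sc: "set cs = insert u (set xs)" "set ds = insert u (set ys)" "set ps = set zs"
    by (auto simp: cs ds xs_def ys_def zs_def)
  have dx: "distinct xs" "u \<notin> set xs" and dy: "distinct ys" "u \<notin> set ys" and dz: "distinct zs"
    using d(1,3,5) by (auto simp: cs ds xs_def ys_def zs_def)
  have xy: "set xs \<inter> set ys = {}" using u dx(2) dy(2) unfolding sc by auto
  have z: "set zs \<inter> set xs = {}" "set zs \<inter> set ys = {}" "u \<notin> set zs" using dis unfolding sc by blast+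
  have dist: "distinct (xs @ ys @ zs @ [u])" "distinct (ys @ xs @ zs @ [u])"
    using dx dy dz xy z by auto
  have sets: "set (xs @ ys @ zs @ [u]) = pverts G" "set (ys @ xs @ zs @ [u]) = pverts G"
    unfolding V sc by auto
  have ne: "c2 @ c1 \<noteq> []" "d2 @ d1 \<noteq> []" using len by (auto simp: xs_def ys_def)
  have hz: "hd ps = last zs" using pne by (simp add: zs_def last_rev)
  have E1: "parcs G = path_arcs xs \<union> path_arcs ys \<union> path_arcs zs \<union>
      (\<Union>w\<in>{hd xs, last xs, hd ys, last ys, last zs}. {(u, w), (w, u)})"
    unfolding E cs ds cycle_arcs_at[OF ne(1)] cycle_arcs_at[OF ne(2)] hz
      xs_def[symmetric] ys_def[symmetric]
    unfolding zs_def path_arcs_rev by auto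
  \<comment> \<open>the same description with the two cycles exchanged, for the case that the second is the longer one\<close>
  have E2: "parcs G = path_arcs ys \<union> path_arcs xs \<union> path_arcs zs \<union>
      (\<Union>w\<in>{hd ys, last ys, hd xs, last xs, last zs}. {(u, w), (w, u)})"
    unfolding E1 by auto
  have main: thesis if E: "parcs G = path_arcs xs \<union> path_arcs ys \<union> path_arcs zs \<union>
      (\<Union>w\<in>{hd xs, last xs, hd ys, last ys, last zs}. {(u, w), (w, u)})"
    and dist: "distinct (xs @ ys @ zs @ [u])" and sets: "set (xs @ ys @ zs @ [u]) = pverts G"
    and l: "length xs \<ge> 2" "length ys \<ge> 2" and le: "length ys \<le> length xs" for xs ys
  proof -
    let ?l = "xs @ ys @ zs @ [u]"
    have P: "propeller (length xs) (length ys) (length zs)" by unfold_locales (use l len in auto)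
    interpret propeller "length xs" "length ys" "length zs" by (rule P)
    have n: "length ?l = Suc (length xs + length ys + length zs)" by simp
    have "nth_adj ?l (parcs G) i j \<longleftrightarrow> propeller_adj (length xs) (length ys) (length zs) i j" for i j
    proof (cases "i < length ?l \<and> j < length ?l")
      case True
      then show ?thesis using propeller_arcs_nth[OF dist l len(3) E, of i j] unfolding nth_adj_def by blast
    next
      case False
      then show ?thesis using adj_less[of i j] adj_less2[of i j] unfolding nth_adj_def n by blast
    qed
    then have "nth_adj ?l (parcs G) = propeller_adj (length xs) (length ys) (length zs)" by blast
    then show thesis by (rule result[OF dist sets P le n])
  qed
  show thesis
  proof (cases "length ys \<le> length xs")
    case True
    show thesis by (rule main[OF E1 dist(1) sets(1) len(1,2) True])
  next
    case False
    then have "length xs \<le> length ys" by simp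
    then show thesis by (rule main[OF E2 dist(2) sets(2) len(2,1)])
  qed
qed

lemma pair_graph_nth_adj:
  assumes G: "pair_graph G" and vs: "distinct vs" "set vs = pverts G"
  shows "nat_graph (length vs) (nth_adj vs (parcs G))"
    and "laplacian_mat vs G = laplacian (length vs) (nth_adj vs (parcs G))"
proof -
  interpret pair_graph G by fact
  have sym: "(x, y) \<in> parcs G \<Longrightarrow> (y, x) \<in> parcs G" for x y
    using symmetric_conv arc_to_ends_def by (auto simp: arcs_symmetric) 
  have irr: "(x, x) \<notin> parcs G" for x using no_loops[of "(x, x)"] by auto
  show ng: "nat_graph (length vs) (nth_adj vs (parcs G))"
  proof
    show "nth_adj vs (parcs G) j i" if "nth_adj vs (parcs G) i j" for i j
      using that sym unfolding nth_adj_def by blast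
    show "i < length vs" if "nth_adj vs (parcs G) i j" for i j
      using that unfolding nth_adj_def by blast
    show "\<not> nth_adj vs (parcs G) i i" for i using irr unfolding nth_adj_def by blast
  qed
  have dg: "out_degree (with_proj G) (vs ! i) = deg (nth_adj vs (parcs G)) i" if i: "i < length vs" for i
  proof -
    have "out_arcs (with_proj G) (vs ! i) = (\<lambda>j. (vs ! i, vs ! j)) ` {j. nth_adj vs (parcs G) i j}"
    proof (intro equalityI subsetI)
      fix e assume "e \<in> out_arcs (with_proj G) (vs ! i)"
      then obtain w where e: "e = (vs ! i, w)" "(vs ! i, w) \<in> parcs G"
        by (cases e) (auto simp: out_arcs_def)
      then have "w \<in> set vs" using in_arcsD2 vs by auto
      then obtain j where "j < length vs" "w = vs ! j" by (auto simp: in_set_conv_nth)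
      then show "e \<in> (\<lambda>j. (vs ! i, vs ! j)) ` {j. nth_adj vs (parcs G) i j}"
        using e i by (auto simp: nth_adj_def)
    qed (auto simp: out_arcs_def nth_adj_def)
    moreover have "inj_on (\<lambda>j. (vs ! i, vs ! j)) {j. nth_adj vs (parcs G) i j}"
      using vs(1) by (auto simp: inj_on_def nth_adj_def nth_eq_iff_index_eq)
    ultimately show ?thesis by (simp add: out_degree_def deg_def card_image)
  qed
  show "laplacian_mat vs G = laplacian (length vs) (nth_adj vs (parcs G))"
    by (rule eq_matI) (auto simp: laplacian_mat_def degree_mat_def adjacency_mat_def laplacian_def dg nth_adj_def irr)
qed

text \<open>
  The characteristic polynomial is monic and splits over the complex numbers.
\<close>

lemma mat_spectrum_determines_char_poly:
  assumes A: "A \<in> carrier_mat n n" and B: "B \<in> carrier_mat m m" and eq: "mat_spectrum A = mat_spectrum B"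
  shows "n = m" "char_poly A = char_poly B"
proof -
  let ?c = "\<lambda>M. char_poly (map_mat complex_of_real M)"
  have cA: "degree (?c A) = n" "lead_coeff (?c A) = 1" and cB: "degree (?c B) = m" "lead_coeff (?c B) = 1"
    using degree_monic_char_poly[of "map_mat complex_of_real A" n] degree_monic_char_poly[of "map_mat complex_of_real B" m] A B
    by auto
  have e: "proots (?c A) = proots (?c B)" using eq by (simp add: mat_spectrum_def)
  then show "n = m" using size_proots_complex[of "?c A"] size_proots_complex[of "?c B"] cA cB by simp
  have "?c A = ?c B"
    using complex_poly_decompose_multiset[of "?c A"] complex_poly_decompose_multiset[of "?c B"] cA cB e by simp
  then have "map_poly complex_of_real (char_poly A) = map_poly complex_of_real (char_poly B)"
    using of_real_hom.char_poly_hom[OF A] of_real_hom.char_poly_hom[OF B] by metis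
  then show "char_poly A = char_poly B"
    by (intro poly_eqI) (metis coeff_map_poly of_real_0 of_real_eq_iff)
qed

theorem theorem1p1:
  fixes G :: "'a pair_pre_digraph" and H :: "'b pair_pre_digraph"
  assumes "propeller_graph G"
    and "pair_graph H"
    and "L_spectrum H = L_spectrum G"
  shows "digraph_iso (with_proj H) (with_proj G)"
proof -
  have G: "pair_graph G" using assms(1) by (rule propeller_graph_imp_pair_graph)
  interpret H: pair_graph H by fact
  obtain vs a b k where vs: "distinct vs" "set vs = pverts G" and P: "propeller a b k" "b \<le> a"
    and len: "length vs = Suc (a + b + k)" and adj: "nth_adj vs (parcs G) = propeller_adj a b k"
    by (rule propeller_graph_enumeration[OF assms(1)])
  obtain ws where ws: "set ws = pverts H" "distinct ws"
    using finite_distinct_list[OF H.pair_finite_verts] by blast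
  let ?B = "nth_adj ws (parcs H)"
  note LG = pair_graph_nth_adj[OF G vs] and LH = pair_graph_nth_adj[OF assms(2) ws(2,1)]
  have c: "laplacian m A \<in> carrier_mat m m" for m A by (simp add: laplacian_def)
  have "mat_spectrum (laplacian (length ws) ?B) = mat_spectrum (laplacian (length vs) (propeller_adj a b k))"
    using assms(3) unfolding L_spectrum_eq[OF vs] L_spectrum_eq[OF ws(2,1)] LG(2) LH(2) adj .
  then have n: "length ws = length vs"
    and cp: "char_poly (laplacian (length ws) ?B) = char_poly (laplacian (length vs) (propeller_adj a b k))"
    by (rule mat_spectrum_determines_char_poly[OF c c])+
  obtain f where f: "bij_betw f {..<length ws} {..<length ws}"
    and BA: "\<And>i j. i < length ws \<Longrightarrow> j < length ws \<Longrightarrow> ?B (f i) (f j) \<longleftrightarrow> propeller_adj a b k i j"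
    by (rule propeller_determined[OF P LH(1) _ cp[folded n]]) (use n len in simp_all)
  have bw: "bij_betw ((!) ws) {..<length ws} (pverts H)" using bij_betw_nth[OF ws(2) refl] ws(1) by simp
  have bv: "bij_betw ((!) vs) {..<length ws} (pverts G)" using bij_betw_nth[OF vs(1) refl] vs(2) n by simp
  define g where "g = (!) vs \<circ> inv_into {..<length ws} ((!) ws \<circ> f)"
  have bwf: "bij_betw ((!) ws \<circ> f) {..<length ws} (pverts H)" by (rule bij_betw_trans[OF f bw])
  have bg: "bij_betw g (pverts H) (pverts G)"
    unfolding g_def by (rule bij_betw_trans[OF bij_betw_inv_into[OF bwf] bv])
  have "(x, y) \<in> parcs H \<longleftrightarrow> (g x, g y) \<in> parcs G" if xy: "x \<in> pverts H" "y \<in> pverts H" for x y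
  proof -
    have "\<exists>i<length ws. w = ws ! f i" if "w \<in> pverts H" for w
    proof -
      have "w \<in> ((!) ws \<circ> f) ` {..<length ws}" using that bij_betw_imp_surj_on[OF bwf] by simp
      then show ?thesis by auto
    qed
    then obtain i j where i: "i < length ws" "x = ws ! f i" and j: "j < length ws" "y = ws ! f j"
      using xy by blast
    have g: "g x = vs ! i" "g y = vs ! j"
      using bij_betw_inv_into_left[OF bwf, of i] bij_betw_inv_into_left[OF bwf, of j] i j
      by (simp_all add: g_def)
    have fl: "f i < length ws" "f j < length ws" using bij_betwE[OF f] i(1) j(1) by simp_all
    have "(x, y) \<in> parcs H \<longleftrightarrow> ?B (f i) (f j)" using i j fl by (simp add: nth_adj_def)
    also have "\<dots> \<longleftrightarrow> nth_adj vs (parcs G) i j" unfolding adj by (rule BA[OF i(1) j(1)])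
    also have "\<dots> \<longleftrightarrow> (g x, g y) \<in> parcs G" unfolding g using i(1) j(1) n by (simp add: nth_adj_def)
    finally show ?thesis .
  qed
  then show ?thesis using bg digraph_iso_with_proj_iff[OF assms(2) G] by blast
qed

end
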